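(* Let $n\ge 1$. The tropicalization of the Poisson bracket on the Poisson-Lie group $U(n)^*$, i.e. the manifold $\mathcal{C}(\pi_{G^*};\Delta,\bar\Delta)\times\mathbb{T}^{n(n-1)/2}$ equipped with the constant Poisson bracket $\{\cdot,\cdot\}_\infty$, is isomorphic to the Gelfand-Zeitlin completely integrable system $\mathcal{C}_{GZ}\times\mathbb{T}^{n(n-1)/2}$. That is, there is a Poisson diffeomorphism $\mathcal{C}_{GZ}\times\mathbb{T}^{n(n-1)/2}\to\mathcal{C}(\pi_{G^*};\Delta,\bar\Delta)\times\mathbb{T}^{n(n-1)/2}$ which takes action variables to action variables, i.e. it covers a bijection $\mathcal{C}_{GZ}\to\mathcal{C}(\pi_{G^*};\Delta,\bar\Delta)$ (the coordinates $\zeta^{(k)}_l$ pull back to functions of the coordinates $\lambda^{(p)}_q$ only).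
   Context: **The Poisson-Lie group.** $B_+$ (resp. $B_-$) is the group of invertible upper (resp. lower) triangular complex $n\times n$ matrices; $g_d$ is the diagonal part of $g$. $G^*=\{(g,f)\in B_+\times B_-: g_df_d=1\}$. Let $e_{i,j}$ be the matrix units and $r=\frac12\sum_i e_{i,i}\otimes e_{i,i}+\sum_{i<j}e_{i,j}\otimes e_{j,i}$. With $g^1=g\otimes 1$, $f^2=1\otimes f$, etc., the Poisson bracket on $G^*$ is given by $\{g^1,g^2\}=[r,g^1g^2]$, $\{f^1,f^2\}=[r,f^1f^2]$, $\{g^1,f^2\}=[r,g^1f^2]$, where e.g. $\{g^1,f^2\}=X$ means that $\{g_{ij},f_{st}\}$ is the matrix element of $X$ with indices $(i,j)$ in the first tensor factor and $(s,t)$ in the second. The real form is $\{(g,f)\in G^*: f^*=g^{-1}\}$, and $\pi_{G^*}$ denotes the real Poisson structure on it with bracket $\{\cdot,\cdot\}^{\mathbb R}=i\{\cdot,\cdot\}$. The group $U(n)^*$ is this real form (the part where the diagonal entries of $g$ are positive is used below). **Coordinates.** For $n\ge k\ge l\ge 1$, $\Delta^{(k)}_l$ is the minor of $g$ with rows $n-k+1,\dots,n-k+l$ and the last $l$ columns; $\Lambda^{(k)}_l$ is the minor of $f^{-1}$ with columns $n-k+1,\dots,n-k+l$ and the last $l$ rows. On the real form $\Lambda^{(k)}_l=\overline{\Delta^{(k)}_l}$, and $\Delta^{(k)}_k$ is real. On the chart where all $\Delta^{(k)}_k>0$ and all $\Delta^{(k)}_l\neq0$ ($k>l$), the functions $\Delta^{(k)}_k\in\mathbb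 R_+$ and $\Delta^{(k)}_l\in\mathbb C^*$ ($k>l$) are coordinates. All brackets $\{u,v\}^{\mathbb R}$ of functions $u,v$ among the $\Delta^{(k)}_l,\bar\Delta^{(k)}_l$ are Laurent polynomials in these functions; write $\{u,v\}^{\mathbb R}=c(u,v)\,uv+p(u,v)$, where $c(u,v)$ is the coefficient of the monomial $uv$. **Cone.** Let $V=\mathbb R^{n(n+1)/2}$ with coordinates $\zeta^{(k)}_l$, $n\ge k\ge l\ge1$. To a Laurent monomial $m$ in the variables $\Delta^{(k)}_l,\bar\Delta^{(k)}_l$ assign the linear functional $n(m)$ on $V$ obtained by replacing products by sums and each of $\Delta^{(k)}_l,\bar\Delta^{(k)}_l$ by $\zeta^{(k)}_l$ (so exponents become coefficients). Then $\mathcal C(\pi_{G^*};\Delta,\bar\Delta)\subset V$ is the open cone of all $\zeta$ such that $\langle n(uv)-n(m),\zeta\rangle>0$ for every pair $u,v$ of coordinate functions (including conjugates) and every monomial $m$ occurring with nonzero coefficient in $p(u,v)$. **Constant bracket.** $\mathbb T^{n(n-1)/2}$ is the real torus with angle coordinates $\phi^{(k)}_l$, $n\ge k>l\ge 1$, corresponding to $\Delta^{(k)}_l=\exp(t\zeta^{(k)}_l+i\phi^{(k)}_l)$ ($\phi^{(k)}_k=0$). The bracket $\{\cdot,\cdot\}_\infty$ on $\mathcal C(\pi_{G^*};\Delta,\bar\Delta)\times\mathbb T^{n(n-1)/2}$ has $\{\zeta,\zeta\}_\infty=\{\phi,\phi\}_\infty=0$ for all pairs, and $\{\zeta^{(k)}_l,\phi^{(p)}_q\}_\infty=\frac12\,\mathrm{Im}\big(c(\Delta^{(k)}_l,\Delta^{(p)}_q)-c(\Delta^{(k)}_l,\bar\Delta^{(p)}_q)\big)$,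 which for $k=l$ equals $\mathrm{Im}\,c(\Delta^{(k)}_k,\Delta^{(p)}_q)$. **Gelfand-Zeitlin system.** $\mathcal C_{GZ}\subset\mathbb R^{n(n+1)/2}$ is the open cone with coordinates $\lambda^{(k)}_l$ ($n\ge k\ge l\ge1$) given by the interlacing inequalities $\lambda^{(k)}_l>\lambda^{(k-1)}_l>\lambda^{(k)}_{l+1}$ for $2\le k\le n$, $1\le l\le k-1$. The torus $\mathbb T^{n(n-1)/2}$ has angle coordinates $\psi^{(k)}_l$, $1\le l\le k\le n-1$. The Poisson bracket on $\mathcal C_{GZ}\times\mathbb T^{n(n-1)/2}$ is $\{\lambda^{(k)}_l,\psi^{(x)}_y\}=-\delta_{k,x}\delta_{l,y}$, with all brackets $\{\lambda,\lambda\}$ and $\{\psi,\psi\}$ equal to zero. The action variables are the $\lambda^{(k)}_l$, respectively the $\zeta^{(k)}_l$. *)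

theory Defs
  imports
    "HOL-Analysis.Analysis"
    "HOL-Library.Poly_Mapping"
    "Jordan_Normal_Form.Determinant"
    "Jordan_Normal_Form.Gauss_Jordan_Elimination"
    "Jordan_Normal_Form.Schur_Decomposition"
begin

text \<open>Matrix entries are indexed from 0, so row $n-k+1$ of the usual numbering is row $n-k$ here.\<close>

definition mat_inv :: "complex mat \<Rightarrow> complex mat" where
  "mat_inv A = the (mat_inverse A)"

definition B_plus :: "nat \<Rightarrow> complex mat set" where
  "B_plus n = {g \<in> carrier_mat n n. invertible_mat g \<and> upper_triangular g}"

definition B_minus :: "nat \<Rightarrow> complex mat set" where
  "B_minus n = {f \<in> carrier_mat n n. invertible_mat f \<and> upper_triangular (transpose_mat f)}"

definition G_star :: "nat \<Rightarrow> (complex mat \<times> complex mat) set" where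
  "G_star n = {(g, f). g \<in> B_plus n \<and> f \<in> B_minus n \<and> (\<forall>i<n. g $$ (i,i) * f $$ (i,i) = 1)}"

definition real_form :: "nat \<Rightarrow> (complex mat \<times> complex mat) set" where
  "real_form n = {(g, f) \<in> G_star n. mat_adjoint f = mat_inv g}"

text \<open>An element \<open>X\<close> of the tensor square of the matrix algebra is given by its entries
  \<open>X i j s t\<close>, with indices \<open>(i, j)\<close> in the first and \<open>(s, t)\<close> in the second tensor factor.\<close>

type_synonym tensor2 = "nat \<Rightarrow> nat \<Rightarrow> nat \<Rightarrow> nat \<Rightarrow> complex"

definition mat_unit :: "nat \<Rightarrow> nat \<Rightarrow> nat \<Rightarrow> nat \<Rightarrow> complex" where
  "mat_unit a b i j = (if i = a \<and> j = b then 1 else 0)"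

definition r_matrix :: "nat \<Rightarrow> tensor2" where
  "r_matrix n i j s t =
     1/2 * (\<Sum>a<n. mat_unit a a i j * mat_unit a a s t)
     + (\<Sum>b<n. \<Sum>a<b. mat_unit a b i j * mat_unit b a s t)"

definition tensor_mult :: "nat \<Rightarrow> tensor2 \<Rightarrow> tensor2 \<Rightarrow> tensor2" where
  "tensor_mult n X Y i j s t = (\<Sum>a<n. \<Sum>b<n. X i a s b * Y a j b t)"

definition tensor_comm :: "nat \<Rightarrow> tensor2 \<Rightarrow> tensor2 \<Rightarrow> tensor2" where
  "tensor_comm n X Y i j s t = tensor_mult n X Y i j s t - tensor_mult n Y X i j s t"

text \<open>The product of \<open>x \<otimes> 1\<close> and \<open>1 \<otimes> y\<close>.\<close>

definition tensor_of :: "complex mat \<Rightarrow> complex mat \<Rightarrow> tensor2" where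
  "tensor_of x y i j s t = x $$ (i,j) * y $$ (s,t)"

datatype entry = GEntry nat nat | FEntry nat nat

definition entries :: "nat \<Rightarrow> entry set" where
  "entries n = {GEntry i j | i j. i < n \<and> j < n} \<union> {FEntry i j | i j. i < n \<and> j < n}"

text \<open>The last clause is the third one together with skew-symmetry.\<close>

fun entry_bracket :: "nat \<Rightarrow> complex mat \<times> complex mat \<Rightarrow> entry \<Rightarrow> entry \<Rightarrow> complex" where
  "entry_bracket n (g, f) (GEntry i j) (GEntry s t) = tensor_comm n (r_matrix n) (tensor_of g g) i j s t"
| "entry_bracket n (g, f) (FEntry i j) (FEntry s t) = tensor_comm n (r_matrix n) (tensor_of f f) i j s t"
| "entry_bracket n (g, f) (GEntry i j) (FEntry s t) = tensor_comm n (r_matrix n) (tensor_of g f) i j s t"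
| "entry_bracket n (g, f) (FEntry i j) (GEntry s t) = - tensor_comm n (r_matrix n) (tensor_of g f) s t i j"

fun shift_entry :: "nat \<Rightarrow> entry \<Rightarrow> complex \<Rightarrow> complex mat \<times> complex mat \<Rightarrow> complex mat \<times> complex mat" where
  "shift_entry n (GEntry i j) z (g, f) = (mat n n (\<lambda>q. g $$ q + (if q = (i,j) then z else 0)), f)"
| "shift_entry n (FEntry i j) z (g, f) = (g, mat n n (\<lambda>q. f $$ q + (if q = (i,j) then z else 0)))"

definition entry_deriv ::
  "nat \<Rightarrow> entry \<Rightarrow> (complex mat \<times> complex mat \<Rightarrow> complex) \<Rightarrow> complex mat \<times> complex mat \<Rightarrow> complex" where
  "entry_deriv n a F p = deriv (\<lambda>z. F (shift_entry n a z p)) 0"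

text \<open>The bracket of two functions is the biderivation extending the brackets of the matrix
  entries, computed with partial derivatives in the space of all pairs of matrices. The bivector is
  tangent to \<open>G_star n\<close>, so at points of \<open>G_star n\<close> the result depends only on the restrictions
  of the functions to \<open>G_star n\<close>.\<close>

definition group_bracket ::
  "nat \<Rightarrow> (complex mat \<times> complex mat \<Rightarrow> complex) \<Rightarrow> (complex mat \<times> complex mat \<Rightarrow> complex)
     \<Rightarrow> complex mat \<times> complex mat \<Rightarrow> complex" where
  "group_bracket n F H p =
     (\<Sum>a\<in>entries n. \<Sum>b\<in>entries n. entry_deriv n a F p * entry_deriv n b H p * entry_bracket n p a b)"

definition real_bracket ::
  "nat \<Rightarrow> (complex mat \<times> complex mat \<Rightarrow> complex) \<Rightarrow> (complex mat \<times> complex mat \<Rightarrow> complex)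
     \<Rightarrow> complex mat \<times> complex mat \<Rightarrow> complex" where
  "real_bracket n F H p = \<i> * group_bracket n F H p"

definition Delta_minor :: "nat \<Rightarrow> nat \<Rightarrow> nat \<Rightarrow> complex mat \<times> complex mat \<Rightarrow> complex" where
  "Delta_minor n k l p = Determinant.det (mat l l (\<lambda>(a, b). fst p $$ (n - k + a, n - l + b)))"

definition Lambda_minor :: "nat \<Rightarrow> nat \<Rightarrow> nat \<Rightarrow> complex mat \<times> complex mat \<Rightarrow> complex" where
  "Lambda_minor n k l p =
     Determinant.det (mat l l (\<lambda>(a, b). mat_inv (snd p) $$ (n - l + a, n - k + b)))"

datatype coord = Dl nat nat | Dlbar nat nat

text \<open>The diagonal functions are real on the real form, so they are their own conjugates and are
  listed only once; with this choice Laurent expansions are unique.\<close>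

definition coords :: "nat \<Rightarrow> coord set" where
  "coords n = {Dl k l | k l. 1 \<le> l \<and> l \<le> k \<and> k \<le> n} \<union> {Dlbar k l | k l. 1 \<le> l \<and> l < k \<and> k \<le> n}"

text \<open>The complex conjugates on the real form are represented by their holomorphic extensions
  \<open>Lambda_minor\<close> to \<open>G_star n\<close>, with which they agree on the real form.\<close>

fun coord_fun :: "nat \<Rightarrow> coord \<Rightarrow> complex mat \<times> complex mat \<Rightarrow> complex" where
  "coord_fun n (Dl k l) = Delta_minor n k l"
| "coord_fun n (Dlbar k l) = Lambda_minor n k l"

definition chart :: "nat \<Rightarrow> (complex mat \<times> complex mat) set" where
  "chart n = {p \<in> real_form n.
     (\<forall>k\<in>{1..n}. Delta_minor n k k p \<in> \<real> \<and> 0 < Re (Delta_minor n k k p)) \<and>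
     (\<forall>k\<in>{1..n}. \<forall>l\<in>{1..<k}. Delta_minor n k l p \<noteq> 0)}"

text \<open>A Laurent monomial is its exponent vector, so that addition of exponent vectors is
  multiplication of monomials.\<close>

type_synonym lmonom = "coord \<Rightarrow>\<^sub>0 int"
type_synonym laurent = "lmonom \<Rightarrow>\<^sub>0 complex"

definition eval_laurent :: "laurent \<Rightarrow> (coord \<Rightarrow> complex) \<Rightarrow> complex" where
  "eval_laurent L x =
     (\<Sum>m\<in>Poly_Mapping.keys L. Poly_Mapping.lookup L m *
        (\<Prod>w\<in>Poly_Mapping.keys m. x w powi Poly_Mapping.lookup m w))"

definition laurent_in :: "coord set \<Rightarrow> laurent set" where
  "laurent_in W = {L. \<forall>m\<in>Poly_Mapping.keys L. Poly_Mapping.keys m \<subseteq> W}"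

definition bracket_laurent :: "nat \<Rightarrow> coord \<Rightarrow> coord \<Rightarrow> laurent" where
  "bracket_laurent n u v =
     (THE L. L \<in> laurent_in (coords n) \<and>
        (\<forall>p\<in>chart n. real_bracket n (coord_fun n u) (coord_fun n v) p
                      = eval_laurent L (\<lambda>w. coord_fun n w p)))"

definition prod_monom :: "coord \<Rightarrow> coord \<Rightarrow> lmonom" where
  "prod_monom u v = Poly_Mapping.single u 1 + Poly_Mapping.single v 1"

definition c_coeff :: "nat \<Rightarrow> coord \<Rightarrow> coord \<Rightarrow> complex" where
  "c_coeff n u v = Poly_Mapping.lookup (bracket_laurent n u v) (prod_monom u v)"

definition p_part :: "nat \<Rightarrow> coord \<Rightarrow> coord \<Rightarrow> laurent" where
  "p_part n u v = bracket_laurent n u v - Poly_Mapping.single (prod_monom u v) (c_coeff n u v)"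

type_synonym idx = "nat \<times> nat"

text \<open>The pair \<open>(k, l)\<close> stands for upper index \<open>k\<close> and lower index \<open>l\<close>. Real coordinate space with
  index set \<open>I\<close> is \<open>I \<rightarrow>\<^sub>E UNIV\<close>.\<close>

definition tri :: "nat \<Rightarrow> idx set" where
  "tri n = {(k, l). 1 \<le> l \<and> l \<le> k \<and> k \<le> n}"

fun coord_index :: "coord \<Rightarrow> idx" where
  "coord_index (Dl k l) = (k, l)"
| "coord_index (Dlbar k l) = (k, l)"

definition monom_functional :: "lmonom \<Rightarrow> (idx \<Rightarrow> real) \<Rightarrow> real" where
  "monom_functional m \<zeta> =
     (\<Sum>w\<in>Poly_Mapping.keys m. of_int (Poly_Mapping.lookup m w) * \<zeta> (coord_index w))"

definition trop_cone :: "nat \<Rightarrow> (idx \<Rightarrow> real) set" where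
  "trop_cone n = {\<zeta> \<in> tri n \<rightarrow>\<^sub>E UNIV.
     \<forall>u\<in>coords n. \<forall>v\<in>coords n. \<forall>m\<in>Poly_Mapping.keys (p_part n u v).
       monom_functional (prod_monom u v) \<zeta> - monom_functional m \<zeta> > 0}"

definition GZ_cone :: "nat \<Rightarrow> (idx \<Rightarrow> real) set" where
  "GZ_cone n = {lam \<in> tri n \<rightarrow>\<^sub>E UNIV.
     \<forall>k\<in>{2..n}. \<forall>l\<in>{1..k - 1}. lam (k, l) > lam (k - 1, l) \<and> lam (k - 1, l) > lam (k, l + 1)}"

text \<open>An action-angle space is the product of an open subset \<open>base\<close> of real coordinate space with
  index set \<open>acts\<close> and a torus with index set \<open>angs\<close>. The bracket of the action coordinate \<open>a\<close>
  with the angle coordinate \<open>b\<close> is the constant \<open>pairing a b\<close>, and the brackets of two action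
  coordinates and of two angle coordinates vanish. A point of the torus is given by the complex
  numbers $e^{i\phi_b}$ of modulus 1.\<close>

record aa_space =
  acts :: "idx set"
  angs :: "idx set"
  base :: "(idx \<Rightarrow> real) set"
  pairing :: "idx \<Rightarrow> idx \<Rightarrow> real"

type_synonym aa_point = "(idx \<Rightarrow> real) \<times> (idx \<Rightarrow> complex)"

definition torus :: "idx set \<Rightarrow> (idx \<Rightarrow> complex) set" where
  "torus J = J \<rightarrow>\<^sub>E sphere 0 1"

definition points :: "aa_space \<Rightarrow> aa_point set" where
  "points S = base S \<times> torus (angs S)"

datatype axis = Act idx | Ang idx

definition axes :: "aa_space \<Rightarrow> axis set" where
  "axes S = Act ` acts S \<union> Ang ` angs S"

fun flow :: "axis \<Rightarrow> real \<Rightarrow> aa_point \<Rightarrow> aa_point" where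
  "flow (Act a) t (x, w) = (x(a := x a + t), w)"
| "flow (Ang b) t (x, w) = (x, w(b := w b * cis t))"

definition axis_deriv :: "axis \<Rightarrow> (aa_point \<Rightarrow> 'b::real_normed_vector) \<Rightarrow> aa_point \<Rightarrow> 'b" where
  "axis_deriv c h p = vector_derivative (\<lambda>t. h (flow c t p)) (at 0)"

text \<open>Infinitely differentiable functions: all iterated partial derivatives in the action and angle
  directions exist and are continuous. As \<open>base S\<close> is open, these derivatives depend only on the
  values on \<open>points S\<close>.\<close>

definition smooth_fun :: "aa_space \<Rightarrow> (aa_point \<Rightarrow> 'b::real_normed_vector) \<Rightarrow> bool" where
  "smooth_fun S h \<longleftrightarrow>
     (\<forall>cs. set cs \<subseteq> axes S \<longrightarrow>
        continuous_on (points S) (foldr axis_deriv cs h) \<and>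
        (\<forall>c\<in>axes S. \<forall>p\<in>points S. (\<lambda>t. foldr axis_deriv cs h (flow c t p)) differentiable (at 0)))"

definition smooth_map :: "aa_space \<Rightarrow> aa_space \<Rightarrow> (aa_point \<Rightarrow> aa_point) \<Rightarrow> bool" where
  "smooth_map S T F \<longleftrightarrow>
     F ` points S \<subseteq> points T \<and>
     (\<forall>a\<in>acts T. smooth_fun S (\<lambda>p. fst (F p) a)) \<and>
     (\<forall>b\<in>angs T. smooth_fun S (\<lambda>p. snd (F p) b))"

fun axis_bracket :: "aa_space \<Rightarrow> axis \<Rightarrow> axis \<Rightarrow> real" where
  "axis_bracket S (Act a) (Act a') = 0"
| "axis_bracket S (Ang b) (Ang b') = 0"
| "axis_bracket S (Act a) (Ang b) = pairing S a b"
| "axis_bracket S (Ang b) (Act a) = - pairing S a b"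

definition aa_bracket :: "aa_space \<Rightarrow> (aa_point \<Rightarrow> real) \<Rightarrow> (aa_point \<Rightarrow> real) \<Rightarrow> aa_point \<Rightarrow> real" where
  "aa_bracket S h k p =
     (\<Sum>c\<in>axes S. \<Sum>d\<in>axes S. axis_bracket S c d * axis_deriv c h p * axis_deriv d k p)"

definition diffeomorphism :: "aa_space \<Rightarrow> aa_space \<Rightarrow> (aa_point \<Rightarrow> aa_point) \<Rightarrow> bool" where
  "diffeomorphism S T F \<longleftrightarrow>
     bij_betw F (points S) (points T) \<and> smooth_map S T F \<and> smooth_map T S (the_inv_into (points S) F)"

definition poisson_map :: "aa_space \<Rightarrow> aa_space \<Rightarrow> (aa_point \<Rightarrow> aa_point) \<Rightarrow> bool" where
  "poisson_map S T F \<longleftrightarrow>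
     (\<forall>h k. smooth_fun T h \<longrightarrow> smooth_fun T k \<longrightarrow>
        (\<forall>p\<in>points S. aa_bracket S (h \<circ> F) (k \<circ> F) p = aa_bracket T h k (F p)))"

definition trop_space :: "nat \<Rightarrow> aa_space" where
  "trop_space n =
     \<lparr> acts = tri n,
       angs = {(k, l). 1 \<le> l \<and> l < k \<and> k \<le> n},
       base = trop_cone n,
       pairing = (\<lambda>(k, l) (p, q). 1/2 * Im (c_coeff n (Dl k l) (Dl p q) - c_coeff n (Dl k l) (Dlbar p q))) \<rparr>"

definition GZ_space :: "nat \<Rightarrow> aa_space" where
  "GZ_space n =
     \<lparr> acts = tri n,
       angs = {(k, l). 1 \<le> l \<and> l \<le> k \<and> k \<le> n - 1},
       base = GZ_cone n,
       pairing = (\<lambda>a b. if a = b then - 1 else 0) \<rparr>"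

end

theory Submission
  imports Defs
begin

text \<open>Write \<open>r = n - k\<close>. The coordinates are then the minors of the corner blocks of \<open>g\<close>, formed by the rows
\<open>r, ..., r + l - 1\<close> and the last \<open>l\<close> columns, together with their conjugates. The proof has three parts.

\<^emph>\<open>Brackets.\<close> Divided by \<open>u v\<close>, the bracket of two minors depends on \<open>g\<close> only through the coefficients that
express a row of \<open>g\<close>, cut to the last \<open>l\<close> columns, by the rows of the block (\<open>row_coeff\<close>), and a column, cut
to the rows of the block, by the columns of the block (\<open>col_coeff\<close>). For a block's own rows and columns these
coefficients are \<open>0\<close> or \<open>1\<close>. For two holomorphic minors the triangular shape of the r-matrix leaves only
those, because the row sets are intervals and the column sets are nested; so \<open>{u, v}\<close> is a constant times
\<open>u v\<close>. For a minor and a conjugate minor one obtains a constant times \<open>u v\<close> plus \<open>u v\<close> times a sum of products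
\<open>x * cnj x'\<close> of coefficients that belong to rows below both blocks or to columns left of both blocks.

\<^emph>\<open>The cone.\<close> The coefficients obey recursions that are fed only by two cross-ratios of corner minors,
\<open>row_ratio\<close> and \<open>col_ratio\<close>. Their tropicalizations are, up to sign, the differences of the gaps
\<open>\<zeta>(k,l) - \<zeta>(k,l-1)\<close> that occur in the interlacing inequalities. Hence every monomial in a coefficient is
negative on the interlacing cone, and that cone lies in the tropical cone. Conversely the bracket of
\<open>\<Delta>(k,l)\<close> with its own conjugate contains the squared moduli of both cross-ratios, times \<open>u v\<close>; the weights
under left and right multiplication by diagonal matrices, together with the degree in \<open>\<Delta>(k,l)\<close>, show that no
other term has the same monomial, so both inequalities are forced (\<open>trop_cone_interlacing\<close>). The Laurent
expansions are unique because the minors take arbitrary admissible values on the chart (\<open>chart_surjective\<close>)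
and distinct monomials are distinct characters (\<open>laurent_vanishing\<close>).

\<^emph>\<open>The isomorphism.\<close> The cone is the image of the Gelfand-Zeitlin cone under
\<open>\<zeta>(k,l) = (\<lambda>(k,1) + ... + \<lambda>(k,l)) / 2\<close>. The constant terms say that \<open>{\<zeta>(k,l), \<phi>(p,q)}\<close> is \<open>-1/2\<close> times the number of
points \<open>(k,y)\<close>, \<open>y \<le> l\<close>, in a box attached to \<open>(p,q)\<close> (\<open>trop_pairing\<close>). So if \<open>\<phi>(p,q)\<close> is the sum of the
\<open>\<psi>(x,y)\<close> over that box, the brackets agree. In the coordinates \<open>y\<close> and \<open>x - y\<close> this is a two-dimensional
cumulative sum, whose inverse has integer coefficients by inclusion-exclusion; thus it is an automorphism
of the torus. It is the factor \<open>1/2\<close> in the actions that makes the angle transformation integral.\<close>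

section \<open>Cofactors and derivatives of determinants\<close>

lemma cofactor_column_orthogonality:
  assumes A: "(A :: 'a :: comm_ring_1 mat) \<in> carrier_mat m m" and a: "a < m" and b: "b < m"
  shows "(\<Sum>i<m. A $$ (i,a) * cofactor A i b) = (if a = b then Determinant.det A else 0)"
proof -
  have "(adj_mat A * A) $$ (b,a) = (\<Sum>i<m. A $$ (i,a) * cofactor A i b)"
    unfolding times_mat_def scalar_prod_def adj_mat_def using a b A
    by (auto intro!: sum.cong simp: mult.commute atLeast0LessThan)
  then show ?thesis using adj_mat(3)[OF A] a b by auto
qed

lemma cofactor_row_orthogonality:
  assumes A: "(A :: 'a :: comm_ring_1 mat) \<in> carrier_mat m m" and a: "a < m" and b: "b < m"
  shows "(\<Sum>j<m. A $$ (a,j) * cofactor A b j) = (if a = b then Determinant.det A else 0)"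
proof -
  have "(A * adj_mat A) $$ (a,b) = (\<Sum>j<m. A $$ (a,j) * cofactor A b j)"
    unfolding times_mat_def scalar_prod_def adj_mat_def using a b A
    by (auto intro!: sum.cong simp: atLeast0LessThan)
  then show ?thesis using adj_mat(2)[OF A] a b by auto
qed

text \<open>Row-multilinearity gives the derivative as a sum of determinants in which one row is replaced by its derivative;
expanding each along that row produces the cofactors.\<close>

lemma det_has_field_derivative:
  fixes A :: "complex \<Rightarrow> nat \<Rightarrow> nat \<Rightarrow> complex"
  assumes D: "\<And>a b. a < m \<Longrightarrow> b < m \<Longrightarrow> ((\<lambda>z. A z a b) has_field_derivative A' a b) (at z0)"
  shows "((\<lambda>z. Determinant.det (mat m m (\<lambda>(a,b). A z a b))) has_field_derivative
     (\<Sum>a<m. \<Sum>b<m. A' a b * cofactor (mat m m (\<lambda>(a,b). A z0 a b)) a b)) (at z0)"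
proof -
  let ?P = "{p. p permutes {0..<m}}"
  let ?M = "mat m m (\<lambda>(a,b). A z0 a b)"
  let ?N = "\<lambda>i. mat m m (\<lambda>(a,b). if a = i then A' a b else A z0 a b)"
  have pm: "p i < m" if "p permutes {0..<m}" "i < m" for p i
    using that permutes_in_image by fastforce
  have 1: "(\<lambda>z. Determinant.det (mat m m (\<lambda>(a,b). A z a b)))
      = (\<lambda>z. \<Sum>p\<in>?P. signof p * (\<Prod>i<m. A z i (p i)))"
    by (rule ext, subst det_def'[of _ m])
       (auto intro!: sum.cong arg_cong2[of _ _ _ _ "(*)"] prod.cong simp: pm atLeast0LessThan)
  have 2: "((\<lambda>z. \<Sum>p\<in>?P. signof p * (\<Prod>i<m. A z i (p i))) has_field_derivative
      (\<Sum>p\<in>?P. signof p * (\<Sum>i<m. A' i (p i) * (\<Prod>j\<in>{..<m}-{i}. A z0 j (p j))))) (at z0)"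
  proof (rule DERIV_sum)
    fix p assume p: "p \<in> ?P"
    have "((\<lambda>z. \<Prod>i<m. A z i (p i)) has_field_derivative
        (\<Sum>i<m. A' i (p i) * (\<Prod>j\<in>{..<m}-{i}. A z0 j (p j)))) (at z0)"
      using p pm by (intro has_field_derivative_prod D) auto
    then show "((\<lambda>z. signof p * (\<Prod>i<m. A z i (p i))) has_field_derivative
        signof p * (\<Sum>i<m. A' i (p i) * (\<Prod>j\<in>{..<m}-{i}. A z0 j (p j)))) (at z0)"
      by (rule DERIV_cmult)
  qed
  have 3: "(\<Sum>p\<in>?P. signof p * (\<Sum>i<m. A' i (p i) * (\<Prod>j\<in>{..<m}-{i}. A z0 j (p j))))
      = (\<Sum>i<m. Determinant.det (?N i))"
  proof -
    have "Determinant.det (?N i) = (\<Sum>p\<in>?P. signof p * (A' i (p i) * (\<Prod>j\<in>{..<m}-{i}. A z0 j (p j))))"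
      if i: "i < m" for i
    proof -
      have "(\<Prod>a=0..<m. ?N i $$ (a, p a)) = A' i (p i) * (\<Prod>j\<in>{..<m}-{i}. A z0 j (p j))"
        if p: "p permutes {0..<m}" for p
      proof -
        have "(\<Prod>a=0..<m. ?N i $$ (a, p a)) = (\<Prod>a<m. if a = i then A' a (p a) else A z0 a (p a))"
          using pm[OF p] by (intro prod.cong) auto
        also have "\<dots> = A' i (p i) * (\<Prod>a\<in>{..<m}-{i}. if a = i then A' a (p a) else A z0 a (p a))"
          using i by (subst prod.remove[of _ i]) auto
        also have "(\<Prod>a\<in>{..<m}-{i}. if a = i then A' a (p a) else A z0 a (p a)) = (\<Prod>j\<in>{..<m}-{i}. A z0 j (p j))"
          by (intro prod.cong) auto
        finally show ?thesis .
      qed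
      then show ?thesis by (subst det_def'[of _ m]) (auto intro!: sum.cong)
    qed
    then have "(\<Sum>i<m. Determinant.det (?N i))
        = (\<Sum>i<m. \<Sum>p\<in>?P. signof p * (A' i (p i) * (\<Prod>j\<in>{..<m}-{i}. A z0 j (p j))))"
      by (intro sum.cong) auto
    then show ?thesis by (subst (asm) sum.swap) (simp add: sum_distrib_left)
  qed
  have 4: "Determinant.det (?N i) = (\<Sum>b<m. A' i b * cofactor ?M i b)" if i: "i < m" for i
  proof -
    have c: "cofactor (?N i) i b = cofactor ?M i b" if "b < m" for b
      unfolding cofactor_def mat_delete_def using i that
      by (intro arg_cong2[of _ _ _ _ "(*)"] arg_cong[of _ _ Determinant.det]) (auto simp: Let_def)
    show ?thesis
      using i by (subst laplace_expansion_row[of _ m i]) (auto simp: c intro!: sum.cong)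
  qed
  show ?thesis unfolding 1 using 2 unfolding 3 by (simp add: 4)
qed

lemma sum_over_window:
  fixes f :: "nat \<Rightarrow> 'a :: comm_monoid_add"
  assumes "r + l \<le> n" and "\<And>i. i < n \<Longrightarrow> \<not> (r \<le> i \<and> i < r + l) \<Longrightarrow> f i = 0"
  shows "(\<Sum>i<n. f i) = (\<Sum>a<l. f (r + a))"
proof -
  have "(\<Sum>i<n. f i) = (\<Sum>i\<in>{r..<r+l}. f i)"
    using assms by (intro sum.mono_neutral_right) auto
  also have "\<dots> = (\<Sum>a<l. f (r + a))"
    by (rule sum.reindex_bij_witness[of _ "\<lambda>a. r + a" "\<lambda>i. i - r"]) auto
  finally show ?thesis .
qed

section \<open>Corner blocks and their transition coefficients\<close>

definition block :: "nat \<Rightarrow> (nat \<Rightarrow> nat \<Rightarrow> complex) \<Rightarrow> nat \<Rightarrow> nat \<Rightarrow> complex mat" where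
  "block n G r l = mat l l (\<lambda>(a, b). G (r + a) (n - l + b))"

text \<open>With \<open>r = n - k\<close> this is the minor with upper index \<open>k\<close> and lower index \<open>l\<close>.\<close>

definition corner_minor :: "nat \<Rightarrow> (nat \<Rightarrow> nat \<Rightarrow> complex) \<Rightarrow> nat \<Rightarrow> nat \<Rightarrow> complex" where
  "corner_minor n G r l = Determinant.det (block n G r l)"

lemma block_carrier [simp]: "block n G r l \<in> carrier_mat l l"
  by (simp add: block_def)

lemma corner_minor_0 [simp]: "corner_minor n G r 0 = 1"
  by (simp add: corner_minor_def block_def Determinant.det_def)

text \<open>The inverse matrix of the block, indexed by the column \<open>j\<close> and the row \<open>i\<close> of the ambient matrix and extended by
\<open>0\<close>, so that all sums can run over the indices below \<open>n\<close>. Up to the factor \<open>corner_minor\<close> it is also the gradient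
of the minor, which is how it enters the brackets.\<close>

definition dual_block :: "nat \<Rightarrow> (nat \<Rightarrow> nat \<Rightarrow> complex) \<Rightarrow> nat \<Rightarrow> nat \<Rightarrow> nat \<Rightarrow> nat \<Rightarrow> complex" where
  "dual_block n G r l j i =
     (if r \<le> i \<and> i < r + l \<and> n - l \<le> j \<and> j < n
      then cofactor (block n G r l) (i - r) (j - (n - l)) / corner_minor n G r l else 0)"

lemma dual_block_left:
  assumes "r + l \<le> n" "corner_minor n G r l \<noteq> 0" "n - l \<le> j" "j < n" "n - l \<le> j'" "j' < n"
  shows "(\<Sum>i<n. dual_block n G r l j i * G i j') = (if j = j' then 1 else 0)"
proof -
  have "(\<Sum>i<n. dual_block n G r l j i * G i j') = (\<Sum>a<l. dual_block n G r l j (r+a) * G (r+a) j')"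
    using assms by (intro sum_over_window) (auto simp: dual_block_def)
  also have "\<dots> = (\<Sum>a<l. block n G r l $$ (a, j' - (n-l)) * cofactor (block n G r l) a (j - (n-l))) / corner_minor n G r l"
    unfolding sum_divide_distrib using assms by (intro sum.cong) (auto simp: dual_block_def block_def)
  also have "\<dots> = (if j = j' then 1 else 0)"
    using assms by (subst cofactor_column_orthogonality) (auto simp: corner_minor_def[symmetric])
  finally show ?thesis .
qed

lemma dual_block_right:
  assumes "r + l \<le> n" "corner_minor n G r l \<noteq> 0" "r \<le> i" "i < r + l" "r \<le> i'" "i' < r + l"
  shows "(\<Sum>j<n. G i j * dual_block n G r l j i') = (if i = i' then 1 else 0)"
proof -
  have "(\<Sum>j<n. G i j * dual_block n G r l j i') = (\<Sum>b<l. G i (n-l+b) * dual_block n G r l (n-l+b) i')"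
    using assms by (intro sum_over_window) (auto simp: dual_block_def)
  also have "\<dots> = (\<Sum>b<l. block n G r l $$ (i - r, b) * cofactor (block n G r l) (i' - r) b) / corner_minor n G r l"
    unfolding sum_divide_distrib using assms by (intro sum.cong) (auto simp: dual_block_def block_def)
  also have "\<dots> = (if i = i' then 1 else 0)"
    using assms by (subst cofactor_row_orthogonality) (auto simp: corner_minor_def[symmetric])
  finally show ?thesis .
qed

text \<open>The coefficient of column \<open>j\<close> of the block in the expansion of column \<open>t\<close> of the ambient matrix, cut to
the rows of the block; see \<open>col_coeff_expand\<close> and \<open>col_coeff_unique\<close>. In \<open>row_coeff\<close> the roles of rows
and columns are exchanged: there row \<open>s\<close> is expanded and \<open>i\<close> is a row of the block.\<close>

definition col_coeff :: "nat \<Rightarrow> (nat \<Rightarrow> nat \<Rightarrow> complex) \<Rightarrow> nat \<Rightarrow> nat \<Rightarrow> nat \<Rightarrow> nat \<Rightarrow> complex" where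
  "col_coeff n G r l j t = (\<Sum>i<n. dual_block n G r l j i * G i t)"

definition row_coeff :: "nat \<Rightarrow> (nat \<Rightarrow> nat \<Rightarrow> complex) \<Rightarrow> nat \<Rightarrow> nat \<Rightarrow> nat \<Rightarrow> nat \<Rightarrow> complex" where
  "row_coeff n G r l s i = (\<Sum>j<n. G s j * dual_block n G r l j i)"

lemma col_coeff_outside: "\<not> (n - l \<le> j \<and> j < n) \<Longrightarrow> col_coeff n G r l j t = 0"
  by (auto simp: col_coeff_def dual_block_def intro!: sum.neutral)

lemma row_coeff_outside: "\<not> (r \<le> i \<and> i < r + l) \<Longrightarrow> row_coeff n G r l s i = 0"
  by (auto simp: row_coeff_def dual_block_def intro!: sum.neutral)

lemma col_coeff_inside:
  assumes "r + l \<le> n" "corner_minor n G r l \<noteq> 0" "n - l \<le> t" "t < n"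
  shows "col_coeff n G r l j t = (if j = t then 1 else 0)"
proof (cases "n - l \<le> j \<and> j < n")
  case True
  then show ?thesis unfolding col_coeff_def using dual_block_left[OF assms(1,2), of j t] assms by auto
next
  case False
  then show ?thesis using assms by (auto simp: col_coeff_outside)
qed

lemma row_coeff_inside:
  assumes "r + l \<le> n" "corner_minor n G r l \<noteq> 0" "r \<le> s" "s < r + l"
  shows "row_coeff n G r l s i = (if s = i then 1 else 0)"
proof (cases "r \<le> i \<and> i < r + l")
  case True
  then show ?thesis unfolding row_coeff_def using dual_block_right[OF assms(1,2), of s i] assms by auto
next
  case False
  then show ?thesis using assms by (auto simp: row_coeff_outside)
qed

lemma col_coeff_unique:
  assumes "r + l \<le> n" "corner_minor n G r l \<noteq> 0" "n - l \<le> j" "j < n"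
    and x: "\<And>i. r \<le> i \<Longrightarrow> i < r + l \<Longrightarrow> G i t = (\<Sum>j'\<in>{n-l..<n}. G i j' * x j')"
  shows "col_coeff n G r l j t = x j"
proof -
  have "col_coeff n G r l j t = (\<Sum>i<n. dual_block n G r l j i * (\<Sum>j'\<in>{n-l..<n}. G i j' * x j'))"
    unfolding col_coeff_def by (intro sum.cong refl) (use x in \<open>auto simp: dual_block_def\<close>)
  also have "\<dots> = (\<Sum>j'\<in>{n-l..<n}. (\<Sum>i<n. dual_block n G r l j i * G i j') * x j')"
    by (subst sum_distrib_right, subst sum.swap, simp add: sum_distrib_left mult.assoc)
  also have "\<dots> = (\<Sum>j'\<in>{n-l..<n}. if j = j' then x j' else 0)"
    using assms by (intro sum.cong) (auto simp: dual_block_left)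
  also have "\<dots> = x j" using assms by auto
  finally show ?thesis .
qed

lemma row_coeff_unique:
  assumes "r + l \<le> n" "corner_minor n G r l \<noteq> 0" "r \<le> i" "i < r + l"
    and x: "\<And>j. n - l \<le> j \<Longrightarrow> j < n \<Longrightarrow> G s j = (\<Sum>i'\<in>{r..<r+l}. x i' * G i' j)"
  shows "row_coeff n G r l s i = x i"
proof -
  have "row_coeff n G r l s i = (\<Sum>j<n. (\<Sum>i'\<in>{r..<r+l}. x i' * G i' j) * dual_block n G r l j i)"
    unfolding row_coeff_def by (intro sum.cong refl) (use x in \<open>auto simp: dual_block_def\<close>)
  also have "\<dots> = (\<Sum>i'\<in>{r..<r+l}. x i' * (\<Sum>j<n. G i' j * dual_block n G r l j i))"
    by (subst sum_distrib_right, subst sum.swap, simp add: sum_distrib_left mult.assoc)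
  also have "\<dots> = (\<Sum>i'\<in>{r..<r+l}. if i = i' then x i' else 0)"
    using assms by (intro sum.cong) (auto simp: dual_block_right)
  also have "\<dots> = x i" using assms by auto
  finally show ?thesis .
qed

lemma col_coeff_expand:
  assumes "r + l \<le> n" "corner_minor n G r l \<noteq> 0" "r \<le> i" "i < r + l"
  shows "G i t = (\<Sum>j\<in>{n-l..<n}. G i j * col_coeff n G r l j t)"
proof -
  have "(\<Sum>j\<in>{n-l..<n}. G i j * col_coeff n G r l j t) = (\<Sum>j<n. G i j * col_coeff n G r l j t)"
    using assms by (intro sum.mono_neutral_left) (auto simp: col_coeff_outside)
  also have "\<dots> = (\<Sum>i'<n. (\<Sum>j<n. G i j * dual_block n G r l j i') * G i' t)"
    unfolding col_coeff_def sum_distrib_left sum_distrib_right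
    by (subst sum.swap) (simp add: mult.assoc)
  also have "\<dots> = (\<Sum>i'<n. if i' = i then G i' t else 0)"
  proof (intro sum.cong refl)
    fix i' show "(\<Sum>j<n. G i j * dual_block n G r l j i') * G i' t = (if i' = i then G i' t else 0)"
      using dual_block_right[OF assms(1-4), of i'] assms
      by (cases "r \<le> i' \<and> i' < r + l") (auto simp: dual_block_def)
  qed
  also have "\<dots> = G i t" using assms by auto
  finally show ?thesis by simp
qed

lemma row_coeff_expand:
  assumes "r + l \<le> n" "corner_minor n G r l \<noteq> 0" "n - l \<le> j" "j < n"
  shows "G s j = (\<Sum>i\<in>{r..<r+l}. row_coeff n G r l s i * G i j)"
proof -
  have "(\<Sum>i\<in>{r..<r+l}. row_coeff n G r l s i * G i j) = (\<Sum>i<n. row_coeff n G r l s i * G i j)"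
    using assms by (intro sum.mono_neutral_left) (auto simp: row_coeff_outside)
  also have "\<dots> = (\<Sum>j'<n. G s j' * (\<Sum>i<n. dual_block n G r l j' i * G i j))"
    unfolding row_coeff_def sum_distrib_left sum_distrib_right
    by (subst sum.swap) (simp add: mult.assoc)
  also have "\<dots> = (\<Sum>j'<n. if j' = j then G s j' else 0)"
  proof (intro sum.cong refl)
    fix j' show "G s j' * (\<Sum>i<n. dual_block n G r l j' i * G i j) = (if j' = j then G s j' else 0)"
      using dual_block_left[OF assms(1,2) _ _ assms(3,4), of j'] assms
      by (cases "n - l \<le> j' \<and> j' < n") (auto simp: dual_block_def)
  qed
  also have "\<dots> = G s j" using assms by auto
  finally show ?thesis by simp
qed

text \<open>Replacing the first column by the combination \<open>A v\<close> does not change the determinant, as \<open>v 0 = 1\<close>, and leaves a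
single nonzero entry at the top. The proof by cofactor orthogonality avoids column operations.\<close>

lemma det_clear_column:
  assumes A: "(A :: complex mat) \<in> carrier_mat (Suc m) (Suc m)" and v: "v 0 = 1"
    and z: "\<And>i. 0 < i \<Longrightarrow> i \<le> m \<Longrightarrow> (\<Sum>j\<le>m. A $$ (i,j) * v j) = 0"
  shows "Determinant.det A = (\<Sum>j\<le>m. A $$ (0,j) * v j) * Determinant.det (mat_delete A 0 0)"
proof -
  have "(\<Sum>i\<le>m. cofactor A i 0 * (\<Sum>j\<le>m. A $$ (i,j) * v j))
      = (\<Sum>j\<le>m. v j * (\<Sum>i<Suc m. A $$ (i,j) * cofactor A i 0))"
    unfolding sum_distrib_left lessThan_Suc_atMost by (subst sum.swap) (simp add: mult_ac)
  also have "\<dots> = (\<Sum>j\<le>m. v j * (if j = 0 then Determinant.det A else 0))"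
    using A by (intro sum.cong refl, subst cofactor_column_orthogonality) auto
  also have "\<dots> = Determinant.det A"
    using v by (subst sum.remove[of _ 0]) auto
  finally have "Determinant.det A = (\<Sum>i\<le>m. cofactor A i 0 * (\<Sum>j\<le>m. A $$ (i,j) * v j))" by simp
  also have "\<dots> = cofactor A 0 0 * (\<Sum>j\<le>m. A $$ (0,j) * v j)"
    using z by (subst sum.remove[of _ 0]) auto
  finally show ?thesis by (simp add: cofactor_def)
qed

lemma det_clear_row:
  assumes A: "(A :: complex mat) \<in> carrier_mat (Suc m) (Suc m)" and u: "u m = 1"
    and z: "\<And>j. 0 < j \<Longrightarrow> j \<le> m \<Longrightarrow> (\<Sum>i\<le>m. u i * A $$ (i,j)) = 0"
  shows "Determinant.det A = (-1)^m * (\<Sum>i\<le>m. u i * A $$ (i,0)) * Determinant.det (mat_delete A m 0)"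
proof -
  have "(\<Sum>j\<le>m. cofactor A m j * (\<Sum>i\<le>m. u i * A $$ (i,j)))
      = (\<Sum>i\<le>m. u i * (\<Sum>j<Suc m. A $$ (i,j) * cofactor A m j))"
    unfolding sum_distrib_left lessThan_Suc_atMost by (subst sum.swap) (simp add: mult_ac)
  also have "\<dots> = (\<Sum>i\<le>m. u i * (if i = m then Determinant.det A else 0))"
    using A by (intro sum.cong refl, subst cofactor_row_orthogonality) auto
  also have "\<dots> = Determinant.det A"
    using u by (subst sum.remove[of _ m]) auto
  finally have "Determinant.det A = (\<Sum>j\<le>m. cofactor A m j * (\<Sum>i\<le>m. u i * A $$ (i,j)))" by simp
  also have "\<dots> = cofactor A m 0 * (\<Sum>i\<le>m. u i * A $$ (i,0))"
    using z by (subst sum.remove[of _ 0]) auto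
  finally show ?thesis by (simp add: cofactor_def)
qed

section \<open>Recursions for the transition coefficients\<close>

lemma mat_delete_block_top_left:
  assumes "Suc l \<le> n"
  shows "mat_delete (block n G r (Suc l)) 0 0 = block n G (Suc r) l"
  using assms by (intro eq_matI) (auto simp: mat_delete_def block_def Suc_diff_Suc)

lemma mat_delete_block_bottom_left:
  assumes "Suc l \<le> n"
  shows "mat_delete (block n G r (Suc l)) l 0 = block n G r l"
  using assms by (intro eq_matI) (auto simp: mat_delete_def block_def Suc_diff_Suc)

text \<open>Enlarging a block by one row above and one column to the left multiplies the minor by a Schur complement:
the defect, in the new row, of the expansion of the new column.\<close>

lemma corner_minor_Suc_column:
  assumes n: "r + Suc l \<le> n" and nz: "corner_minor n G (Suc r) l \<noteq> 0"
  shows "corner_minor n G r (Suc l) =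
    (G r (n - Suc l) - (\<Sum>j\<in>{n-l..<n}. G r j * col_coeff n G (Suc r) l j (n - Suc l))) * corner_minor n G (Suc r) l"
proof -
  let ?A = "block n G r (Suc l)" and ?x = "\<lambda>j. col_coeff n G (Suc r) l j (n - Suc l)"
  define v where "v b = (if b = 0 then 1 else - ?x (n - Suc l + b))" for b
  have s: "(\<Sum>b\<le>l. ?A $$ (i,b) * v b) = G (r+i) (n - Suc l) - (\<Sum>j\<in>{n-l..<n}. G (r+i) j * ?x j)"
    if "i \<le> l" for i
  proof -
    have "(\<Sum>b\<le>l. ?A $$ (i,b) * v b) = ?A $$ (i,0) * v 0 + (\<Sum>b\<in>{1..l}. ?A $$ (i,b) * v b)"
      by (subst sum.remove[of _ 0]) (auto intro!: sum.cong)
    also have "(\<Sum>b\<in>{1..l}. ?A $$ (i,b) * v b) = (\<Sum>j\<in>{n-l..<n}. - (G (r+i) j * ?x j))"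
      using n that by (intro sum.reindex_bij_witness[of _ "\<lambda>j. j - (n - Suc l)" "\<lambda>b. n - Suc l + b"])
        (auto simp: block_def v_def)
    finally show ?thesis using that n by (simp add: block_def v_def sum_negf)
  qed
  have "Determinant.det ?A = (\<Sum>b\<le>l. ?A $$ (0,b) * v b) * Determinant.det (mat_delete ?A 0 0)"
  proof (rule det_clear_column)
    fix i assume i: "0 < i" "i \<le> l"
    have "G (r+i) (n - Suc l) = (\<Sum>j\<in>{n-l..<n}. G (r+i) j * ?x j)"
      using n nz i by (intro col_coeff_expand) auto
    then show "(\<Sum>b\<le>l. ?A $$ (i,b) * v b) = 0" using s[OF i(2)] by simp
  qed (auto simp: v_def)
  then show ?thesis using n by (simp add: corner_minor_def mat_delete_block_top_left s)
qed

text \<open>The analogous statement for enlarging by one row below. The new row enters through any linear relation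
\<open>u\<close> between the \<open>l + 1\<close> rows that holds on the last \<open>l\<close> columns; its defect in the new column is the Schur
complement.\<close>

lemma corner_minor_Suc_row:
  assumes n: "r + Suc l \<le> n" and u: "u (r + l) = 1"
    and z: "\<And>j. n - l \<le> j \<Longrightarrow> j < n \<Longrightarrow> (\<Sum>i\<in>{r..r+l}. u i * G i j) = 0"
  shows "corner_minor n G r (Suc l) =
    (-1)^l * (\<Sum>i\<in>{r..r+l}. u i * G i (n - Suc l)) * corner_minor n G r l"
proof -
  let ?A = "block n G r (Suc l)"
  have s: "(\<Sum>a\<le>l. u (r+a) * ?A $$ (a,b)) = (\<Sum>i\<in>{r..r+l}. u i * G i (n - Suc l + b))" if "b \<le> l" for b
    using that by (intro sum.reindex_bij_witness[of _ "\<lambda>i. i - r" "\<lambda>a. r + a"]) (auto simp: block_def)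
  have "Determinant.det ?A = (-1)^l * (\<Sum>a\<le>l. u (r+a) * ?A $$ (a,0)) * Determinant.det (mat_delete ?A l 0)"
  proof (rule det_clear_row)
    fix b assume b: "0 < b" "b \<le> l"
    show "(\<Sum>a\<le>l. u (r+a) * ?A $$ (a,b)) = 0" using s[OF b(2)] z[of "n - Suc l + b"] b n by simp
  qed (use u in auto)
  then show ?thesis using n by (simp add: corner_minor_def mat_delete_block_bottom_left s)
qed

text \<open>The only inputs of the recursions for the coefficients: \<open>row_ratio\<close> moves the relation between consecutive
rows from \<open>l\<close> to \<open>l + 1\<close> columns, \<open>col_ratio\<close> moves the expansion of the next column one row upwards.\<close>

definition row_ratio :: "nat \<Rightarrow> (nat \<Rightarrow> nat \<Rightarrow> complex) \<Rightarrow> nat \<Rightarrow> nat \<Rightarrow> complex" where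
  "row_ratio n G r l = corner_minor n G (Suc r) l * corner_minor n G r (l - 1) /
     (corner_minor n G r l * corner_minor n G (Suc r) (l - 1))"

definition col_ratio :: "nat \<Rightarrow> (nat \<Rightarrow> nat \<Rightarrow> complex) \<Rightarrow> nat \<Rightarrow> nat \<Rightarrow> complex" where
  "col_ratio n G r l = corner_minor n G r (Suc l) * corner_minor n G (Suc r) (l - 1) /
     (corner_minor n G (Suc r) l * corner_minor n G r l)"

text \<open>The coefficients of the linear relation between the rows \<open>r, ..., r + l\<close> on the last \<open>l\<close> columns, normalized to
\<open>1\<close> at the row \<open>r + l\<close>. The relations of length \<open>l\<close> starting at \<open>r\<close> and at \<open>Suc r\<close> both hold on
the last \<open>l\<close> columns, and the combination chosen here also holds on the next column.\<close>

fun row_relation :: "nat \<Rightarrow> (nat \<Rightarrow> nat \<Rightarrow> complex) \<Rightarrow> nat \<Rightarrow> nat \<Rightarrow> nat \<Rightarrow> complex" where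
  "row_relation n G 0 r i = (if i = r then 1 else 0)"
| "row_relation n G (Suc l) r i =
     row_relation n G l (Suc r) i - row_ratio n G r (Suc l) * row_relation n G l r i"

lemma row_relation_outside: "i < r \<or> r + l < i \<Longrightarrow> row_relation n G l r i = 0"
  by (induction l arbitrary: r) auto

lemma row_relation_top: "row_relation n G l r (r + l) = 1"
proof (induction l arbitrary: r)
  case (Suc l)
  show ?case using Suc[of "Suc r"] by (simp add: row_relation_outside)
qed auto

definition corner_regular :: "nat \<Rightarrow> (nat \<Rightarrow> nat \<Rightarrow> complex) \<Rightarrow> bool" where
  "corner_regular n G \<longleftrightarrow> (\<forall>r l. r + l \<le> n \<longrightarrow> corner_minor n G r l \<noteq> 0)"

lemma corner_regularD: "corner_regular n G \<Longrightarrow> r + l \<le> n \<Longrightarrow> corner_minor n G r l \<noteq> 0"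
  by (auto simp: corner_regular_def)

text \<open>Induction on \<open>l\<close>. On the new column \<open>n - Suc l\<close> the two shorter relations take values that
\<open>corner_minor_Suc_row\<close> expresses by minors, and \<open>row_ratio\<close> is the quotient of these values.\<close>

lemma row_relation_annihilates:
  assumes "corner_regular n G" "r + l < n" "n - l \<le> j" "j < n"
  shows "(\<Sum>i<n. row_relation n G l r i * G i j) = 0"
  using assms(2-)
proof (induction l arbitrary: r j)
  case (Suc l)
  let ?S = "\<lambda>r j. \<Sum>i<n. row_relation n G l r i * G i j"
  note nz = corner_regularD[OF assms(1)]
  have eq: "(\<Sum>i<n. row_relation n G (Suc l) r i * G i j) = ?S (Suc r) j - row_ratio n G r (Suc l) * ?S r j"
    by (simp add: sum_subtractf sum_distrib_left algebra_simps)
  show ?case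
  proof (cases "n - l \<le> j")
    case True
    then show ?thesis unfolding eq using Suc by simp
  next
    case False
    then have j: "j = n - Suc l" using Suc.prems by linarith
    have *: "corner_minor n G r' (Suc l) = (-1)^l * ?S r' j * corner_minor n G r' l" if r': "r' + Suc l \<le> n" for r'
    proof -
      have sub: "(\<Sum>i\<in>{r'..r'+l}. row_relation n G l r' i * G i j) = ?S r' j" for j
        using r' by (intro sum.mono_neutral_left) (auto simp: row_relation_outside)
      have "corner_minor n G r' (Suc l) = (-1)^l * (\<Sum>i\<in>{r'..r'+l}. row_relation n G l r' i * G i (n - Suc l)) * corner_minor n G r' l"
        using r' by (intro corner_minor_Suc_row) (auto simp: row_relation_top sub Suc.IH)
      then show ?thesis by (simp add: sub j)
    qed
    have s: "?S r' j = (-1)^l * corner_minor n G r' (Suc l) / corner_minor n G r' l" if r': "r' + Suc l \<le> n" for r'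
    proof -
      have "(-1)^l * ((-1)^l * ?S r' j * corner_minor n G r' l) = ?S r' j * corner_minor n G r' l"
        by (simp only: mult.assoc[symmetric] power_mult_distrib[symmetric]) simp
      then show ?thesis using *[OF r'] nz[of r' l] r' by (simp add: field_simps)
    qed
    show ?thesis unfolding eq using Suc.prems nz[of r "Suc l"] nz[of "Suc r" l] nz[of r l]
      by (simp add: s row_ratio_def)
  qed
qed auto

lemma row_coeff_first_below:
  assumes "corner_regular n G" "r + l < n" "r \<le> i" "i < r + l"
  shows "row_coeff n G r l (r + l) i = - row_relation n G l r i"
proof (rule row_coeff_unique)
  fix j assume j: "n - l \<le> j" "j < n"
  have "(\<Sum>i<n. row_relation n G l r i * G i j) = (\<Sum>i\<in>{r..r+l}. row_relation n G l r i * G i j)"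
    using assms by (intro sum.mono_neutral_right) (auto simp: row_relation_outside)
  also have "\<dots> = (\<Sum>i\<in>{r..<r+l}. row_relation n G l r i * G i j) + G (r+l) j"
    by (subst sum.last_plus) (auto simp: row_relation_top)
  finally show "G (r + l) j = (\<Sum>i'\<in>{r..<r+l}. - row_relation n G l r i' * G i' j)"
    using row_relation_annihilates[OF assms(1,2) j] by (simp add: sum_negf add_eq_0_iff2)
qed (use assms in \<open>auto simp: corner_regular_def\<close>)

text \<open>Moving the window of rows up by one: the row \<open>r + l\<close> leaves the basis and is itself expanded in the new one.
Iterated, this reduces every coefficient to those of the first row below a block.\<close>

lemma row_coeff_shift:
  assumes "corner_regular n G" "r + l < n" "r \<le> i" "i < r + l"
  shows "row_coeff n G r l s i = row_coeff n G (Suc r) l s i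
     + row_coeff n G (Suc r) l s (r + l) * row_coeff n G r l (r + l) i"
proof (rule row_coeff_unique)
  fix j assume j: "n - l \<le> j" "j < n"
  let ?c = "row_coeff n G (Suc r) l s"
  have "G s j = (\<Sum>i'\<in>{Suc r..<Suc r + l}. ?c i' * G i' j)"
    using assms j by (intro row_coeff_expand) (auto simp: corner_regular_def)
  also have "{Suc r..<Suc r + l} = insert (r+l) {Suc r..<r+l}" using assms by auto
  also have "(\<Sum>i'\<in>insert (r+l) {Suc r..<r+l}. ?c i' * G i' j) = ?c (r+l) * G (r+l) j + (\<Sum>i'\<in>{Suc r..<r+l}. ?c i' * G i' j)"
    by (subst sum.insert) auto
  also have "(\<Sum>i'\<in>{Suc r..<r+l}. ?c i' * G i' j) = (\<Sum>i'\<in>{r..<r+l}. ?c i' * G i' j)"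
    by (intro sum.mono_neutral_left) (auto, metis Suc_leI le_neq_implies_less not_less_eq_eq row_coeff_outside mult_zero_left less_irrefl_nat)
  also have "G (r+l) j = (\<Sum>i'\<in>{r..<r+l}. row_coeff n G r l (r + l) i' * G i' j)"
    using assms j by (intro row_coeff_expand) (auto simp: corner_regular_def)
  finally show "G s j = (\<Sum>i'\<in>{r..<r+l}. (?c i' + ?c (r+l) * row_coeff n G r l (r + l) i') * G i' j)"
    by (simp add: sum.distrib sum_distrib_left algebra_simps)
qed (use assms in \<open>auto simp: corner_regular_def\<close>)

text \<open>A vector spanning the kernel of the rows \<open>Suc r, ..., r + l - 1\<close> on the last \<open>l\<close> columns. Two expansions
of a column which agree on these \<open>l - 1\<close> rows differ by a multiple of it.\<close>

definition kernel_coeff :: "nat \<Rightarrow> (nat \<Rightarrow> nat \<Rightarrow> complex) \<Rightarrow> nat \<Rightarrow> nat \<Rightarrow> nat \<Rightarrow> complex" where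
  "kernel_coeff n G r l j = (if j = n - l then 1 else - col_coeff n G (Suc r) (l - 1) j (n - l))"

lemma kernel_coeff_sum:
  assumes "0 < l" "l \<le> n"
  shows "(\<Sum>j\<in>{n-l..<n}. G i j * kernel_coeff n G r l j)
      = G i (n - l) - (\<Sum>j\<in>{n-(l-1)..<n}. G i j * col_coeff n G (Suc r) (l - 1) j (n - l))"
proof -
  have "{n-l..<n} = insert (n-l) {n-(l-1)..<n}" using assms by auto
  moreover have "n - l \<notin> {n-(l-1)..<n}" using assms by auto
  moreover have "(\<Sum>j\<in>{n-(l-1)..<n}. G i j * kernel_coeff n G r l j)
     = (\<Sum>j\<in>{n-(l-1)..<n}. - (G i j * col_coeff n G (Suc r) (l - 1) j (n - l)))"
    using assms by (intro sum.cong) (auto simp: kernel_coeff_def)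
  ultimately show ?thesis by (simp add: kernel_coeff_def sum_negf)
qed

text \<open>The expansions of the next column over the blocks starting at the rows \<open>r\<close> and \<open>Suc r\<close> agree on the common
rows, so they differ by a multiple of the kernel vector. Evaluating in row \<open>r\<close>, where both defects are
Schur complements, identifies the factor as \<open>col_ratio\<close>.\<close>

lemma col_coeff_shift:
  assumes reg: "corner_regular n G" and l: "0 < l" "r + Suc l \<le> n" and j: "n - l \<le> j" "j < n"
  shows "col_coeff n G r l j (n - Suc l) =
    col_coeff n G (Suc r) l j (n - Suc l) + col_ratio n G r l * kernel_coeff n G r l j"
proof (rule col_coeff_unique)
  note nz = corner_regularD[OF reg]
  let ?x = "\<lambda>j. col_coeff n G (Suc r) l j (n - Suc l)"
  fix i assume i: "r \<le> i" "i < r + l"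
  have eq: "(\<Sum>j'\<in>{n-l..<n}. G i j' * (?x j' + col_ratio n G r l * kernel_coeff n G r l j'))
     = (\<Sum>j'\<in>{n-l..<n}. G i j' * ?x j') + col_ratio n G r l * (\<Sum>j'\<in>{n-l..<n}. G i j' * kernel_coeff n G r l j')"
    by (simp add: sum.distrib sum_distrib_left algebra_simps)
  show "G i (n - Suc l) = (\<Sum>j'\<in>{n-l..<n}. G i j' * (?x j' + col_ratio n G r l * kernel_coeff n G r l j'))"
  proof (cases "i = r")
    case True
    have a: "G r (n - Suc l) - (\<Sum>j\<in>{n-l..<n}. G r j * ?x j) = corner_minor n G r (Suc l) / corner_minor n G (Suc r) l"
      using corner_minor_Suc_column[of r l n G] nz[of "Suc r" l] l by simp
    have b: "(\<Sum>j'\<in>{n-l..<n}. G r j' * kernel_coeff n G r l j') = corner_minor n G r l / corner_minor n G (Suc r) (l - 1)"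
      using corner_minor_Suc_column[of r "l - 1" n G] nz[of "Suc r" "l - 1"] l by (simp add: kernel_coeff_sum)
    have "col_ratio n G r l * (corner_minor n G r l / corner_minor n G (Suc r) (l - 1))
        = corner_minor n G r (Suc l) / corner_minor n G (Suc r) l"
      using nz[of "Suc r" l] nz[of r l] nz[of "Suc r" "l-1"] l by (simp add: col_ratio_def)
    then show ?thesis using a unfolding True eq[unfolded True] b by (simp add: algebra_simps)
  next
    case False
    have "G i (n - Suc l) = (\<Sum>j'\<in>{n-l..<n}. G i j' * ?x j')"
      using i False l nz by (intro col_coeff_expand) auto
    moreover have "G i (n - l) = (\<Sum>j\<in>{n-(l-1)..<n}. G i j * col_coeff n G (Suc r) (l - 1) j (n - l))"
      using i False l nz by (intro col_coeff_expand) auto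
    ultimately show ?thesis using l by (simp add: eq kernel_coeff_sum)
  qed
qed (use assms in \<open>auto simp: corner_regular_def\<close>)

text \<open>An expansion over \<open>l + 1\<close> columns turns into one over \<open>l\<close> columns by expanding the extra column. Iterated, this
reduces every coefficient to those of the first column left of a block.\<close>

lemma col_coeff_widen:
  assumes reg: "corner_regular n G" and l: "r + Suc l \<le> n" and j: "n - l \<le> j" "j < n"
  shows "col_coeff n G r l j t = col_coeff n G r (Suc l) j t
     + col_coeff n G r (Suc l) (n - Suc l) t * col_coeff n G r l j (n - Suc l)"
proof (rule col_coeff_unique)
  fix i assume i: "r \<le> i" "i < r + l"
  let ?c = "\<lambda>j. col_coeff n G r (Suc l) j t"
  have "G i t = (\<Sum>j'\<in>{n - Suc l..<n}. G i j' * ?c j')"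
    using assms i by (intro col_coeff_expand) (auto simp: corner_regular_def)
  also have "{n - Suc l..<n} = insert (n - Suc l) {n-l..<n}" using l by auto
  also have "(\<Sum>j'\<in>insert (n - Suc l) {n-l..<n}. G i j' * ?c j')
     = G i (n - Suc l) * ?c (n - Suc l) + (\<Sum>j'\<in>{n-l..<n}. G i j' * ?c j')"
    using l by (subst sum.insert) auto
  also have "G i (n - Suc l) = (\<Sum>j'\<in>{n-l..<n}. G i j' * col_coeff n G r l j' (n - Suc l))"
    using assms i by (intro col_coeff_expand) (auto simp: corner_regular_def)
  finally show "G i t = (\<Sum>j'\<in>{n-l..<n}. G i j' * (?c j' + ?c (n - Suc l) * col_coeff n G r l j' (n - Suc l)))"
    by (simp add: sum.distrib sum_distrib_left algebra_simps)
qed (use assms in \<open>auto simp: corner_regular_def\<close>)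

lemma col_coeff_full_height:
  assumes "\<And>i j. j < i \<Longrightarrow> i < n \<Longrightarrow> G i j = 0" "r + l = n" "t < r"
  shows "col_coeff n G r l j t = 0"
proof -
  have "dual_block n G r l j i * G i t = 0" if "i < n" for i
    using assms that by (cases "r \<le> i") (auto simp: dual_block_def)
  then show ?thesis by (auto simp: col_coeff_def intro!: sum.neutral)
qed

section \<open>Derivatives of the minors and the brackets of matrix entries\<close>

lemma sum_single:
  fixes \<phi> :: "nat \<Rightarrow> 'a :: comm_monoid_add"
  assumes "i < n" "\<And>a. a < n \<Longrightarrow> a \<noteq> i \<Longrightarrow> \<phi> a = 0"
  shows "(\<Sum>a<n. \<phi> a) = \<phi> i"
proof -
  have "(\<Sum>a<n. \<phi> a) = (\<Sum>a\<in>{i}. \<phi> a)"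
    using assms by (intro sum.mono_neutral_right) auto
  then show ?thesis by simp
qed

text \<open>The r-matrix has the entry \<open>ordering_weight i j\<close> at the position of \<open>e\<^sub>i\<^sub>j \<otimes> e\<^sub>j\<^sub>i\<close>, and all other entries vanish.\<close>

definition ordering_weight :: "nat \<Rightarrow> nat \<Rightarrow> complex" where
  "ordering_weight i s = (if i = s then 1/2 else if i < s then 1 else 0)"

lemma r_matrix_entries:
  assumes "i < n" "j < n" "s < n" "t < n"
  shows "r_matrix n i j s t = (if s = j \<and> t = i then ordering_weight i j else 0)"
proof -
  have 1: "(\<Sum>a<n. mat_unit a a i j * mat_unit a a s t) = (if i = j \<and> s = i \<and> t = i then 1 else 0)"
  proof -
    have "(\<Sum>a<n. mat_unit a a i j * mat_unit a a s t) = (\<Sum>a<n. if a = i then (if i = j \<and> s = i \<and> t = i then 1 else 0) else 0)"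
      by (intro sum.cong) (auto simp: mat_unit_def)
    then show ?thesis using assms by simp
  qed
  have 2: "(\<Sum>b<n. \<Sum>a<b. mat_unit a b i j * mat_unit b a s t) = (if i < j \<and> s = j \<and> t = i then 1 else 0)"
  proof -
    have "(\<Sum>b<n. \<Sum>a<b. mat_unit a b i j * mat_unit b a s t) = (\<Sum>a<j. mat_unit a j i j * mat_unit j a s t)"
      using assms by (subst sum_single[of j n]) (auto simp: mat_unit_def)
    also have "\<dots> = (if i < j \<and> s = j \<and> t = i then 1 else 0)"
    proof (cases "i < j")
      case True
      then show ?thesis by (subst sum_single[of i j]) (auto simp: mat_unit_def)
    qed (auto simp: mat_unit_def intro!: sum.neutral)
    finally show ?thesis .
  qed
  show ?thesis unfolding r_matrix_def 1 2 by (auto simp: ordering_weight_def)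
qed

lemma tensor_comm_r_matrix:
  assumes "i < n" "j < n" "s < n" "t < n"
  shows "tensor_comm n (r_matrix n) (tensor_of x y) i j s t =
    ordering_weight i s * x $$ (s,j) * y $$ (i,t) - ordering_weight t j * x $$ (i,t) * y $$ (s,j)"
proof -
  have "tensor_mult n (r_matrix n) (tensor_of x y) i j s t = ordering_weight i s * x $$ (s,j) * y $$ (i,t)"
    unfolding tensor_mult_def using assms
    by (subst sum_single[of s n]) (auto simp: r_matrix_entries tensor_of_def sum_single[of i n] intro!: sum.neutral)
  moreover have "tensor_mult n (tensor_of x y) (r_matrix n) i j s t = ordering_weight t j * x $$ (i,t) * y $$ (s,j)"
    unfolding tensor_mult_def using assms
    by (subst sum_single[of t n]) (auto simp: r_matrix_entries tensor_of_def sum_single[of j n] intro!: sum.neutral)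
  ultimately show ?thesis by (simp add: tensor_comm_def)
qed

lemma entry_bracket_antisym:
  assumes "a \<in> entries n" "b \<in> entries n"
  shows "entry_bracket n P a b = - entry_bracket n P b a"
proof -
  obtain g f where P: "P = (g, f)" by force
  show ?thesis
    using assms unfolding P entries_def
    by (elim UnE CollectE exE conjE) (simp_all add: tensor_comm_r_matrix, auto simp: ordering_weight_def)
qed

lemma group_bracket_antisym: "group_bracket n F H P = - group_bracket n H F P"
  unfolding group_bracket_def
  by (subst sum.swap, simp only: sum_negf[symmetric], intro sum.cong refl)
     (subst entry_bracket_antisym, auto)

lemma sum_entries:
  fixes \<phi> :: "entry \<Rightarrow> complex"
  shows "(\<Sum>a\<in>entries n. \<phi> a) = (\<Sum>i<n. \<Sum>j<n. \<phi> (GEntry i j)) + (\<Sum>i<n. \<Sum>j<n. \<phi> (FEntry i j))"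
proof -
  have e: "entries n = (\<lambda>(i,j). GEntry i j) ` ({..<n} \<times> {..<n}) \<union> (\<lambda>(i,j). FEntry i j) ` ({..<n} \<times> {..<n})"
    by (auto simp: entries_def image_iff)
  show ?thesis unfolding e
    by (subst sum.union_disjoint)
       (auto simp: sum.reindex inj_on_def sum.cartesian_product split_def)
qed

lemma mat_inv_eqI:
  assumes M: "M \<in> carrier_mat n n" and N: "N \<in> carrier_mat n n" and MN: "M * N = 1\<^sub>m n"
  shows "mat_inv M = N"
proof -
  have NM: "N * M = 1\<^sub>m n" using mat_mult_left_right_inverse[OF M N MN] .
  show ?thesis
  proof (cases "mat_inverse M")
    case None
    from mat_inverse(1)[OF M this, of "()"] have "M \<notin> Units (ring_mat TYPE(complex) n ())" .
    moreover have "M \<in> Units (ring_mat TYPE(complex) n ())"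
      unfolding Units_def ring_mat_def using M N MN NM by auto
    ultimately show ?thesis by simp
  next
    case (Some B)
    from mat_inverse(2)[OF M this] have B: "B * M = 1\<^sub>m n" "B \<in> carrier_mat n n" by auto
    have "B = B * (M * N)" using B MN by simp
    also have "\<dots> = N" using B M N by (simp add: assoc_mult_mat[symmetric, of B n n M n N n])
    finally show ?thesis using Some by (simp add: mat_inv_def)
  qed
qed

text \<open>Changing one entry of \<open>f\<close> is a rank-one perturbation, so near \<open>0\<close> the inverse is given by the Sherman-Morrison
formula.\<close>

lemma mat_inv_derivative:
  assumes f: "f \<in> carrier_mat n n" and H: "H \<in> carrier_mat n n" and fH: "f * H = 1\<^sub>m n"
    and st: "s < n" "t < n" and ab: "a < n" "b < n"
  shows "((\<lambda>z. mat_inv (mat n n (\<lambda>q. f $$ q + (if q = (s,t) then z else 0))) $$ (a,b))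
     has_field_derivative - (H $$ (a,s) * H $$ (t,b))) (at 0)"
proof -
  let ?f = "\<lambda>z. mat n n (\<lambda>q. f $$ q + (if q = (s,t) then z else 0))"
  have fHe: "(\<Sum>k<n. f $$ (i,k) * H $$ (k,j)) = (if i = j then 1 else 0)" if "i < n" "j < n" for i j
  proof -
    have "(f * H) $$ (i,j) = (\<Sum>k<n. f $$ (i,k) * H $$ (k,j))"
      using that f H by (auto simp: times_mat_def scalar_prod_def atLeast0LessThan)
    then show ?thesis using fH that by simp
  qed
  have inv: "mat_inv (?f z) $$ (a,b) = H $$ (a,b) - z / (1 + z * H $$ (t,s)) * (H $$ (a,s) * H $$ (t,b))"
    if w: "1 + z * H $$ (t,s) \<noteq> 0" for z
  proof -
    define c where "c = z / (1 + z * H $$ (t,s))"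
    have c: "c * (1 + z * H $$ (t,s)) = z" using w by (simp add: c_def)
    (* the Sherman-Morrison inverse *)
    define N where "N = mat n n (\<lambda>(i,j). H $$ (i,j) - c * (H $$ (i,s) * H $$ (t,j)))"
    have "?f z * N = 1\<^sub>m n"
    proof (rule eq_matI)
      fix i j assume ij: "i < dim_row (1\<^sub>m n :: complex mat)" "j < dim_col (1\<^sub>m n :: complex mat)"
      have "(?f z * N) $$ (i,j) = (\<Sum>k<n. (f $$ (i,k) + (if i = s \<and> k = t then z else 0)) * (H $$ (k,j) - c * (H $$ (k,s) * H $$ (t,j))))"
        using ij by (auto simp: times_mat_def scalar_prod_def atLeast0LessThan N_def intro!: sum.cong)
      also have "\<dots> = (\<Sum>k<n. f $$ (i,k) * H $$ (k,j)) - c * (\<Sum>k<n. f $$ (i,k) * H $$ (k,s)) * H $$ (t,j)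
         + (\<Sum>k<n. if k = t then (if i = s then z * (H $$ (t,j) - c * (H $$ (t,s) * H $$ (t,j))) else 0) else 0)"
        unfolding sum_distrib_left sum_distrib_right sum_subtractf[symmetric] sum.distrib[symmetric]
        by (intro sum.cong) (auto simp: algebra_simps)
      also have "\<dots> = (if i = j then 1 else 0) + (if i = s then H $$ (t,j) * (z - c * (1 + z * H $$ (t,s))) else 0)"
        using ij st by (subst (1 2) fHe) (auto simp: algebra_simps)
      finally show "(?f z * N) $$ (i,j) = 1\<^sub>m n $$ (i,j)" using ij by (simp add: c)
    qed (auto simp: N_def)
    then have "mat_inv (?f z) = N" by (intro mat_inv_eqI) (auto simp: N_def)
    then show ?thesis using ab by (simp add: N_def c_def)
  qed
  have ev: "eventually (\<lambda>z. mat_inv (?f z) $$ (a,b) = H $$ (a,b) - z / (1 + z * H $$ (t,s)) * (H $$ (a,s) * H $$ (t,b))) (nhds 0)"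
  proof -
    have "((\<lambda>z. 1 + z * H $$ (t,s)) \<longlongrightarrow> 1 + 0 * H $$ (t,s)) (nhds 0)"
      by (intro tendsto_intros filterlim_ident)
    then have "eventually (\<lambda>z. 1 + z * H $$ (t,s) \<noteq> 0) (nhds 0)"
      by (rule tendsto_imp_eventually_ne) simp
    then show ?thesis by eventually_elim (rule inv)
  qed
  have "((\<lambda>z. H $$ (a,b) - z / (1 + z * H $$ (t,s)) * (H $$ (a,s) * H $$ (t,b))) has_field_derivative
       - (H $$ (a,s) * H $$ (t,b))) (at 0)"
    by (auto intro!: derivative_eq_intros)
  then show ?thesis using ev by (subst DERIV_cong_ev[OF refl _ refl])
qed

lemma corner_minor_derivative:
  fixes A :: "complex \<Rightarrow> nat \<Rightarrow> nat \<Rightarrow> complex"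
  assumes D: "\<And>i j. i < n \<Longrightarrow> j < n \<Longrightarrow> ((\<lambda>z. A z i j) has_field_derivative A' i j) (at z0)"
    and l: "r + l \<le> n" and nz: "corner_minor n (A z0) r l \<noteq> 0"
  shows "((\<lambda>z. corner_minor n (A z) r l) has_field_derivative
     corner_minor n (A z0) r l * (\<Sum>i<n. \<Sum>j<n. A' i j * dual_block n (A z0) r l j i)) (at z0)"
proof -
  have "((\<lambda>z. corner_minor n (A z) r l) has_field_derivative
      (\<Sum>a<l. \<Sum>b<l. A' (r+a) (n-l+b) * cofactor (block n (A z0) r l) a b)) (at z0)"
    unfolding corner_minor_def block_def using l
    by (intro det_has_field_derivative[where A = "\<lambda>z a b. A z (r+a) (n-l+b)"] D) auto
  moreover have "(\<Sum>i<n. \<Sum>j<n. A' i j * dual_block n (A z0) r l j i)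
     = (\<Sum>a<l. \<Sum>j<n. A' (r+a) j * dual_block n (A z0) r l j (r+a))"
    using l by (intro sum_over_window) (auto simp: dual_block_def)
  moreover have "(\<Sum>j<n. A' (r+a) j * dual_block n (A z0) r l j (r+a))
     = (\<Sum>b<l. A' (r+a) (n-l+b) * dual_block n (A z0) r l (n-l+b) (r+a))" for a
    using l by (intro sum_over_window) (auto simp: dual_block_def)
  moreover have "corner_minor n (A z0) r l * (\<Sum>a<l. \<Sum>b<l. A' (r+a) (n-l+b) * dual_block n (A z0) r l (n-l+b) (r+a))
     = (\<Sum>a<l. \<Sum>b<l. A' (r+a) (n-l+b) * cofactor (block n (A z0) r l) a b)"
    unfolding sum_distrib_left using l nz by (intro sum.cong refl) (auto simp: dual_block_def)
  ultimately show ?thesis by simp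
qed

lemma Delta_minor_corner: "Delta_minor n k l (g, f) = corner_minor n (\<lambda>i j. g $$ (i,j)) (n - k) l"
  by (simp add: Delta_minor_def corner_minor_def block_def)

lemma Lambda_minor_corner: "Lambda_minor n k l (g, f) = corner_minor n (\<lambda>i j. mat_inv f $$ (j,i)) (n - k) l"
proof -
  have "block n (\<lambda>i j. mat_inv f $$ (j,i)) (n-k) l = transpose_mat (mat l l (\<lambda>(a, b). mat_inv f $$ (n - l + a, n - k + b)))"
    by (intro eq_matI) (auto simp: block_def)
  then show ?thesis by (simp add: Lambda_minor_def corner_minor_def det_transpose[of _ l])
qed

lemma entry_deriv_Delta_F [simp]: "entry_deriv n (FEntry i j) (Delta_minor n k l) P = 0"
proof -
  obtain g f where "P = (g, f)" by force
  then show ?thesis by (simp add: entry_deriv_def Delta_minor_corner)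
qed

lemma entry_deriv_Lambda_G [simp]: "entry_deriv n (GEntry i j) (Lambda_minor n k l) P = 0"
proof -
  obtain g f where "P = (g, f)" by force
  then show ?thesis by (simp add: entry_deriv_def Lambda_minor_corner)
qed

lemma corner_minor_cong:
  assumes "\<And>i j. i < n \<Longrightarrow> j < n \<Longrightarrow> G i j = G' i j" "r + l \<le> n"
  shows "corner_minor n G r l = corner_minor n G' r l" "dual_block n G r l = dual_block n G' r l"
proof -
  have b: "block n G r l = block n G' r l"
    using assms by (intro eq_matI) (auto simp: block_def)
  show "corner_minor n G r l = corner_minor n G' r l" by (simp add: corner_minor_def b)
  show "dual_block n G r l = dual_block n G' r l" by (intro ext) (simp add: dual_block_def corner_minor_def b)
qed

lemma sum_sum_delta:
  fixes c :: "nat \<Rightarrow> nat \<Rightarrow> complex"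
  assumes "i < n" "j < n"
  shows "(\<Sum>a<n. \<Sum>b<n. (if (a,b) = (i,j) then 1 else 0) * c a b) = c i j"
proof -
  have "(\<Sum>a<n. \<Sum>b<n. (if (a,b) = (i,j) then 1 else 0) * c a b) = (\<Sum>b<n. (if (i,b) = (i,j) then 1 else 0) * c i b)"
    using assms by (intro sum_single) (auto intro!: sum.neutral)
  also have "\<dots> = c i j" using assms by (subst sum_single[of j n]) auto
  finally show ?thesis .
qed

lemma entry_deriv_Delta_G:
  assumes ij: "i < n" "j < n" and l: "n - k + l \<le> n" and nz: "Delta_minor n k l (g, f) \<noteq> 0"
  shows "entry_deriv n (GEntry i j) (Delta_minor n k l) (g, f) =
    Delta_minor n k l (g, f) * dual_block n (\<lambda>i j. g $$ (i,j)) (n - k) l j i"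
proof -
  let ?A = "\<lambda>z a b. mat n n (\<lambda>q. g $$ q + (if q = (i,j) then z else 0)) $$ (a,b)"
  have c: "corner_minor n (?A 0) (n-k) l = Delta_minor n k l (g, f)"
    "dual_block n (?A 0) (n-k) l = dual_block n (\<lambda>i j. g $$ (i,j)) (n-k) l"
    using corner_minor_cong[of n "?A 0" "\<lambda>i j. g $$ (i,j)" "n-k" l] l by (auto simp: Delta_minor_corner)
  have "((\<lambda>z. corner_minor n (?A z) (n-k) l) has_field_derivative
     corner_minor n (?A 0) (n-k) l * (\<Sum>a<n. \<Sum>b<n. (if (a,b) = (i,j) then 1 else 0) * dual_block n (?A 0) (n-k) l b a)) (at 0)"
  proof (rule corner_minor_derivative)
    fix a b assume ab: "a < n" "b < n"
    have "((\<lambda>z. g $$ (a,b) + (if (a,b) = (i,j) then z else 0)) has_field_derivative (if (a,b) = (i,j) then 1 else 0)) (at 0)"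
      by (cases "(a,b) = (i,j)") (auto intro!: derivative_eq_intros)
    then show "((\<lambda>z. ?A z a b) has_field_derivative (if (a,b) = (i,j) then 1 else 0)) (at 0)"
      using ab by simp
  qed (use l nz c in auto)
  from DERIV_imp_deriv[OF this] show ?thesis
    unfolding c sum_sum_delta[OF ij] entry_deriv_def shift_entry.simps Delta_minor_corner[of n k l] by simp
qed

text \<open>With \<open>K\<close> the transpose of the inverse of \<open>f\<close>, the minors of the inverse of \<open>f\<close> are corner minors of
\<open>K\<close>. The derivative of an inverse contributes a factor on either side of \<open>dual_block\<close>, which leaves a
row coefficient times an entry of \<open>K\<close>.\<close>

lemma entry_deriv_Lambda_F:
  fixes H :: "complex mat"
  defines "K \<equiv> (\<lambda>i j. H $$ (j,i))"
  assumes f: "f \<in> carrier_mat n n" and H: "H \<in> carrier_mat n n" and fH: "f * H = 1\<^sub>m n"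
    and st: "s < n" "t < n" and l: "n - k + l \<le> n" and nz: "Lambda_minor n k l (g, f) \<noteq> 0"
  shows "entry_deriv n (FEntry s t) (Lambda_minor n k l) (g, f) =
    - Lambda_minor n k l (g, f) * (\<Sum>b<n. row_coeff n K (n - k) l s b * K b t)"
proof -
  let ?f = "\<lambda>z. mat n n (\<lambda>q. f $$ q + (if q = (s,t) then z else 0))"
  let ?A = "\<lambda>z i j. mat_inv (?f z) $$ (j,i)"
  have f0: "?f 0 = f" using f by (intro eq_matI) auto
  have Hinv: "mat_inv f = H" using mat_inv_eqI[OF f H fH] .
  have A0: "?A 0 = K" unfolding f0 Hinv K_def ..
  have c: "corner_minor n (?A 0) (n-k) l = Lambda_minor n k l (g, f)"
    unfolding A0 Lambda_minor_corner Hinv K_def ..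
  have "((\<lambda>z. corner_minor n (?A z) (n-k) l) has_field_derivative
     corner_minor n (?A 0) (n-k) l * (\<Sum>a<n. \<Sum>b<n. - (H $$ (b,s) * H $$ (t,a)) * dual_block n (?A 0) (n-k) l b a)) (at 0)"
    by (rule corner_minor_derivative) (use mat_inv_derivative[OF f H fH st] l nz c in auto)
  from DERIV_imp_deriv[OF this] have "entry_deriv n (FEntry s t) (Lambda_minor n k l) (g, f) =
      Lambda_minor n k l (g, f) * (\<Sum>a<n. \<Sum>b<n. - (H $$ (b,s) * H $$ (t,a)) * dual_block n K (n-k) l b a)"
    unfolding c unfolding A0 entry_deriv_def shift_entry.simps Lambda_minor_corner by simp
  also have "(\<Sum>a<n. \<Sum>b<n. - (H $$ (b,s) * H $$ (t,a)) * dual_block n K (n-k) l b a)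
      = - (\<Sum>b<n. row_coeff n K (n - k) l s b * K b t)"
    unfolding row_coeff_def sum_distrib_right sum_negf[symmetric]
    by (intro sum.cong refl) (simp add: K_def)
  finally show ?thesis by simp
qed

section \<open>Brackets of minors\<close>

text \<open>The common inner step of the bracket computations: in each of the two terms of the bracket of entries one of
the summations is a matrix product of \<open>M\<close> with \<open>f\<close>, which is already known.\<close>

lemma contract_bracket:
  fixes f g M w :: "nat \<Rightarrow> nat \<Rightarrow> complex"
  assumes c1: "\<And>s i. s < n \<Longrightarrow> i < n \<Longrightarrow> (\<Sum>t<n. M s t * f i t) = A s i"
    and c2: "\<And>j t. j < n \<Longrightarrow> t < n \<Longrightarrow> (\<Sum>s<n. M s t * f s j) = B j t"
    and ij: "i < n" "j < n"
  shows "(\<Sum>s<n. \<Sum>t<n. M s t * (w i s * g s j * f i t - w t j * g i t * f s j))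
     = (\<Sum>s<n. w i s * g s j * A s i) - (\<Sum>t<n. w t j * g i t * B j t)"
proof -
  have "(\<Sum>s<n. \<Sum>t<n. M s t * (w i s * g s j * f i t - w t j * g i t * f s j))
     = (\<Sum>s<n. w i s * g s j * (\<Sum>t<n. M s t * f i t)) - (\<Sum>s<n. \<Sum>t<n. w t j * g i t * (M s t * f s j))"
    by (simp add: sum_distrib_left sum_subtractf[symmetric] algebra_simps)
  also have "(\<Sum>s<n. \<Sum>t<n. w t j * g i t * (M s t * f s j)) = (\<Sum>t<n. w t j * g i t * (\<Sum>s<n. M s t * f s j))"
    by (subst sum.swap) (simp add: sum_distrib_left)
  finally show ?thesis using ij by (simp add: c1 c2)
qed

lemma bracket_Delta_Delta:
  fixes g f :: "complex mat"
  defines "G \<equiv> (\<lambda>i j. g $$ (i,j))"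
  assumes l: "n - k + l \<le> n" "n - k' + l' \<le> n"
    and nz: "Delta_minor n k l (g, f) \<noteq> 0" "Delta_minor n k' l' (g, f) \<noteq> 0"
  shows "group_bracket n (Delta_minor n k l) (Delta_minor n k' l') (g, f) =
     Delta_minor n k l (g, f) * Delta_minor n k' l' (g, f) *
     ((\<Sum>i<n. \<Sum>s<n. ordering_weight i s * row_coeff n G (n - k) l s i * row_coeff n G (n - k') l' i s)
    - (\<Sum>j<n. \<Sum>t<n. ordering_weight t j * col_coeff n G (n - k) l j t * col_coeff n G (n - k') l' t j))"
proof -
  let ?D = "Delta_minor n k l (g, f)" and ?D' = "Delta_minor n k' l' (g, f)"
  let ?a = "dual_block n G (n - k) l" and ?a' = "dual_block n G (n - k') l'" and ?w = ordering_weight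
  have "group_bracket n (Delta_minor n k l) (Delta_minor n k' l') (g, f) =
     (\<Sum>i<n. \<Sum>j<n. \<Sum>s<n. \<Sum>t<n. (?D * ?a j i) * (?D' * ?a' t s) * (?w i s * G s j * G i t - ?w t j * G i t * G s j))"
    unfolding group_bracket_def sum_entries
    by (simp add: entry_deriv_Delta_G l nz tensor_comm_r_matrix G_def)
  also have "\<dots> = ?D * ?D' * (\<Sum>i<n. \<Sum>j<n. ?a j i * (\<Sum>s<n. \<Sum>t<n. ?a' t s * (?w i s * G s j * G i t - ?w t j * G i t * G s j)))"
    by (simp add: sum_distrib_left mult_ac)
  also have "(\<Sum>i<n. \<Sum>j<n. ?a j i * (\<Sum>s<n. \<Sum>t<n. ?a' t s * (?w i s * G s j * G i t - ?w t j * G i t * G s j)))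
     = (\<Sum>i<n. \<Sum>j<n. ?a j i * ((\<Sum>s<n. ?w i s * G s j * row_coeff n G (n - k') l' i s) - (\<Sum>t<n. ?w t j * G i t * col_coeff n G (n - k') l' t j)))"
    by (intro sum.cong refl arg_cong2[of _ _ _ _ "(*)"], rule contract_bracket[where A = "\<lambda>s i. row_coeff n G (n - k') l' i s" and B = "\<lambda>j t. col_coeff n G (n - k') l' t j"])
       (auto simp: row_coeff_def col_coeff_def mult_ac)
  also have "\<dots> = (\<Sum>i<n. \<Sum>j<n. \<Sum>s<n. ?w i s * (G s j * ?a j i) * row_coeff n G (n - k') l' i s)
       - (\<Sum>i<n. \<Sum>j<n. \<Sum>t<n. ?w t j * (?a j i * G i t) * col_coeff n G (n - k') l' t j)"
    by (simp add: right_diff_distrib sum_subtractf sum_distrib_left mult_ac)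
  also have "(\<Sum>i<n. \<Sum>j<n. \<Sum>s<n. ?w i s * (G s j * ?a j i) * row_coeff n G (n - k') l' i s)
     = (\<Sum>i<n. \<Sum>s<n. ?w i s * row_coeff n G (n - k) l s i * row_coeff n G (n - k') l' i s)"
    unfolding row_coeff_def[of n G "n - k" l]
    by (rule sum.cong[OF refl], subst sum.swap) (simp add: sum_distrib_left sum_distrib_right)
  also have "(\<Sum>i<n. \<Sum>j<n. \<Sum>t<n. ?w t j * (?a j i * G i t) * col_coeff n G (n - k') l' t j)
     = (\<Sum>j<n. \<Sum>t<n. ?w t j * col_coeff n G (n - k) l j t * col_coeff n G (n - k') l' t j)"
    unfolding col_coeff_def[of n G "n - k" l]
    by (subst sum.swap, rule sum.cong[OF refl], subst sum.swap) (simp add: sum_distrib_left sum_distrib_right)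
  finally show ?thesis .
qed

text \<open>For \<open>M = K\<cdot>dual\<cdot>K\<close>, the logarithmic gradient of a minor of the inverse of \<open>f\<close> up to sign, multiplication by \<open>f\<close>
cancels one of the outer factors \<open>K\<close>, and coefficients of \<open>K\<close> remain.\<close>

lemma dual_contractions:
  fixes K f :: "nat \<Rightarrow> nat \<Rightarrow> complex"
  assumes fK: "\<And>i b. i < n \<Longrightarrow> b < n \<Longrightarrow> (\<Sum>t<n. K b t * f i t) = (if b = i then 1 else 0)"
    and Kf: "\<And>c j. c < n \<Longrightarrow> j < n \<Longrightarrow> (\<Sum>s<n. K s c * f s j) = (if c = j then 1 else 0)"
  shows "s < n \<Longrightarrow> i < n \<Longrightarrow> (\<Sum>t<n. (\<Sum>b<n. row_coeff n K r l s b * K b t) * f i t) = row_coeff n K r l s i"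
    and "j < n \<Longrightarrow> t < n \<Longrightarrow> (\<Sum>s<n. (\<Sum>b<n. row_coeff n K r l s b * K b t) * f s j) = col_coeff n K r l j t"
proof -
  assume si: "s < n" "i < n"
  have "(\<Sum>t<n. (\<Sum>b<n. row_coeff n K r l s b * K b t) * f i t) = (\<Sum>b<n. row_coeff n K r l s b * (\<Sum>t<n. K b t * f i t))"
    unfolding sum_distrib_left sum_distrib_right by (subst sum.swap) (simp add: mult_ac)
  also have "\<dots> = row_coeff n K r l s i" using si by (subst sum_single[of i n]) (auto simp: fK)
  finally show "(\<Sum>t<n. (\<Sum>b<n. row_coeff n K r l s b * K b t) * f i t) = row_coeff n K r l s i" .
next
  assume jt: "j < n" "t < n"
  have "(\<Sum>s<n. (\<Sum>b<n. row_coeff n K r l s b * K b t) * f s j)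
      = (\<Sum>s<n. \<Sum>b<n. \<Sum>c<n. dual_block n K r l c b * K b t * (K s c * f s j))"
    unfolding row_coeff_def sum_distrib_right by (simp add: mult_ac)
  also have "\<dots> = (\<Sum>b<n. \<Sum>c<n. dual_block n K r l c b * K b t * (\<Sum>s<n. K s c * f s j))"
    unfolding sum_distrib_left by (subst sum.swap, rule sum.cong[OF refl], subst sum.swap) simp
  also have "\<dots> = (\<Sum>b<n. dual_block n K r l j b * K b t)"
    using jt by (intro sum.cong refl, subst sum_single[of j n]) (auto simp: Kf)
  finally show "(\<Sum>s<n. (\<Sum>b<n. row_coeff n K r l s b * K b t) * f s j) = col_coeff n K r l j t"
    by (simp add: col_coeff_def)
qed

lemma inverse_entries:
  assumes f: "f \<in> carrier_mat n n" and H: "H \<in> carrier_mat n n" and fH: "f * H = 1\<^sub>m n"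
  shows "i < n \<Longrightarrow> b < n \<Longrightarrow> (\<Sum>t<n. H $$ (t,b) * f $$ (i,t)) = (if b = i then 1 else (0::complex))"
    and "c < n \<Longrightarrow> j < n \<Longrightarrow> (\<Sum>s<n. H $$ (c,s) * f $$ (s,j)) = (if c = j then 1 else (0::complex))"
proof -
  have Hf: "H * f = 1\<^sub>m n" using mat_mult_left_right_inverse[OF f H fH] .
  show "(\<Sum>t<n. H $$ (t,b) * f $$ (i,t)) = (if b = i then 1 else (0::complex))" if "i < n" "b < n"
  proof -
    have "(f * H) $$ (i,b) = (\<Sum>t<n. H $$ (t,b) * f $$ (i,t))"
      using that f H by (auto simp: times_mat_def scalar_prod_def atLeast0LessThan mult.commute)
    then show ?thesis using fH that by auto
  qed
  show "(\<Sum>s<n. H $$ (c,s) * f $$ (s,j)) = (if c = j then 1 else (0::complex))" if "c < n" "j < n"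
  proof -
    have "(H * f) $$ (c,j) = (\<Sum>s<n. H $$ (c,s) * f $$ (s,j))"
      using that f H by (auto simp: times_mat_def scalar_prod_def atLeast0LessThan)
    then show ?thesis using Hf that by auto
  qed
qed

lemma bracket_Delta_Lambda:
  fixes g f H :: "complex mat"
  defines "G \<equiv> (\<lambda>i j. g $$ (i,j))" and "K \<equiv> (\<lambda>i j. H $$ (j,i))"
  assumes f: "f \<in> carrier_mat n n" and H: "H \<in> carrier_mat n n" and fH: "f * H = 1\<^sub>m n"
    and l: "n - k + l \<le> n" "n - k' + l' \<le> n"
    and nz: "Delta_minor n k l (g, f) \<noteq> 0" "Lambda_minor n k' l' (g, f) \<noteq> 0"
  shows "group_bracket n (Delta_minor n k l) (Lambda_minor n k' l') (g, f) =
     Delta_minor n k l (g, f) * Lambda_minor n k' l' (g, f) *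
     ((\<Sum>j<n. \<Sum>t<n. ordering_weight t j * col_coeff n G (n - k) l j t * col_coeff n K (n - k') l' j t)
    - (\<Sum>i<n. \<Sum>s<n. ordering_weight i s * row_coeff n G (n - k) l s i * row_coeff n K (n - k') l' s i))"
proof -
  let ?D = "Delta_minor n k l (g, f)" and ?L = "Lambda_minor n k' l' (g, f)"
  let ?a = "dual_block n G (n - k) l" and ?w = ordering_weight
  let ?A = "row_coeff n K (n - k') l'" and ?B = "col_coeff n K (n - k') l'"
  define M where "M s t = (\<Sum>b<n. ?A s b * K b t)" for s t
  have c1: "(\<Sum>t<n. M s t * f $$ (i,t)) = ?A s i" if "s < n" "i < n" for s i
    unfolding M_def
    by (rule dual_contractions(1)[where f = "\<lambda>i j. f $$ (i,j)"]) (use inverse_entries[OF f H fH] that in \<open>auto simp: K_def\<close>)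
  have c2: "(\<Sum>s<n. M s t * f $$ (s,j)) = ?B j t" if "j < n" "t < n" for j t
    unfolding M_def
    by (rule dual_contractions(2)[where f = "\<lambda>i j. f $$ (i,j)"]) (use inverse_entries[OF f H fH] that in \<open>auto simp: K_def\<close>)
  have "group_bracket n (Delta_minor n k l) (Lambda_minor n k' l') (g, f) =
     (\<Sum>i<n. \<Sum>j<n. \<Sum>s<n. \<Sum>t<n. (?D * ?a j i) * (- ?L * M s t) * (?w i s * G s j * f $$ (i,t) - ?w t j * G i t * f $$ (s,j)))"
    unfolding group_bracket_def sum_entries
    by (simp add: entry_deriv_Delta_G entry_deriv_Lambda_F[OF f H fH] l nz tensor_comm_r_matrix G_def K_def M_def del: mult_minus_left)
  also have "\<dots> = - (?D * ?L) * (\<Sum>i<n. \<Sum>j<n. ?a j i * (\<Sum>s<n. \<Sum>t<n. M s t * (?w i s * G s j * f $$ (i,t) - ?w t j * G i t * f $$ (s,j))))"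
    by (simp add: sum_distrib_left mult_ac sum_negf)
  also have "(\<Sum>i<n. \<Sum>j<n. ?a j i * (\<Sum>s<n. \<Sum>t<n. M s t * (?w i s * G s j * f $$ (i,t) - ?w t j * G i t * f $$ (s,j))))
     = (\<Sum>i<n. \<Sum>j<n. ?a j i * ((\<Sum>s<n. ?w i s * G s j * ?A s i) - (\<Sum>t<n. ?w t j * G i t * ?B j t)))"
    by (intro sum.cong refl arg_cong2[of _ _ _ _ "(*)"], rule contract_bracket[where f = "\<lambda>i t. f $$ (i,t)"]) (auto simp: c1 c2)
  also have "\<dots> = (\<Sum>i<n. \<Sum>j<n. \<Sum>s<n. ?w i s * (G s j * ?a j i) * ?A s i)
       - (\<Sum>i<n. \<Sum>j<n. \<Sum>t<n. ?w t j * (?a j i * G i t) * ?B j t)"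
    by (simp add: right_diff_distrib sum_subtractf sum_distrib_left mult_ac)
  also have "(\<Sum>i<n. \<Sum>j<n. \<Sum>s<n. ?w i s * (G s j * ?a j i) * ?A s i)
     = (\<Sum>i<n. \<Sum>s<n. ?w i s * row_coeff n G (n - k) l s i * ?A s i)"
    unfolding row_coeff_def[of n G "n - k" l]
    by (rule sum.cong[OF refl], subst sum.swap) (simp add: sum_distrib_left sum_distrib_right)
  also have "(\<Sum>i<n. \<Sum>j<n. \<Sum>t<n. ?w t j * (?a j i * G i t) * ?B j t)
     = (\<Sum>j<n. \<Sum>t<n. ?w t j * col_coeff n G (n - k) l j t * ?B j t)"
    unfolding col_coeff_def[of n G "n - k" l]
    by (subst sum.swap, rule sum.cong[OF refl], subst sum.swap) (simp add: sum_distrib_left sum_distrib_right)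
  finally show ?thesis by (simp add: algebra_simps)
qed

lemma bracket_Lambda_Lambda:
  fixes g f H :: "complex mat"
  defines "K \<equiv> (\<lambda>i j. H $$ (j,i))"
  assumes f: "f \<in> carrier_mat n n" and H: "H \<in> carrier_mat n n" and fH: "f * H = 1\<^sub>m n"
    and l: "n - k + l \<le> n" "n - k' + l' \<le> n"
    and nz: "Lambda_minor n k l (g, f) \<noteq> 0" "Lambda_minor n k' l' (g, f) \<noteq> 0"
  shows "group_bracket n (Lambda_minor n k l) (Lambda_minor n k' l') (g, f) =
     Lambda_minor n k l (g, f) * Lambda_minor n k' l' (g, f) *
     ((\<Sum>i<n. \<Sum>s<n. ordering_weight i s * row_coeff n K (n - k') l' s i * row_coeff n K (n - k) l i s)
    - (\<Sum>j<n. \<Sum>t<n. ordering_weight t j * col_coeff n K (n - k') l' j t * col_coeff n K (n - k) l t j))"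
proof -
  let ?D = "Lambda_minor n k l (g, f)" and ?L = "Lambda_minor n k' l' (g, f)" and ?w = ordering_weight
  define A where "A r l = row_coeff n K r l" for r l
  define B where "B r l = col_coeff n K r l" for r l
  define M where "M r l s t = (\<Sum>b<n. A r l s b * K b t)" for r l s t
  have c1: "(\<Sum>t<n. M r l s t * f $$ (i,t)) = A r l s i" if "s < n" "i < n" for r l s i
    unfolding M_def A_def
    by (rule dual_contractions(1)[where f = "\<lambda>i j. f $$ (i,j)"]) (use inverse_entries[OF f H fH] that in \<open>auto simp: K_def\<close>)
  have c2: "(\<Sum>s<n. M r l s t * f $$ (s,j)) = B r l j t" if "j < n" "t < n" for r l j t
    unfolding M_def A_def B_def
    by (rule dual_contractions(2)[where f = "\<lambda>i j. f $$ (i,j)"]) (use inverse_entries[OF f H fH] that in \<open>auto simp: K_def\<close>)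
  let ?M = "M (n-k) l" and ?M' = "M (n-k') l'" and ?A' = "A (n-k') l'" and ?B' = "B (n-k') l'"
  have "group_bracket n (Lambda_minor n k l) (Lambda_minor n k' l') (g, f) =
     (\<Sum>i<n. \<Sum>j<n. \<Sum>s<n. \<Sum>t<n. (- ?D * ?M i j) * (- ?L * ?M' s t) * (?w i s * f $$ (s,j) * f $$ (i,t) - ?w t j * f $$ (i,t) * f $$ (s,j)))"
    unfolding group_bracket_def sum_entries
    by (simp add: entry_deriv_Lambda_F[OF f H fH] l nz tensor_comm_r_matrix K_def M_def A_def del: mult_minus_left)
  also have "\<dots> = ?D * ?L * (\<Sum>i<n. \<Sum>j<n. ?M i j * (\<Sum>s<n. \<Sum>t<n. ?M' s t * (?w i s * f $$ (s,j) * f $$ (i,t) - ?w t j * f $$ (i,t) * f $$ (s,j))))"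
    by (simp add: sum_distrib_left mult_ac)
  also have "(\<Sum>i<n. \<Sum>j<n. ?M i j * (\<Sum>s<n. \<Sum>t<n. ?M' s t * (?w i s * f $$ (s,j) * f $$ (i,t) - ?w t j * f $$ (i,t) * f $$ (s,j))))
     = (\<Sum>i<n. \<Sum>j<n. ?M i j * ((\<Sum>s<n. ?w i s * f $$ (s,j) * ?A' s i) - (\<Sum>t<n. ?w t j * f $$ (i,t) * ?B' j t)))"
    by (intro sum.cong refl arg_cong2[of _ _ _ _ "(*)"], rule contract_bracket[where f = "\<lambda>i t. f $$ (i,t)" and g = "\<lambda>i t. f $$ (i,t)"]) (auto simp: c1 c2)
  also have "\<dots> = (\<Sum>i<n. \<Sum>j<n. \<Sum>s<n. ?w i s * ?A' s i * (?M i j * f $$ (s,j)))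
       - (\<Sum>i<n. \<Sum>j<n. \<Sum>t<n. ?w t j * ?B' j t * (?M i j * f $$ (i,t)))"
    by (simp add: right_diff_distrib sum_subtractf sum_distrib_left mult_ac)
  also have "(\<Sum>i<n. \<Sum>j<n. \<Sum>s<n. ?w i s * ?A' s i * (?M i j * f $$ (s,j)))
     = (\<Sum>i<n. \<Sum>s<n. ?w i s * ?A' s i * A (n-k) l i s)"
    by (rule sum.cong[OF refl], subst sum.swap) (simp add: sum_distrib_left[symmetric] c1)
  also have "(\<Sum>i<n. \<Sum>j<n. \<Sum>t<n. ?w t j * ?B' j t * (?M i j * f $$ (i,t)))
     = (\<Sum>j<n. \<Sum>t<n. ?w t j * ?B' j t * B (n-k) l t j)"
    by (subst sum.swap, rule sum.cong[OF refl], subst sum.swap) (simp add: sum_distrib_left[symmetric] c2)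
  finally show ?thesis unfolding A_def B_def .
qed

text \<open>The factor \<open>ordering_weight\<close> forces \<open>i \<le> s\<close>. As the second window starts first and contains \<open>s\<close>, it also
contains \<open>i\<close>, so its coefficient vanishes unless \<open>i = s\<close>. Thus only the common rows survive.\<close>

lemma row_sum_triangular:
  assumes "r + l \<le> n" "r' + l' \<le> n" "r' \<le> r" "corner_minor n G r l \<noteq> 0" "corner_minor n G r' l' \<noteq> 0"
  shows "(\<Sum>i<n. \<Sum>s<n. ordering_weight i s * row_coeff n G r l s i * row_coeff n G r' l' i s)
     = of_nat (card ({r..<r+l} \<inter> {r'..<r'+l'})) / 2"
proof -
  have "(\<Sum>s<n. ordering_weight i s * row_coeff n G r l s i * row_coeff n G r' l' i s)
      = (if i \<in> {r..<r+l} \<inter> {r'..<r'+l'} then 1/2 else 0)" if i: "i < n" for i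
  proof -
    have z: "ordering_weight i s * row_coeff n G r l s i * row_coeff n G r' l' i s = 0" if "s \<noteq> i" for s
    proof (cases "r \<le> i \<and> i < r + l \<and> r' \<le> s \<and> s < r' + l' \<and> i \<le> s")
      case True
      then show ?thesis using assms that by (simp add: row_coeff_inside[of r' l'])
    next
      case False
      then show ?thesis using row_coeff_outside[of r i l n G s] row_coeff_outside[of r' s l' n G i]
        by (auto simp: ordering_weight_def)
    qed
    then have "(\<Sum>s<n. ordering_weight i s * row_coeff n G r l s i * row_coeff n G r' l' i s)
       = ordering_weight i i * row_coeff n G r l i i * row_coeff n G r' l' i i"
      using i by (intro sum_single) auto
    then show ?thesis using assms row_coeff_outside[of r i l n G i] row_coeff_outside[of r' i l' n G i]
      by (auto simp: ordering_weight_def row_coeff_inside)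
  qed
  then have "(\<Sum>i<n. \<Sum>s<n. ordering_weight i s * row_coeff n G r l s i * row_coeff n G r' l' i s)
     = (\<Sum>i<n. if i \<in> {r..<r+l} \<inter> {r'..<r'+l'} then 1/2 else 0)" by (intro sum.cong) auto
  also have "\<dots> = (\<Sum>i\<in>{r..<r+l} \<inter> {r'..<r'+l'}. 1/2)"
    using assms by (intro sum.mono_neutral_cong_right) auto
  finally show ?thesis by simp
qed

text \<open>As for the rows; the sets of columns are nested, so the two blocks can come in either order.\<close>

lemma col_sum_triangular:
  assumes "r + l \<le> n" "r' + l' \<le> n" "corner_minor n G r l \<noteq> 0" "corner_minor n G r' l' \<noteq> 0"
  shows "(\<Sum>j<n. \<Sum>t<n. ordering_weight t j * col_coeff n G r l j t * col_coeff n G r' l' t j) = of_nat (min l l') / 2"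
proof -
  have "(\<Sum>t<n. ordering_weight t j * col_coeff n G r l j t * col_coeff n G r' l' t j)
      = (if j \<in> {n - min l l'..<n} then 1/2 else 0)" if j: "j < n" for j
  proof -
    have z: "ordering_weight t j * col_coeff n G r l j t * col_coeff n G r' l' t j = 0" if "t \<noteq> j" for t
    proof (cases "n - l' \<le> t \<and> t < j")
      case True
      then have "col_coeff n G r' l' t j = 0" using assms j by (subst col_coeff_inside) auto
      then show ?thesis by simp
    next
      case False
      then show ?thesis using col_coeff_outside[of n l' t G r' j] that
        by (auto simp: ordering_weight_def)
    qed
    then have "(\<Sum>t<n. ordering_weight t j * col_coeff n G r l j t * col_coeff n G r' l' t j)
       = ordering_weight j j * col_coeff n G r l j j * col_coeff n G r' l' j j"
      using j by (intro sum_single) auto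
    then show ?thesis using j assms col_coeff_outside[of n l j G r j] col_coeff_outside[of n l' j G r' j]
      by (auto simp: ordering_weight_def col_coeff_inside min_def split: if_splits)
  qed
  then have "(\<Sum>j<n. \<Sum>t<n. ordering_weight t j * col_coeff n G r l j t * col_coeff n G r' l' t j)
     = (\<Sum>j<n. if j \<in> {n - min l l'..<n} then 1/2 else 0)" by (intro sum.cong) auto
  also have "\<dots> = (\<Sum>j\<in>{n - min l l'..<n}. 1/2)"
    using assms by (intro sum.mono_neutral_cong_right) auto
  finally show ?thesis using assms by simp
qed

text \<open>Here both coefficients expand the same row \<open>s\<close>. It contributes if \<open>s = i\<close>, or if it lies below
both windows, because the coefficients of the other rows of either block vanish.\<close>

lemma row_sum_parallel:
  assumes "r + l \<le> n" "r' + l' \<le> n" "corner_minor n G r l \<noteq> 0" "corner_minor n K r' l' \<noteq> 0"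
  shows "(\<Sum>i<n. \<Sum>s<n. ordering_weight i s * row_coeff n G r l s i * row_coeff n K r' l' s i)
     = of_nat (card ({r..<r+l} \<inter> {r'..<r'+l'})) / 2
       + (\<Sum>i\<in>{r..<r+l} \<inter> {r'..<r'+l'}. \<Sum>s\<in>{max (r+l) (r'+l')..<n}. row_coeff n G r l s i * row_coeff n K r' l' s i)"
proof -
  let ?I = "{r..<r+l} \<inter> {r'..<r'+l'}" and ?S = "{max (r+l) (r'+l')..<n}"
  let ?t = "\<lambda>i s. ordering_weight i s * row_coeff n G r l s i * row_coeff n K r' l' s i"
  have "(\<Sum>i<n. \<Sum>s<n. ?t i s) = (\<Sum>i\<in>?I. \<Sum>s<n. ?t i s)"
    using assms row_coeff_outside[of r _ l n G] row_coeff_outside[of r' _ l' n K]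
    by (intro sum.mono_neutral_right) (auto intro!: sum.neutral)
  also have "\<dots> = (\<Sum>i\<in>?I. 1/2 + (\<Sum>s\<in>?S. row_coeff n G r l s i * row_coeff n K r' l' s i))"
  proof (intro sum.cong refl)
    fix i assume i: "i \<in> ?I"
    have "(\<Sum>s<n. ?t i s) = (\<Sum>s\<in>insert i ?S. ?t i s)"
    proof (intro sum.mono_neutral_right ballI)
      fix s assume s: "s \<in> {..<n} - insert i ?S"
      show "?t i s = 0"
      proof (cases "i < s")
        case False then show ?thesis using s by (auto simp: ordering_weight_def)
      next
        case True
        then have "(r \<le> s \<and> s < r + l) \<or> (r' \<le> s \<and> s < r' + l')" using s i by auto
        then show ?thesis using True assms by (auto simp: row_coeff_inside)
      qed
    qed (use i assms in auto)
    also have "\<dots> = ?t i i + (\<Sum>s\<in>?S. ?t i s)" using i by (subst sum.insert) auto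
    also have "?t i i = 1/2" using i assms by (simp add: row_coeff_inside ordering_weight_def)
    also have "(\<Sum>s\<in>?S. ?t i s) = (\<Sum>s\<in>?S. row_coeff n G r l s i * row_coeff n K r' l' s i)"
      using i by (intro sum.cong) (auto simp: ordering_weight_def)
    finally show "(\<Sum>s<n. ?t i s) = 1/2 + (\<Sum>s\<in>?S. row_coeff n G r l s i * row_coeff n K r' l' s i)" .
  qed
  finally show ?thesis by (simp add: sum.distrib)
qed

lemma col_sum_parallel:
  assumes "r + l \<le> n" "r' + l' \<le> n" "corner_minor n G r l \<noteq> 0" "corner_minor n K r' l' \<noteq> 0"
  shows "(\<Sum>j<n. \<Sum>t<n. ordering_weight t j * col_coeff n G r l j t * col_coeff n K r' l' j t)
     = of_nat (min l l') / 2
       + (\<Sum>j\<in>{n - min l l'..<n}. \<Sum>t<n - max l l'. col_coeff n G r l j t * col_coeff n K r' l' j t)"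
proof -
  let ?I = "{n - min l l'..<n}" and ?S = "{..<n - max l l'}"
  let ?t = "\<lambda>j t. ordering_weight t j * col_coeff n G r l j t * col_coeff n K r' l' j t"
  have "(\<Sum>j<n. \<Sum>t<n. ?t j t) = (\<Sum>j\<in>?I. \<Sum>t<n. ?t j t)"
    using assms col_coeff_outside[of n l _ G r] col_coeff_outside[of n l' _ K r']
    by (intro sum.mono_neutral_right) (auto intro!: sum.neutral simp: min_def split: if_splits)
  also have "\<dots> = (\<Sum>j\<in>?I. 1/2 + (\<Sum>t\<in>?S. col_coeff n G r l j t * col_coeff n K r' l' j t))"
  proof (intro sum.cong refl)
    fix j assume j: "j \<in> ?I"
    have "(\<Sum>t<n. ?t j t) = (\<Sum>t\<in>insert j ?S. ?t j t)"
    proof (intro sum.mono_neutral_right ballI)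
      fix t assume t: "t \<in> {..<n} - insert j ?S"
      show "?t j t = 0"
      proof (cases "t < j")
        case False then show ?thesis using t by (auto simp: ordering_weight_def)
      next
        case True
        then have "n - l \<le> t \<or> n - l' \<le> t" using t j by auto
        then show ?thesis using True t assms by (auto simp: col_coeff_inside)
      qed
    qed (use j assms in auto)
    also have "\<dots> = ?t j j + (\<Sum>t\<in>?S. ?t j t)" using j assms by (subst sum.insert) auto
    also have "?t j j = 1/2"
    proof -
      have "n - l \<le> j" "n - l' \<le> j" "j < n" using j by auto
      then show ?thesis using assms by (simp add: col_coeff_inside ordering_weight_def)
    qed
    also have "(\<Sum>t\<in>?S. ?t j t) = (\<Sum>t\<in>?S. col_coeff n G r l j t * col_coeff n K r' l' j t)"
      using j by (intro sum.cong) (auto simp: ordering_weight_def)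
    finally show "(\<Sum>t<n. ?t j t) = 1/2 + (\<Sum>t\<in>?S. col_coeff n G r l j t * col_coeff n K r' l' j t)" .
  qed
  also have "\<dots> = of_nat (card ?I) / 2 + (\<Sum>j\<in>?I. \<Sum>t\<in>?S. col_coeff n G r l j t * col_coeff n K r' l' j t)"
    by (simp add: sum.distrib)
  also have "card ?I = min l l'" using assms by simp
  finally show ?thesis .
qed

section \<open>Brackets on the real form\<close>

lemma mat_adjoint_entry:
  fixes A :: "complex mat"
  assumes "A \<in> carrier_mat n n" "i < n" "j < n"
  shows "mat_adjoint A $$ (i,j) = cnj (A $$ (j,i))"
  using assms by (auto simp: mat_adjoint_def mat_of_rows_def cols_def)

lemma mat_adjoint_carrier [simp]: "A \<in> carrier_mat n n \<Longrightarrow> mat_adjoint A \<in> carrier_mat n n" for A :: "complex mat"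
  by (auto simp: mat_adjoint_def)

lemma invertible_mat_inverse:
  fixes A :: "complex mat"
  assumes A: "A \<in> carrier_mat n n" and "invertible_mat A"
  shows "mat_inv A \<in> carrier_mat n n" "A * mat_inv A = 1\<^sub>m n"
proof -
  obtain B where B: "inverts_mat A B" "inverts_mat B A"
    using assms(2) by (auto simp: invertible_mat_def)
  have "dim_col (A * B) = n" "dim_col (B * A) = dim_row B"
    using B A unfolding inverts_mat_def by auto
  then have "B \<in> carrier_mat n n" using A by auto
  moreover have AB: "A * B = 1\<^sub>m n" using B A unfolding inverts_mat_def by auto
  ultimately have "mat_inv A = B" using A by (intro mat_inv_eqI)
  then show "mat_inv A \<in> carrier_mat n n" "A * mat_inv A = 1\<^sub>m n"
    using \<open>B \<in> carrier_mat n n\<close> AB by auto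
qed

text \<open>On the real form \<open>f\<close> is the inverse of the adjoint of \<open>g\<close>, so the inverse of \<open>f\<close> has the entries
of \<open>g\<close>, conjugated and transposed.\<close>

lemma real_formD:
  assumes "(g, f) \<in> real_form n"
  shows "g \<in> carrier_mat n n" "f \<in> carrier_mat n n" "f * mat_adjoint g = 1\<^sub>m n"
    "\<And>i j. j < i \<Longrightarrow> i < n \<Longrightarrow> g $$ (i,j) = 0"
proof -
  show g: "g \<in> carrier_mat n n" and f: "f \<in> carrier_mat n n"
    and ut: "\<And>i j. j < i \<Longrightarrow> i < n \<Longrightarrow> g $$ (i,j) = 0"
    using assms by (auto simp: real_form_def G_star_def B_plus_def B_minus_def)
  have "invertible_mat g" and adj: "mat_adjoint f = mat_inv g"
    using assms by (auto simp: real_form_def G_star_def B_plus_def)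
  then have gf: "g * mat_adjoint f = 1\<^sub>m n" using invertible_mat_inverse[OF g] by simp
  show "f * mat_adjoint g = 1\<^sub>m n"
  proof (rule eq_matI)
    fix i j assume ij: "i < dim_row (1\<^sub>m n :: complex mat)" "j < dim_col (1\<^sub>m n :: complex mat)"
    have "(f * mat_adjoint g) $$ (i,j) = (\<Sum>k<n. f $$ (i,k) * cnj (g $$ (j,k)))"
      using ij f g by (auto simp: times_mat_def scalar_prod_def atLeast0LessThan mat_adjoint_entry
          mat_adjoint_carrier[THEN carrier_matD(1)] mat_adjoint_carrier[THEN carrier_matD(2)] intro!: sum.cong)
    also have "\<dots> = cnj (\<Sum>k<n. g $$ (j,k) * cnj (f $$ (i,k)))"
      by (simp add: mult.commute)
    also have "(\<Sum>k<n. g $$ (j,k) * cnj (f $$ (i,k))) = (g * mat_adjoint f) $$ (j,i)"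
      using ij f g by (auto simp: times_mat_def scalar_prod_def atLeast0LessThan mat_adjoint_entry
          mat_adjoint_carrier[THEN carrier_matD(1)] mat_adjoint_carrier[THEN carrier_matD(2)] intro!: sum.cong)
    finally show "(f * mat_adjoint g) $$ (i,j) = 1\<^sub>m n $$ (i,j)" using gf ij by auto
  qed (use f g in \<open>auto simp: mat_adjoint_carrier[THEN carrier_matD(2)]\<close>)
qed

definition upper_entries :: "complex mat \<times> complex mat \<Rightarrow> nat \<Rightarrow> nat \<Rightarrow> complex" where
  "upper_entries p i j = fst p $$ (i,j)"

lemma Delta_minor_upper_entries: "Delta_minor n k l p = corner_minor n (upper_entries p) (n - k) l"
proof -
  have "upper_entries p = (\<lambda>i j. fst p $$ (i,j))" by (intro ext) (simp add: upper_entries_def)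
  then show ?thesis using Delta_minor_corner[of n k l "fst p" "snd p"] by simp
qed

text \<open>The chart conditions cover all corner minors, since \<open>r + l \<le> n\<close> says that the lower index is at most the
upper index \<open>n - r\<close>.\<close>

lemma chart_regular:
  assumes "p \<in> chart n"
  shows "corner_regular n (upper_entries p)"
  unfolding corner_regular_def
proof (intro allI impI)
  fix r l assume rl: "r + l \<le> n"
  have eq: "corner_minor n (upper_entries p) r l = Delta_minor n (n - r) l p"
    using rl by (simp add: Delta_minor_upper_entries)
  consider "l = 0" | "l = n - r" "l > 0" | "l \<in> {1..<n-r}" "n - r \<in> {1..n}" using rl by force
  then show "corner_minor n (upper_entries p) r l \<noteq> 0"
  proof cases
    case 2
    then have "n - r \<in> {1..n}" by auto
    then have "0 < Re (Delta_minor n (n - r) (n - r) p)" using assms unfolding chart_def by blast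
    then show ?thesis using eq 2(1) by auto
  next
    case 3
    then show ?thesis using assms unfolding eq chart_def by blast
  qed auto
qed

lemma chart_upper_entries_zero: "p \<in> chart n \<Longrightarrow> j < i \<Longrightarrow> i < n \<Longrightarrow> upper_entries p i j = 0"
  using real_formD(4)[of "fst p" "snd p" n j i] unfolding chart_def upper_entries_def by simp

lemma det_cnj:
  assumes "A \<in> carrier_mat m m" "B \<in> carrier_mat m m" "\<And>i j. i < m \<Longrightarrow> j < m \<Longrightarrow> B $$ (i,j) = cnj (A $$ (i,j))"
  shows "Determinant.det B = cnj (Determinant.det A)"
proof -
  have s: "cnj (signof p) = signof p" for p :: "nat \<Rightarrow> nat" by (cases p rule: sign_cases) auto
  have "(\<Prod>i = 0..<m. B $$ (i, p i)) = (\<Prod>i = 0..<m. cnj (A $$ (i, p i)))" if "p permutes {0..<m}" for p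
    using that assms(3) permutes_in_image[OF that] by (intro prod.cong) auto
  then show ?thesis using assms(1,2) by (simp add: det_def' s)
qed

lemma corner_cnj:
  assumes "\<And>i j. i < n \<Longrightarrow> j < n \<Longrightarrow> K i j = cnj (G i j)" "r + l \<le> n"
  shows "corner_minor n K r l = cnj (corner_minor n G r l)"
    and "dual_block n K r l j i = cnj (dual_block n G r l j i)"
    and "i < n \<Longrightarrow> row_coeff n K r l i s = cnj (row_coeff n G r l i s)"
    and "t < n \<Longrightarrow> col_coeff n K r l j t = cnj (col_coeff n G r l j t)"
proof -
  show c: "corner_minor n K r l = cnj (corner_minor n G r l)"
    unfolding corner_minor_def using assms by (intro det_cnj[of _ l]) (auto simp: block_def)
  show d: "dual_block n K r l j i = cnj (dual_block n G r l j i)" for i j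
  proof (cases "r \<le> i \<and> i < r + l \<and> n - l \<le> j \<and> j < n")
    case True
    have "Determinant.det (mat_delete (block n K r l) (i - r) (j - (n - l))) = cnj (Determinant.det (mat_delete (block n G r l) (i - r) (j - (n - l))))"
      using True assms by (intro det_cnj[of _ "l - 1"]) (auto simp: mat_delete_def block_def)
    then show ?thesis using True by (simp add: dual_block_def cofactor_def c)
  qed (auto simp: dual_block_def)
  show "i < n \<Longrightarrow> row_coeff n K r l i s = cnj (row_coeff n G r l i s)"
    using assms(1) by (simp add: row_coeff_def d)
  show "t < n \<Longrightarrow> col_coeff n K r l j t = cnj (col_coeff n G r l j t)"
    using assms(1) by (simp add: col_coeff_def d)
qed

lemma half_difference_regroup:
  fixes B :: complex
  assumes "B = D * D' * (c / 2 - m / 2)"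
  shows "\<i> * B = \<i> / 2 * (c - m) * (D * D')"
  unfolding assms by (simp add: field_simps)

lemma half_difference_regroup':
  fixes B :: complex
  assumes "B = D * D' * (m / 2 + C - (c / 2 + R))"
  shows "\<i> * B = \<i> / 2 * (m - c) * (D * D') + D * D' * \<i> * (C - R)"
  unfolding assms by (simp add: field_simps)

text \<open>At a point of the chart the conjugated matrix \<open>K\<close> plays for the functions \<open>\<Lambda>\<close> the role that \<open>G\<close> plays for
the functions \<open>\<Delta>\<close>.\<close>

locale chart_point =
  fixes n :: nat and p :: "complex mat \<times> complex mat"
  assumes in_chart: "p \<in> chart n"
begin

abbreviation "G \<equiv> upper_entries p"

definition K :: "nat \<Rightarrow> nat \<Rightarrow> complex" where "K i j = mat_adjoint (fst p) $$ (j,i)"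

lemma real_form: "(fst p, snd p) \<in> real_form n"
  using in_chart by (simp add: chart_def)

lemma K_cnj: "i < n \<Longrightarrow> j < n \<Longrightarrow> K i j = cnj (G i j)"
  using real_formD(1)[OF real_form] by (simp add: K_def upper_entries_def mat_adjoint_entry)

lemmas K_corner_cnj = corner_cnj[of n K G, OF K_cnj]

lemma regular: "corner_regular n G" using chart_regular in_chart .

lemma minor_nz: "r + l \<le> n \<Longrightarrow> corner_minor n G r l \<noteq> 0" "r + l \<le> n \<Longrightarrow> corner_minor n K r l \<noteq> 0"
  using corner_regularD[OF regular] by (auto simp: K_corner_cnj)

lemma mat_inv_snd: "mat_inv (snd p) = mat_adjoint (fst p)"
  using real_formD[OF real_form] by (intro mat_inv_eqI) auto

lemma Lambda_K: "Lambda_minor n k l p = corner_minor n K (n - k) l"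
  using Lambda_minor_corner[of n k l "fst p" "snd p"] by (simp add: mat_inv_snd K_def[abs_def])

lemma Lambda_cnj: "l \<le> k \<Longrightarrow> k \<le> n \<Longrightarrow> Lambda_minor n k l p = cnj (Delta_minor n k l p)"
  by (simp add: Lambda_K Delta_minor_upper_entries K_corner_cnj)

lemma Delta_nz: "l \<le> k \<Longrightarrow> k \<le> n \<Longrightarrow> Delta_minor n k l p \<noteq> 0"
  by (simp add: Delta_minor_upper_entries minor_nz)

lemma Lambda_nz: "l \<le> k \<Longrightarrow> k \<le> n \<Longrightarrow> Lambda_minor n k l p \<noteq> 0"
  by (simp add: Lambda_K minor_nz)

lemma Delta_Delta:
  assumes "l \<le> k" "k \<le> k'" "l' \<le> k'" "k' \<le> n"
  shows "real_bracket n (Delta_minor n k l) (Delta_minor n k' l') p =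
    \<i> / 2 * (of_nat (card ({n-k..<n-k+l} \<inter> {n-k'..<n-k'+l'})) - of_nat (min l l')) *
     (Delta_minor n k l p * Delta_minor n k' l' p)"
proof -
  have e: "(\<lambda>i j. fst p $$ (i,j)) = G" by (intro ext) (simp add: upper_entries_def)
  have "group_bracket n (Delta_minor n k l) (Delta_minor n k' l') p =
     Delta_minor n k l p * Delta_minor n k' l' p *
      (of_nat (card ({n-k..<n-k+l} \<inter> {n-k'..<n-k'+l'})) / 2 - of_nat (min l l') / 2)"
    using bracket_Delta_Delta[of n k l k' l' "fst p" "snd p"] assms
    by (simp add: Delta_nz e row_sum_triangular col_sum_triangular minor_nz)
  from half_difference_regroup[OF this] show ?thesis unfolding real_bracket_def .
qed

lemma Lambda_Lambda:
  assumes "l' \<le> k'" "k' \<le> k" "l \<le> k" "k \<le> n"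
  shows "real_bracket n (Lambda_minor n k l) (Lambda_minor n k' l') p =
    \<i> / 2 * (of_nat (card ({n-k'..<n-k'+l'} \<inter> {n-k..<n-k+l})) - of_nat (min l' l)) *
     (Lambda_minor n k l p * Lambda_minor n k' l' p)"
proof -
  have "group_bracket n (Lambda_minor n k l) (Lambda_minor n k' l') p =
     Lambda_minor n k l p * Lambda_minor n k' l' p *
      (of_nat (card ({n-k'..<n-k'+l'} \<inter> {n-k..<n-k+l})) / 2 - of_nat (min l' l) / 2)"
    using bracket_Lambda_Lambda[of "snd p" n "mat_adjoint (fst p)" k l k' l' "fst p"] assms real_formD[OF real_form]
    by (simp add: Lambda_nz K_def[abs_def, symmetric] row_sum_triangular col_sum_triangular minor_nz)
  from half_difference_regroup[OF this] show ?thesis unfolding real_bracket_def .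
qed

lemma Delta_Lambda:
  assumes "l \<le> k" "k \<le> n" "l' \<le> k'" "k' \<le> n"
  shows "real_bracket n (Delta_minor n k l) (Lambda_minor n k' l') p =
    \<i> / 2 * (of_nat (min l l') - of_nat (card ({n-k..<n-k+l} \<inter> {n-k'..<n-k'+l'}))) *
     (Delta_minor n k l p * Lambda_minor n k' l' p)
    + Delta_minor n k l p * Lambda_minor n k' l' p * \<i> *
     ((\<Sum>j\<in>{n - min l l'..<n}. \<Sum>t<n - max l l'. col_coeff n G (n-k) l j t * cnj (col_coeff n G (n-k') l' j t))
      - (\<Sum>i\<in>{n-k..<n-k+l} \<inter> {n-k'..<n-k'+l'}. \<Sum>s\<in>{max (n-k+l) (n-k'+l')..<n}.
          row_coeff n G (n-k) l s i * cnj (row_coeff n G (n-k') l' s i)))"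
proof -
  have e: "(\<lambda>i j. fst p $$ (i,j)) = G" by (intro ext) (simp add: upper_entries_def)
  let ?C = "\<Sum>j\<in>{n - min l l'..<n}. \<Sum>t<n - max l l'. col_coeff n G (n-k) l j t * cnj (col_coeff n G (n-k') l' j t)"
  let ?R = "\<Sum>i\<in>{n-k..<n-k+l} \<inter> {n-k'..<n-k'+l'}. \<Sum>s\<in>{max (n-k+l) (n-k'+l')..<n}.
          row_coeff n G (n-k) l s i * cnj (row_coeff n G (n-k') l' s i)"
  have R: "(\<Sum>i<n. \<Sum>s<n. ordering_weight i s * row_coeff n G (n-k) l s i * row_coeff n K (n-k') l' s i)
      = of_nat (card ({n-k..<n-k+l} \<inter> {n-k'..<n-k'+l'})) / 2 + ?R"
    using row_sum_parallel[of "n-k" l n "n-k'" l' G K] assms by (simp add: minor_nz K_corner_cnj)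
  have C: "(\<Sum>j<n. \<Sum>t<n. ordering_weight t j * col_coeff n G (n-k) l j t * col_coeff n K (n-k') l' j t)
      = of_nat (min l l') / 2 + ?C"
    using col_sum_parallel[of "n-k" l n "n-k'" l' G K] assms by (simp add: minor_nz K_corner_cnj)
  have "group_bracket n (Delta_minor n k l) (Lambda_minor n k' l') (fst p, snd p) =
     Delta_minor n k l (fst p, snd p) * Lambda_minor n k' l' (fst p, snd p) *
      (of_nat (min l l') / 2 + ?C - (of_nat (card ({n-k..<n-k+l} \<inter> {n-k'..<n-k'+l'})) / 2 + ?R))"
    by (subst bracket_Delta_Lambda[of "snd p" n "mat_adjoint (fst p)"])
      (use assms real_formD[OF real_form] in \<open>simp_all add: Delta_nz Lambda_nz e K_def[abs_def, symmetric] R C del: Int_atLeastLessThan\<close>)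
  then have "group_bracket n (Delta_minor n k l) (Lambda_minor n k' l') p =
     Delta_minor n k l p * Lambda_minor n k' l' p *
      (of_nat (min l l') / 2 + ?C - (of_nat (card ({n-k..<n-k+l} \<inter> {n-k'..<n-k'+l'})) / 2 + ?R))"
    by simp
  from half_difference_regroup'[OF this] show ?thesis unfolding real_bracket_def .
qed

end

section \<open>Prescribing the corner minors\<close>

lemma block_local:
  assumes "l \<le> n" "\<And>i j. r \<le> i \<Longrightarrow> i < r + l \<Longrightarrow> n - l \<le> j \<Longrightarrow> j < n \<Longrightarrow> G i j = G' i j"
  shows "block n G r l = block n G' r l" "corner_minor n G r l = corner_minor n G' r l"
proof -
  show "block n G r l = block n G' r l" using assms by (intro eq_matI) (auto simp: block_def)
  then show "corner_minor n G r l = corner_minor n G' r l" by (simp add: corner_minor_def)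
qed

text \<open>The corner minors of \<open>G\<close> are the given values \<open>y\<close> for all blocks that start below row \<open>r\<close>, and for those of size
at most \<open>l\<close> that start at row \<open>r\<close>.\<close>

definition realizes :: "nat \<Rightarrow> (nat \<Rightarrow> nat \<Rightarrow> complex) \<Rightarrow> nat \<Rightarrow> nat \<Rightarrow> (nat \<Rightarrow> nat \<Rightarrow> complex) \<Rightarrow> bool" where
  "realizes n y r l G \<longleftrightarrow> (\<forall>i j. j < i \<longrightarrow> G i j = 0) \<and>
     (\<forall>r' l'. r' + l' \<le> n \<longrightarrow> r < r' \<or> (r' = r \<and> l' \<le> l) \<longrightarrow> corner_minor n G r' l' = y r' l')"

text \<open>The entry \<open>(r, n - Suc l)\<close> does not occur in the blocks treated before, and the next corner minor is an affine
function of it whose slope is the nonzero minor one row below.\<close>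

lemma realizes_step:
  assumes y: "\<And>r l. r + l \<le> n \<Longrightarrow> y r l \<noteq> 0" and G: "realizes n y r l G" and rl: "r + Suc l \<le> n"
  shows "\<exists>G'. realizes n y r (Suc l) G'"
proof -
  define c where "c = corner_minor n G (Suc r) l"
  have c: "c \<noteq> 0" using G y[of "Suc r" l] rl unfolding c_def realizes_def by auto
  (* solves the affine equation given by corner_minor_Suc_column *)
  define v where "v = y r (Suc l) / c + (\<Sum>j\<in>{n-l..<n}. G r j * col_coeff n G (Suc r) l j (n - Suc l))"
  define G' where "G' = (\<lambda>i j. if i = r \<and> j = n - Suc l then v else G i j)"
  have same: "block n G' r' l' = block n G r' l'" "corner_minor n G' r' l' = corner_minor n G r' l'"
    if "r' + l' \<le> n" "r < r' \<or> (r' = r \<and> l' \<le> l)" for r' l'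
  proof -
    have "G' i j = G i j" if "r' \<le> i" "n - l' \<le> j" for i j
      using that \<open>r < r' \<or> (r' = r \<and> l' \<le> l)\<close> rl by (auto simp: G'_def)
    then show "block n G' r' l' = block n G r' l'" "corner_minor n G' r' l' = corner_minor n G r' l'"
      using block_local[of l' n r' G' G] \<open>r' + l' \<le> n\<close> by auto
  qed
  have x: "col_coeff n G' (Suc r) l j t = col_coeff n G (Suc r) l j t" for j t
    unfolding col_coeff_def using rl same[of "Suc r" l]
    by (intro sum.cong refl) (auto simp: dual_block_def G'_def)
  have c': "corner_minor n G' (Suc r) l = c" using same[of "Suc r" l] rl by (simp add: c_def)
  have "corner_minor n G' r (Suc l) = (G' r (n - Suc l) - (\<Sum>j\<in>{n-l..<n}. G' r j * col_coeff n G' (Suc r) l j (n - Suc l))) * c"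
    using corner_minor_Suc_column[OF rl, of G'] c c' by simp
  also have "(\<Sum>j\<in>{n-l..<n}. G' r j * col_coeff n G' (Suc r) l j (n - Suc l)) = (\<Sum>j\<in>{n-l..<n}. G r j * col_coeff n G (Suc r) l j (n - Suc l))"
    unfolding x using rl by (intro sum.cong refl) (auto simp: G'_def)
  also have "G' r (n - Suc l) = v" by (simp add: G'_def)
  finally have new: "corner_minor n G' r (Suc l) = y r (Suc l)" using c by (simp add: v_def)
  have "realizes n y r (Suc l) G'"
    unfolding realizes_def
  proof (intro conjI allI impI)
    fix i j :: nat assume "j < i" then show "G' i j = 0" using G rl by (auto simp: G'_def realizes_def)
  next
    fix r' l' assume "r' + l' \<le> n" "r < r' \<or> (r' = r \<and> l' \<le> Suc l)"
    then show "corner_minor n G' r' l' = y r' l'"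
      using same[of r' l'] G new by (cases "r' = r \<and> l' = Suc l") (auto simp: realizes_def)
  qed
  then show ?thesis by blast
qed

lemma realizes_exists:
  assumes y: "\<And>r l. r + l \<le> n \<Longrightarrow> y r l \<noteq> 0" and y0: "\<And>r. y r 0 = 1"
  shows "\<exists>G. (\<forall>i j. j < i \<longrightarrow> G i j = 0) \<and> (\<forall>r l. r + l \<le> n \<longrightarrow> corner_minor n G r l = y r l)"
proof -
  have row: "\<exists>G. realizes n y r l G" if "\<exists>G. realizes n y r 0 G" "r + l \<le> n" for r l
    using that(2) by (induction l) (use that(1) realizes_step[of n y, OF y] in auto)
  have "\<exists>G. realizes n y (n - d) 0 G" if "d \<le> n" for d
    using that
  proof (induction d)
    case 0
    have "realizes n y n 0 (\<lambda>i j. 0)" unfolding realizes_def using y0 by auto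
    then show ?case by auto
  next
    case (Suc d)
    then obtain G where G: "realizes n y (n - d) d G" using row[of "n - d" d] by auto
    have "realizes n y (n - Suc d) 0 G"
      unfolding realizes_def
    proof (intro conjI allI impI)
      fix i j :: nat assume "j < i" then show "G i j = 0" using G by (auto simp: realizes_def)
    next
      fix r' l' assume a: "r' + l' \<le> n" "n - Suc d < r' \<or> (r' = n - Suc d \<and> l' \<le> 0)"
      show "corner_minor n G r' l' = y r' l'"
      proof (cases "l' = 0")
        case False
        then have "n - d < r' \<or> (r' = n - d \<and> l' \<le> d)" using a Suc.prems by auto
        then show ?thesis using G a by (auto simp: realizes_def)
      qed (simp add: y0)
    qed
    then show ?case by blast
  qed
  from this[of n] obtain G0 where "realizes n y 0 0 G0" by auto
  then obtain G where G: "realizes n y 0 n G" using row[of 0 n] by auto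
  have "corner_minor n G r l = y r l" if "r + l \<le> n" for r l
  proof -
    have "0 < r \<or> (r = 0 \<and> l \<le> n)" using that by auto
    then show ?thesis using G that unfolding realizes_def by blast
  qed
  then show ?thesis using G by (auto simp: realizes_def)
qed

lemma upper_triangular_inverse:
  fixes g M :: "complex mat"
  assumes g: "g \<in> carrier_mat n n" and M: "M \<in> carrier_mat n n" and Mg: "M * g = 1\<^sub>m n"
    and ut: "\<And>i j. j < i \<Longrightarrow> i < n \<Longrightarrow> g $$ (i,j) = 0" and nz: "\<And>i. i < n \<Longrightarrow> g $$ (i,i) \<noteq> 0"
  shows "j < i \<Longrightarrow> i < n \<Longrightarrow> M $$ (i,j) = 0"
proof (induction j rule: less_induct)
  case (less j)
  have "0 = (M * g) $$ (i,j)" using less.prems by (simp add: Mg)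
  also have "\<dots> = (\<Sum>k<n. M $$ (i,k) * g $$ (k,j))"
    using less.prems M g by (auto simp: times_mat_def scalar_prod_def atLeast0LessThan)
  also have "\<dots> = M $$ (i,j) * g $$ (j,j)"
  proof (intro sum_single)
    fix k assume "k < n" "k \<noteq> j"
    then show "M $$ (i,k) * g $$ (k,j) = 0" using less ut[of j k] by (cases "k < j") auto
  qed (use less.prems in auto)
  finally show ?case using nz[of j] less.prems by simp
qed

text \<open>An upper triangular matrix with the prescribed corner minors exists, filling in the entries row by row from
the bottom and from right to left. Its diagonal entries are quotients of consecutive full corner minors, hence
positive, and the adjoint of its inverse completes it to a point of the real form.\<close>

lemma chart_surjective:
  fixes x :: "nat \<Rightarrow> nat \<Rightarrow> complex"
  assumes diag: "\<And>k. 1 \<le> k \<Longrightarrow> k \<le> n \<Longrightarrow> x k k \<in> \<real> \<and> 0 < Re (x k k)"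
    and nz: "\<And>k l. 1 \<le> l \<Longrightarrow> l < k \<Longrightarrow> k \<le> n \<Longrightarrow> x k l \<noteq> 0"
  shows "\<exists>p\<in>chart n. \<forall>k l. 1 \<le> l \<longrightarrow> l \<le> k \<longrightarrow> k \<le> n \<longrightarrow> Delta_minor n k l p = x k l"
proof -
  define y where "y r l = (if l = 0 then 1 else x (n - r) l)" for r l
  have ynz: "y r l \<noteq> 0" if "r + l \<le> n" for r l
  proof (cases "l = 0 \<or> l < n - r")
    case True
    then show ?thesis using nz[of l "n - r"] unfolding y_def by auto
  next
    case False
    then have "l = n - r" "1 \<le> n - r" using that by auto
    then show ?thesis using diag[of "n - r"] unfolding y_def by auto
  qed
  obtain G where G0: "\<And>i j. j < i \<Longrightarrow> G i j = 0" and Gy: "\<And>r l. r + l \<le> n \<Longrightarrow> corner_minor n G r l = y r l"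
    using realizes_exists[of n y] ynz unfolding y_def by auto
  have ydiag: "y r (n - r) \<in> \<real>" "0 < Re (y r (n - r))" if "r \<le> n" for r
    using diag[of "n - r"] that by (auto simp: y_def)
  have Gd: "G r r \<in> \<real> \<and> 0 < Re (G r r)" if r: "r < n" for r
  proof -
    let ?l = "n - Suc r"
    have "corner_minor n G r (Suc ?l) = (G r (n - Suc ?l) - (\<Sum>j\<in>{n - ?l..<n}. G r j * col_coeff n G (Suc r) ?l j (n - Suc ?l))) * corner_minor n G (Suc r) ?l"
      using r Gy ynz by (intro corner_minor_Suc_column) auto
    moreover have "col_coeff n G (Suc r) ?l j (n - Suc ?l) = 0" for j
      using r G0 by (intro col_coeff_full_height) auto
    moreover have "n - Suc ?l = r" "Suc ?l = n - r" using r by auto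
    ultimately have eq: "y r (n - r) = G r r * y (Suc r) (n - Suc r)" using Gy r by simp
    have y2: "y (Suc r) (n - Suc r) \<in> \<real>" "0 < Re (y (Suc r) (n - Suc r))" using ydiag[of "Suc r"] r by auto
    have y1: "y r (n - r) \<in> \<real>" "0 < Re (y r (n - r))" using ydiag[of r] r by auto
    have "G r r = y r (n - r) / y (Suc r) (n - Suc r)" using eq y2 by (auto simp: field_simps)
    moreover obtain a b where ab: "y r (n - r) = of_real a" "y (Suc r) (n - Suc r) = of_real b"
      using y1(1) y2(1) by (auto elim!: Reals_cases)
    ultimately have "G r r = of_real (a / b)" by simp
    moreover have "a / b > 0" using y1 y2 ab by simp
    ultimately show ?thesis by simp
  qed
  define g where "g = mat n n (\<lambda>(i,j). G i j)"
  have g: "g \<in> carrier_mat n n" by (simp add: g_def)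
  have ge: "g $$ (i,j) = G i j" if "i < n" "j < n" for i j using that by (simp add: g_def)
  have "block n G 0 n = g" by (intro eq_matI) (auto simp: block_def g_def)
  then have "Determinant.det g = y 0 n" using Gy[of 0 n] by (simp add: corner_minor_def)
  then have det: "Determinant.det g \<noteq> 0" using ynz[of 0 n] by simp
  (* the inverse of g *)
  define M where "M = (1 / Determinant.det g) \<cdot>\<^sub>m adj_mat g"
  have M: "M \<in> carrier_mat n n" using adj_mat(1)[OF g] by (simp add: M_def)
  have gM: "g * M = 1\<^sub>m n"
    unfolding M_def using adj_mat[OF g] g det by (subst mult_smult_distrib[of _ n n _ n]) (auto intro!: eq_matI)
  have Mg: "M * g = 1\<^sub>m n" using mat_mult_left_right_inverse[OF g M gM] .
  have Gnz: "G i i \<noteq> 0" if "i < n" for i using Gd[OF that] by auto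
  have M0: "M $$ (i,j) = 0" if "j < i" "i < n" for i j
    using upper_triangular_inverse[OF g M Mg _ _ that] G0 Gnz ge by auto
  define f where "f = mat_adjoint M"
  have f: "f \<in> carrier_mat n n" using M by (simp add: f_def)
  have fe: "f $$ (i,j) = cnj (M $$ (j,i))" if "i < n" "j < n" for i j using M that by (simp add: f_def mat_adjoint_entry)
  have adj_f: "mat_adjoint f = M" using M f by (intro eq_matI) (auto simp: mat_adjoint_entry fe mat_adjoint_carrier[THEN carrier_matD(1)] mat_adjoint_carrier[THEN carrier_matD(2)])
  have inv_g: "mat_inv g = M" using mat_inv_eqI[OF g M gM] .
  have invg: "invertible_mat g" unfolding invertible_mat_def inverts_mat_def using g M gM Mg by auto
  have gd: "g $$ (i,i) * M $$ (i,i) = 1" if i: "i < n" for i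
  proof -
    have "1 = (g * M) $$ (i,i)" using i by (simp add: gM)
    also have "\<dots> = (\<Sum>k<n. g $$ (i,k) * M $$ (k,i))"
      using i M g by (auto simp: times_mat_def scalar_prod_def atLeast0LessThan)
    also have "\<dots> = g $$ (i,i) * M $$ (i,i)"
    proof (intro sum_single)
      fix k assume "k < n" "k \<noteq> i"
      then show "g $$ (i,k) * M $$ (k,i) = 0" using M0[of i k] G0[of k i] i by (cases "k < i") (auto simp: ge)
    qed (use i in auto)
    finally show ?thesis by simp
  qed
  have gf: "g $$ (i,i) * f $$ (i,i) = 1" if i: "i < n" for i
  proof -
    have "cnj (G i i) = G i i" using Gd[OF i] by (simp add: Reals_cnj_iff)
    then have "g $$ (i,i) * f $$ (i,i) = cnj (g $$ (i,i) * M $$ (i,i))" using i by (simp add: fe ge)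
    then show ?thesis using gd[OF i] by simp
  qed
  have invf: "invertible_mat f"
  proof -
    have "f * mat_adjoint g = 1\<^sub>m n"
    proof (rule eq_matI)
      fix i j assume ij: "i < dim_row (1\<^sub>m n :: complex mat)" "j < dim_col (1\<^sub>m n :: complex mat)"
      have "(f * mat_adjoint g) $$ (i,j) = (\<Sum>k<n. f $$ (i,k) * cnj (g $$ (j,k)))"
        using ij f g by (auto simp: times_mat_def scalar_prod_def atLeast0LessThan mat_adjoint_entry
          mat_adjoint_carrier[THEN carrier_matD(1)] mat_adjoint_carrier[THEN carrier_matD(2)] intro!: sum.cong)
      also have "\<dots> = cnj (\<Sum>k<n. g $$ (j,k) * M $$ (k,i))"
        using ij by (simp add: fe mult.commute)
      also have "(\<Sum>k<n. g $$ (j,k) * M $$ (k,i)) = (g * M) $$ (j,i)"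
        using ij M g by (auto simp: times_mat_def scalar_prod_def atLeast0LessThan)
      finally show "(f * mat_adjoint g) $$ (i,j) = 1\<^sub>m n $$ (i,j)" using gM ij by auto
    qed (use f g in \<open>auto simp: mat_adjoint_carrier[THEN carrier_matD(2)]\<close>)
    moreover from this have "mat_adjoint g * f = 1\<^sub>m n"
      using mat_mult_left_right_inverse[OF f mat_adjoint_carrier[OF g]] by simp
    ultimately show ?thesis unfolding invertible_mat_def inverts_mat_def
      using f mat_adjoint_carrier[OF g, THEN carrier_matD(1)] by (auto intro!: exI[of _ "mat_adjoint g"])
  qed
  have rf: "(g, f) \<in> real_form n"
    unfolding real_form_def G_star_def B_plus_def B_minus_def
    using g f invg invf gf adj_f inv_g M0 G0 by (auto simp: ge fe upper_triangular_def)
  have D: "Delta_minor n k l (g, f) = x k l" if "1 \<le> l" "l \<le> k" "k \<le> n" for k l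
  proof -
    have "Delta_minor n k l (g, f) = corner_minor n G (n - k) l"
      unfolding Delta_minor_corner using that ge by (intro corner_minor_cong(1)) auto
    also have "\<dots> = x k l" using Gy[of "n - k" l] that by (simp add: y_def)
    finally show ?thesis .
  qed
  have "(g, f) \<in> chart n" unfolding chart_def using rf D diag nz by auto
  then show ?thesis using D by blast
qed

section \<open>Laurent expansions on the chart\<close>

lemma finite_coords [simp]: "finite (coords n)"
proof -
  have "coords n \<subseteq> (\<lambda>(k,l). Dl k l) ` ({..n} \<times> {..n}) \<union> (\<lambda>(k,l). Dlbar k l) ` ({..n} \<times> {..n})"
    by (auto simp: coords_def image_iff)
  then show ?thesis by (rule finite_subset) auto
qed

text \<open>The minors with equal indices are real on the chart, so conjugation fixes them.\<close>

fun conj_coord :: "coord \<Rightarrow> coord" where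
  "conj_coord (Dl k l) = (if k = l then Dl k l else Dlbar k l)"
| "conj_coord (Dlbar k l) = Dl k l"

lemma conj_coord_coords: "w \<in> coords n \<Longrightarrow> conj_coord w \<in> coords n \<and> conj_coord (conj_coord w) = w"
  by (cases w) (auto simp: coords_def)

lemma conj_coord_index [simp]: "coord_index (conj_coord w) = coord_index w"
  by (cases w) auto

lemma coord_fun_conj:
  assumes "p \<in> chart n" "w \<in> coords n"
  shows "coord_fun n (conj_coord w) p = cnj (coord_fun n w p)"
proof -
  interpret chart_point n p by standard fact
  show ?thesis
  proof (cases w)
    case (Dl k l)
    then have kl: "1 \<le> l" "l \<le> k" "k \<le> n" using assms(2) by (auto simp: coords_def)
    show ?thesis
    proof (cases "k = l")
      case True
      then have "k \<in> {1..n}" using kl by auto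
      then have "Delta_minor n k k p \<in> \<real>" using assms(1) unfolding chart_def by blast
      then show ?thesis using Dl True by (simp add: Reals_cnj_iff)
    qed (use Dl kl Lambda_cnj in simp)
  next
    case (Dlbar k l)
    then have "l \<le> k" "k \<le> n" using assms(2) by (auto simp: coords_def)
    then show ?thesis using Dlbar Lambda_cnj[of l k] by simp
  qed
qed

lemma coord_fun_nz:
  assumes "p \<in> chart n" "w \<in> coords n"
  shows "coord_fun n w p \<noteq> 0"
proof -
  interpret chart_point n p by standard fact
  show ?thesis using assms(2) Delta_nz Lambda_nz by (cases w) (auto simp: coords_def)
qed

definition monomial :: "nat \<Rightarrow> (coord \<Rightarrow> int) \<Rightarrow> (coord \<Rightarrow> complex) \<Rightarrow> complex" where
  "monomial n e x = (\<Prod>w\<in>coords n. x w powi e w)"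

text \<open>The linear functional of the monomial with exponents \<open>e\<close>. It ignores the difference between a coordinate
and its conjugate.\<close>

definition weight :: "nat \<Rightarrow> (coord \<Rightarrow> int) \<Rightarrow> (idx \<Rightarrow> real) \<Rightarrow> real" where
  "weight n e \<zeta> = (\<Sum>w\<in>coords n. of_int (e w) * \<zeta> (coord_index w))"

abbreviation point_coords :: "nat \<Rightarrow> complex mat \<times> complex mat \<Rightarrow> coord \<Rightarrow> complex" where
  "point_coords n p \<equiv> (\<lambda>w. coord_fun n w p)"

text \<open>On the chart \<open>F\<close> is a combination of Laurent monomials whose functionals satisfy \<open>Q\<close>. Working with the
functionals instead of the monomials makes the notion stable under conjugation, and linear conditions on them
are easily followed through sums and products. Exponents are plain functions here and become finitely
supported ones only in \<open>laurent_of_weights\<close>.\<close>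

definition laurent_weights ::
  "nat \<Rightarrow> (((idx \<Rightarrow> real) \<Rightarrow> real) \<Rightarrow> bool) \<Rightarrow> (complex mat \<times> complex mat \<Rightarrow> complex) \<Rightarrow> bool" where
  "laurent_weights n Q F \<longleftrightarrow> (\<exists>xs :: (complex \<times> (coord \<Rightarrow> int)) list.
     (\<forall>(c, e)\<in>set xs. Q (weight n e)) \<and>
     (\<forall>p\<in>chart n. F p = (\<Sum>(c, e)\<leftarrow>xs. c * monomial n e (point_coords n p))))"

lemma laurent_weightsI:
  assumes "\<And>c e. (c, e) \<in> set xs \<Longrightarrow> Q (weight n e)"
    and "\<And>p. p \<in> chart n \<Longrightarrow> F p = (\<Sum>(c, e)\<leftarrow>xs. c * monomial n e (point_coords n p))"
  shows "laurent_weights n Q F"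
  using assms unfolding laurent_weights_def by (intro exI[of _ xs]) auto

lemma laurent_weights_mono:
  assumes "laurent_weights n Q F" "\<And>a. Q a \<Longrightarrow> Q' a" "\<And>p. p \<in> chart n \<Longrightarrow> F p = F' p"
  shows "laurent_weights n Q' F'"
proof -
  obtain xs where xs: "\<forall>(c, e)\<in>set xs. Q (weight n e)"
    "\<forall>p\<in>chart n. F p = (\<Sum>(c, e)\<leftarrow>xs. c * monomial n e (point_coords n p))"
    using assms(1) unfolding laurent_weights_def by blast
  show ?thesis by (rule laurent_weightsI[of xs]) (use xs assms(2,3) in auto)
qed

lemma laurent_weights_0 [simp]: "laurent_weights n Q (\<lambda>p. 0)"
  by (rule laurent_weightsI[of "[]"]) auto

lemma laurent_weights_monomial: "laurent_weights n ((=) (weight n e)) (\<lambda>p. c * monomial n e (point_coords n p))"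
  by (rule laurent_weightsI[of "[(c, e)]"]) auto

lemma laurent_weights_add:
  assumes "laurent_weights n Q F" "laurent_weights n Q H"
  shows "laurent_weights n Q (\<lambda>p. F p + H p)"
proof -
  obtain xs ys where "\<forall>(c, e)\<in>set xs. Q (weight n e)" "\<forall>(c, e)\<in>set ys. Q (weight n e)"
    "\<forall>p\<in>chart n. F p = (\<Sum>(c, e)\<leftarrow>xs. c * monomial n e (point_coords n p))"
    "\<forall>p\<in>chart n. H p = (\<Sum>(c, e)\<leftarrow>ys. c * monomial n e (point_coords n p))"
    using assms unfolding laurent_weights_def by blast
  then show ?thesis by (intro laurent_weightsI[of "xs @ ys"]) auto
qed

lemma laurent_weights_sum:
  assumes "\<And>i. i \<in> I \<Longrightarrow> laurent_weights n Q (F i)"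
  shows "laurent_weights n Q (\<lambda>p. \<Sum>i\<in>I. F i p)"
proof (cases "finite I")
  case True
  then show ?thesis using assms by (induction I) (auto intro: laurent_weights_add)
qed simp

lemma monomial_mult:
  assumes "p \<in> chart n"
  shows "monomial n (\<lambda>w. e w + e' w) (point_coords n p) = monomial n e (point_coords n p) * monomial n e' (point_coords n p)"
  unfolding monomial_def prod.distrib[symmetric]
  by (intro prod.cong refl power_int_add) (use coord_fun_nz[OF assms] in auto)

lemma weight_add: "weight n (\<lambda>w. e w + e' w) = (\<lambda>\<zeta>. weight n e \<zeta> + weight n e' \<zeta>)"
  by (auto simp: weight_def sum.distrib algebra_simps)

lemma laurent_weights_mult_monomial:
  assumes "laurent_weights n Q F" "\<And>a. Q a \<Longrightarrow> Q' (\<lambda>\<zeta>. a \<zeta> + weight n e' \<zeta>)"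
  shows "laurent_weights n Q' (\<lambda>p. F p * (c' * monomial n e' (point_coords n p)))"
proof -
  obtain xs where xs: "\<forall>(c, e)\<in>set xs. Q (weight n e)"
    "\<forall>p\<in>chart n. F p = (\<Sum>(c, e)\<leftarrow>xs. c * monomial n e (point_coords n p))"
    using assms unfolding laurent_weights_def by blast
  have eq: "(\<Sum>(c, e)\<leftarrow>xs. c * monomial n e (point_coords n p)) * (c' * monomial n e' (point_coords n p))
      = (\<Sum>(c, e)\<leftarrow>map (\<lambda>(c, e). (c * c', \<lambda>w. e w + e' w)) xs. c * monomial n e (point_coords n p))"
    if "p \<in> chart n" for p
    by (induction xs) (auto simp: monomial_mult[OF that] algebra_simps)
  show ?thesis
    by (rule laurent_weightsI[of "map (\<lambda>(c, e). (c * c', \<lambda>w. e w + e' w)) xs"])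
       (use xs assms(2) eq in \<open>auto simp: weight_add\<close>)
qed

lemma laurent_weights_mult:
  assumes F: "laurent_weights n Q F" and H: "laurent_weights n Q' H"
    and QQ: "\<And>a b. Q a \<Longrightarrow> Q' b \<Longrightarrow> Q'' (\<lambda>\<zeta>. a \<zeta> + b \<zeta>)"
  shows "laurent_weights n Q'' (\<lambda>p. F p * H p)"
proof -
  obtain ys where ys: "\<forall>(c, e)\<in>set ys. Q' (weight n e)"
    "\<forall>p\<in>chart n. H p = (\<Sum>(c, e)\<leftarrow>ys. c * monomial n e (point_coords n p))"
    using H unfolding laurent_weights_def by blast
  have "laurent_weights n Q'' (\<lambda>p. F p * (\<Sum>(c, e)\<leftarrow>ys. c * monomial n e (point_coords n p)))"
    using ys(1)
  proof (induction ys)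
    case (Cons y ys)
    obtain c e where y: "y = (c, e)" by force
    have "laurent_weights n Q'' (\<lambda>p. F p * (c * monomial n e (point_coords n p)))"
      using laurent_weights_mult_monomial[OF F] QQ Cons.prems y by auto
    from laurent_weights_add[OF this Cons.IH] Cons.prems show ?case by (simp add: y distrib_left)
  qed simp
  then show ?thesis by (rule laurent_weights_mono) (use ys in auto)
qed

lemma laurent_weights_cmult:
  assumes "laurent_weights n Q F"
  shows "laurent_weights n Q (\<lambda>p. c * F p)"
proof -
  have w: "weight n (\<lambda>w. 0) = (\<lambda>\<zeta>. 0)" by (auto simp: weight_def)
  have "laurent_weights n Q (\<lambda>p. F p * (c * monomial n (\<lambda>w. 0) (point_coords n p)))"
    by (rule laurent_weights_mult_monomial[OF assms]) (simp add: w)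
  then show ?thesis by (rule laurent_weights_mono) (auto simp: monomial_def)
qed

lemma laurent_weights_uminus: "laurent_weights n Q F \<Longrightarrow> laurent_weights n Q (\<lambda>p. - F p)"
  using laurent_weights_cmult[of n Q F "-1"] by simp

lemma laurent_weights_diff:
  "laurent_weights n Q F \<Longrightarrow> laurent_weights n Q H \<Longrightarrow> laurent_weights n Q (\<lambda>p. F p - H p)"
  using laurent_weights_add[of n Q F "\<lambda>p. - H p"] laurent_weights_uminus by auto

lemma laurent_weights_cnj:
  assumes "laurent_weights n Q F"
  shows "laurent_weights n Q (\<lambda>p. cnj (F p))"
proof -
  obtain xs where xs: "\<forall>(c, e)\<in>set xs. Q (weight n e)"
    "\<forall>p\<in>chart n. F p = (\<Sum>(c, e)\<leftarrow>xs. c * monomial n e (point_coords n p))"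
    using assms unfolding laurent_weights_def by blast
  have m: "cnj (monomial n e (point_coords n p)) = monomial n (\<lambda>w. e (conj_coord w)) (point_coords n p)" if "p \<in> chart n" for e p
  proof -
    have "cnj (monomial n e (point_coords n p)) = (\<Prod>w\<in>coords n. coord_fun n (conj_coord w) p powi e w)"
      unfolding monomial_def cnj_prod by (intro prod.cong refl) (simp add: coord_fun_conj that)
    also have "\<dots> = monomial n (\<lambda>w. e (conj_coord w)) (point_coords n p)"
      unfolding monomial_def
      by (rule prod.reindex_bij_witness[of _ conj_coord conj_coord]) (auto simp: conj_coord_coords)
    finally show ?thesis .
  qed
  have w: "weight n (\<lambda>w. e (conj_coord w)) = weight n e" for e
    unfolding weight_def
    by (intro ext, rule sum.reindex_bij_witness[of _ conj_coord conj_coord]) (auto simp: conj_coord_coords)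
  have eq: "cnj (\<Sum>(c, e)\<leftarrow>xs. c * monomial n e (point_coords n p))
      = (\<Sum>(c, e)\<leftarrow>map (\<lambda>(c, e). (cnj c, \<lambda>w. e (conj_coord w))) xs. c * monomial n e (point_coords n p))"
    if "p \<in> chart n" for p
    by (induction xs) (auto simp: m[OF that])
  show ?thesis
    by (rule laurent_weightsI[of "map (\<lambda>(c, e). (cnj c, \<lambda>w. e (conj_coord w))) xs"]) (use xs eq w in auto)
qed

text \<open>Empty minors are \<open>1\<close>, so the missing coordinates with lower index \<open>0\<close> have tropical value \<open>0\<close>.\<close>

definition pad :: "(idx \<Rightarrow> real) \<Rightarrow> nat \<Rightarrow> nat \<Rightarrow> real" where
  "pad \<zeta> k l = (if l = 0 then 0 else \<zeta> (k, l))"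

lemma laurent_weights_minor_power:
  assumes "r + l \<le> n"
  shows "laurent_weights n ((=) (\<lambda>\<zeta>. of_int i * pad \<zeta> (n - r) l)) (\<lambda>p. corner_minor n (upper_entries p) r l powi i)"
proof (cases "l = 0")
  case True
  have "weight n (\<lambda>w. 0) = (\<lambda>\<zeta>. of_int i * pad \<zeta> (n - r) l)" using True by (auto simp: weight_def pad_def)
  with laurent_weights_monomial[of n "\<lambda>w. 0" 1] show ?thesis
    by (elim laurent_weights_mono) (auto simp: monomial_def True)
next
  case False
  let ?w = "Dl (n - r) l" and ?e = "\<lambda>w. if w = Dl (n - r) l then i else 0"
  have w: "?w \<in> coords n" using assms False by (auto simp: coords_def)
  have "weight n ?e \<zeta> = of_int i * pad \<zeta> (n - r) l" for \<zeta>
  proof -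
    have "weight n ?e \<zeta> = (\<Sum>w\<in>coords n. if w = ?w then of_int i * \<zeta> (n - r, l) else 0)"
      unfolding weight_def by (intro sum.cong) auto
    then show ?thesis using w False by (simp add: pad_def)
  qed
  then have eq: "weight n ?e = (\<lambda>\<zeta>. of_int i * pad \<zeta> (n - r) l)" by auto
  have "monomial n ?e (point_coords n p) = corner_minor n (upper_entries p) r l powi i" for p
  proof -
    have "monomial n ?e (point_coords n p) = (\<Prod>w\<in>coords n. if w = ?w then coord_fun n ?w p powi i else 1)"
      unfolding monomial_def by (intro prod.cong) auto
    also have "\<dots> = Delta_minor n (n - r) l p powi i" using w by simp
    finally show ?thesis using assms by (simp add: Delta_minor_upper_entries)
  qed
  with laurent_weights_monomial[of n ?e 1] show ?thesis by (simp add: eq)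
qed

section \<open>Uniqueness of Laurent expansions\<close>

text \<open>Dedekind's argument: multiply a relation by one of the characters, evaluated at a point that separates it from
another one, and subtract the relation evaluated at the product; this eliminates one character.\<close>

lemma characters_independent:
  fixes ch :: "'i \<Rightarrow> 'x \<Rightarrow> complex"
  assumes "finite S"
    and mult: "\<And>x y. x \<in> X \<Longrightarrow> y \<in> X \<Longrightarrow> m x y \<in> X"
    and hom: "\<And>i x y. i \<in> S \<Longrightarrow> x \<in> X \<Longrightarrow> y \<in> X \<Longrightarrow> ch i (m x y) = ch i x * ch i y"
    and one: "u \<in> X" "\<And>i. i \<in> S \<Longrightarrow> ch i u = 1"
    and sep: "\<And>i j. i \<in> S \<Longrightarrow> j \<in> S \<Longrightarrow> i \<noteq> j \<Longrightarrow> \<exists>x\<in>X. ch i x \<noteq> ch j x"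
    and zero: "\<And>x. x \<in> X \<Longrightarrow> (\<Sum>i\<in>S. c i * ch i x) = 0"
  shows "\<forall>i\<in>S. c i = 0"
  using assms(1) hom one(2) sep zero
proof (induction S arbitrary: c rule: finite_induct)
  case (insert k S)
  have c: "c i = 0" if i: "i \<in> S" for i
  proof -
    obtain y where y: "y \<in> X" "ch i y \<noteq> ch k y" using insert.prems(3)[of i k] i insert.hyps by auto
    have "\<forall>i\<in>S. c i * (ch i y - ch k y) = 0"
    proof (rule insert.IH)
      fix x assume x: "x \<in> X"
      have "(\<Sum>i\<in>insert k S. c i * ch i (m x y)) = 0" using insert.prems(4) mult x y by blast
      then have 1: "(\<Sum>i\<in>insert k S. c i * (ch i x * ch i y)) = 0"
        using insert.prems(1) x y by simp
      have 2: "ch k y * (\<Sum>i\<in>insert k S. c i * ch i x) = 0" using insert.prems(4)[OF x] by simp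
      have "(\<Sum>i\<in>insert k S. c i * (ch i y - ch k y) * ch i x)
          = (\<Sum>i\<in>insert k S. c i * (ch i x * ch i y)) - ch k y * (\<Sum>i\<in>insert k S. c i * ch i x)"
        by (simp add: sum_distrib_left sum_subtractf[symmetric] algebra_simps del: sum.insert)
      then show "(\<Sum>i\<in>S. c i * (ch i y - ch k y) * ch i x) = 0"
        using 1 2 insert.hyps by simp
    qed (use insert.prems in auto)
    then show ?thesis using i y by auto
  qed
  moreover have "c k = 0" using insert.prems(4)[OF one(1)] insert.prems(2) insert.hyps c by simp
  ultimately show ?case by auto
qed simp

text \<open>The values which the coordinate functions can take on the chart. They form a group under pointwise
multiplication, on which the Laurent monomials are characters.\<close>

definition admissible :: "(coord \<Rightarrow> complex) \<Rightarrow> bool" where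
  "admissible x \<longleftrightarrow> (\<forall>k. x (Dl k k) \<in> \<real> \<and> 0 < Re (x (Dl k k))) \<and>
     (\<forall>k l. x (Dl k l) \<noteq> 0 \<and> x (Dlbar k l) = cnj (x (Dl k l)))"

lemma admissible_on_chart:
  assumes x: "admissible x"
  shows "\<exists>p\<in>chart n. \<forall>w\<in>coords n. coord_fun n w p = x w"
proof -
  obtain p where p: "p \<in> chart n"
    and D: "\<And>k l. 1 \<le> l \<Longrightarrow> l \<le> k \<Longrightarrow> k \<le> n \<Longrightarrow> Delta_minor n k l p = x (Dl k l)"
    using chart_surjective[of n "\<lambda>k l. x (Dl k l)"] x unfolding admissible_def by blast
  interpret chart_point n p by standard fact
  have "coord_fun n w p = x w" if "w \<in> coords n" for w
    using that D Lambda_cnj x by (cases w) (auto simp: coords_def admissible_def)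
  then show ?thesis using p by blast
qed

lemma admissible_mult: "admissible x \<Longrightarrow> admissible y \<Longrightarrow> admissible (\<lambda>w. x w * y w)"
  unfolding admissible_def by (auto simp: complex_is_Real_iff)

lemma chart_nonempty: "chart n \<noteq> {}"
  using admissible_on_chart[of "\<lambda>w. 1" n] by (auto simp: admissible_def)

lemma powi_2_inj: "(2::complex) powi a = 2 powi b \<longleftrightarrow> a = b"
proof
  assume "(2::complex) powi a = 2 powi b"
  then have "norm ((2::complex) powi a) = norm ((2::complex) powi b)" by simp
  then have "(2::real) powi a = 2 powi b" by (simp add: norm_power_int)
  then show "a = b" by (metis less_irrefl linorder_neqE power_int_strict_increasing one_less_numeral_iff semiring_norm(76))
qed simp

text \<open>If the exponents differ at a coordinate, vary only this coordinate and its conjugate. The point \<open>2\<close> detects the sum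
of the two exponents, and a suitable point of the unit circle detects their difference.\<close>

lemma monomial_separation:
  assumes w: "w \<in> coords n" and ne: "e w \<noteq> e' w"
  shows "\<exists>x. admissible x \<and> monomial n e x \<noteq> monomial n e' x"
proof -
  obtain k l where kl: "coord_index w = (k, l)" by force
  then have lk: "1 \<le> l" "l \<le> k" "k \<le> n" and w': "w = Dl k l \<or> (l < k \<and> w = Dlbar k l)"
    using w by (auto simp: coords_def)
  define X where "X z = (\<lambda>v. if v = Dl k l then z else if v = Dlbar k l then cnj z else 1)" for z :: complex
  show ?thesis
  proof (cases "k = l")
    case True
    have m: "monomial n f (X 2) = 2 powi f w" for f
    proof -
      have "monomial n f (X 2) = (\<Prod>v\<in>coords n. if v = w then 2 powi f w else 1)"
        unfolding monomial_def using True w' by (intro prod.cong refl) (auto simp: X_def coords_def)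
      then show ?thesis using w by simp
    qed
    have "admissible (X 2)" by (auto simp: admissible_def X_def)
    then show ?thesis using m ne powi_2_inj by metis
  next
    case False
    have m: "monomial n f (X z) = z powi f (Dl k l) * cnj z powi f (Dlbar k l)" for f z
    proof -
      have "monomial n f (X z) = (\<Prod>v\<in>{Dl k l, Dlbar k l}. X z v powi f v)"
        unfolding monomial_def using False lk by (intro prod.mono_neutral_right finite_coords) (auto simp: X_def coords_def)
      then show ?thesis by (simp add: X_def)
    qed
    have adm: "admissible (X z)" if "z \<noteq> 0" for z
      using that False by (auto simp: admissible_def X_def)
    let ?a = "e (Dl k l)" and ?b = "e (Dlbar k l)" and ?a' = "e' (Dl k l)" and ?b' = "e' (Dlbar k l)"
    show ?thesis
    proof (cases "?a + ?b = ?a' + ?b'")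
      case False
      have "monomial n f (X 2) = 2 powi (f (Dl k l) + f (Dlbar k l))" for f
        unfolding m by (simp add: power_int_add)
      then show ?thesis using False adm[of 2] powi_2_inj by (metis zero_neq_numeral)
    next
      case True
      define d where "d = (?a - ?b) - (?a' - ?b')"
      have d: "d \<noteq> 0" using True ne w' unfolding d_def by auto
      (* at this angle the two monomials differ by the sign -1 *)
      define \<theta> where "\<theta> = pi / of_int d"
      have c: "monomial n f (X (cis \<theta>)) = cis (of_int (f (Dl k l) - f (Dlbar k l)) * \<theta>)" for f
      proof -
        have "monomial n f (X (cis \<theta>)) = cis \<theta> powi f (Dl k l) * cis (-\<theta>) powi f (Dlbar k l)"
          unfolding m by (simp add: cis_cnj)
        then show ?thesis by (simp add: cis_power_int cis_mult algebra_simps)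
      qed
      have "monomial n e (X (cis \<theta>)) = monomial n e' (X (cis \<theta>)) * cis (of_int d * \<theta>)"
        unfolding c cis_mult d_def by (simp add: algebra_simps)
      also have "cis (of_int d * \<theta>) = -1" using d by (simp add: \<theta>_def)
      finally have "monomial n e (X (cis \<theta>)) = - monomial n e' (X (cis \<theta>))" by simp
      moreover have "monomial n e' (X (cis \<theta>)) \<noteq> 0" unfolding c by simp
      ultimately show ?thesis using adm[of "cis \<theta>"] by (intro exI[of _ "X (cis \<theta>)"]) auto
    qed
  qed
qed

lemma eval_monomial:
  assumes "Poly_Mapping.keys m \<subseteq> coords n"
  shows "(\<Prod>w\<in>Poly_Mapping.keys m. x w powi Poly_Mapping.lookup m w) = monomial n (Poly_Mapping.lookup m) x"
  unfolding monomial_def using assms by (intro prod.mono_neutral_left) (auto simp: in_keys_iff)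

lemma monom_functional_weight:
  assumes "Poly_Mapping.keys m \<subseteq> coords n"
  shows "monom_functional m = weight n (Poly_Mapping.lookup m)"
  unfolding monom_functional_def weight_def using assms
  by (intro ext sum.mono_neutral_left) (auto simp: in_keys_iff)

lemma eval_laurent_monomials:
  assumes "L \<in> laurent_in (coords n)" "finite S" "Poly_Mapping.keys L \<subseteq> S"
  shows "eval_laurent L x = (\<Sum>m\<in>S. Poly_Mapping.lookup L m * monomial n (Poly_Mapping.lookup m) x)"
proof -
  have "eval_laurent L x = (\<Sum>m\<in>Poly_Mapping.keys L. Poly_Mapping.lookup L m * monomial n (Poly_Mapping.lookup m) x)"
    unfolding eval_laurent_def using assms(1)
    by (intro sum.cong refl) (auto simp: laurent_in_def eval_monomial)
  also have "\<dots> = (\<Sum>m\<in>S. Poly_Mapping.lookup L m * monomial n (Poly_Mapping.lookup m) x)"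
    using assms by (intro sum.mono_neutral_left) (auto simp: in_keys_iff)
  finally show ?thesis .
qed

lemma laurent_in_add: "L \<in> laurent_in W \<Longrightarrow> L' \<in> laurent_in W \<Longrightarrow> L + L' \<in> laurent_in W"
  using Poly_Mapping.keys_add[of L L'] unfolding laurent_in_def by blast

lemma laurent_in_diff: "L \<in> laurent_in W \<Longrightarrow> L' \<in> laurent_in W \<Longrightarrow> L - L' \<in> laurent_in W"
  using keys_diff[of L L'] unfolding laurent_in_def by blast

lemma eval_laurent_add:
  assumes "L \<in> laurent_in (coords n)" "L' \<in> laurent_in (coords n)"
  shows "eval_laurent (L + L') x = eval_laurent L x + eval_laurent L' x"
proof -
  let ?S = "Poly_Mapping.keys L \<union> Poly_Mapping.keys L'"
  have "Poly_Mapping.keys (L + L') \<subseteq> ?S" by (rule Poly_Mapping.keys_add)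
  then show ?thesis
    using eval_laurent_monomials[OF assms(1), of ?S x] eval_laurent_monomials[OF assms(2), of ?S x]
      eval_laurent_monomials[OF laurent_in_add[OF assms], of ?S x]
    by (simp add: lookup_add distrib_right sum.distrib)
qed

lemma eval_laurent_diff:
  assumes "L \<in> laurent_in (coords n)" "L' \<in> laurent_in (coords n)"
  shows "eval_laurent (L - L') x = eval_laurent L x - eval_laurent L' x"
  using eval_laurent_add[OF laurent_in_diff[OF assms] assms(2), of x] by simp

lemma eval_laurent_single:
  assumes "Poly_Mapping.keys m \<subseteq> coords n"
  shows "eval_laurent (Poly_Mapping.single m c) x = c * monomial n (Poly_Mapping.lookup m) x"
  using assms by (simp add: eval_laurent_def eval_monomial)

lemma laurent_vanishing:
  assumes L: "L \<in> laurent_in (coords n)" and z: "\<And>p. p \<in> chart n \<Longrightarrow> eval_laurent L (point_coords n p) = 0"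
  shows "L = 0"
proof -
  have keys: "Poly_Mapping.keys m \<subseteq> coords n" if "m \<in> Poly_Mapping.keys L" for m
    using L that by (auto simp: laurent_in_def)
  have "\<forall>m\<in>Poly_Mapping.keys L. Poly_Mapping.lookup L m = 0"
  proof (rule characters_independent[where X = "Collect admissible" and m = "\<lambda>x y w. x w * y w"
        and u = "\<lambda>w. 1" and ch = "\<lambda>m. monomial n (Poly_Mapping.lookup m)"])
    fix m x y assume "x \<in> Collect admissible" "y \<in> Collect admissible"
    show "monomial n (Poly_Mapping.lookup m) (\<lambda>w. x w * y w)
        = monomial n (Poly_Mapping.lookup m) x * monomial n (Poly_Mapping.lookup m) y"
      by (simp add: monomial_def power_int_mult_distrib prod.distrib)
  next
    fix m m' assume m: "m \<in> Poly_Mapping.keys L" "m' \<in> Poly_Mapping.keys L" "m \<noteq> m'"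
    obtain w where w: "Poly_Mapping.lookup m w \<noteq> Poly_Mapping.lookup m' w"
      using m(3) by (metis poly_mapping_eqI)
    then have "w \<in> coords n" using keys[OF m(1)] keys[OF m(2)] by (metis in_keys_iff subsetD)
    from monomial_separation[where e = "Poly_Mapping.lookup m" and e' = "Poly_Mapping.lookup m'", OF this w]
    show "\<exists>x\<in>Collect admissible. monomial n (Poly_Mapping.lookup m) x \<noteq> monomial n (Poly_Mapping.lookup m') x" by auto
  next
    fix x assume "x \<in> Collect admissible"
    then obtain p where p: "p \<in> chart n" "\<forall>w\<in>coords n. coord_fun n w p = x w"
      using admissible_on_chart by blast
    have "monomial n e x = monomial n e (point_coords n p)" for e
      using p unfolding monomial_def by (intro prod.cong) auto
    then show "(\<Sum>m\<in>Poly_Mapping.keys L. Poly_Mapping.lookup L m * monomial n (Poly_Mapping.lookup m) x) = 0"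
      using z[OF p(1)] eval_laurent_monomials[OF L finite_keys order_refl] by simp
  qed (auto simp: admissible_mult admissible_def[of "\<lambda>w. 1"] monomial_def)
  then have "Poly_Mapping.lookup L m = 0" for m by (cases "m \<in> Poly_Mapping.keys L") (auto simp: in_keys_iff)
  then show ?thesis by (intro poly_mapping_eqI) auto
qed

definition to_monom :: "nat \<Rightarrow> (coord \<Rightarrow> int) \<Rightarrow> lmonom" where
  "to_monom n e = Abs_poly_mapping (\<lambda>w. if w \<in> coords n then e w else 0)"

lemma lookup_to_monom: "Poly_Mapping.lookup (to_monom n e) w = (if w \<in> coords n then e w else 0)"
proof -
  have "finite {w. (if w \<in> coords n then e w else 0) \<noteq> 0}"
    by (rule finite_subset[OF _ finite_coords[of n]]) (auto split: if_splits)
  then show ?thesis by (simp add: to_monom_def)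
qed

lemma to_monom_props:
  "Poly_Mapping.keys (to_monom n e) \<subseteq> coords n"
  "monomial n (Poly_Mapping.lookup (to_monom n e)) = monomial n e"
  "monom_functional (to_monom n e) = weight n e"
proof -
  show k: "Poly_Mapping.keys (to_monom n e) \<subseteq> coords n"
    by (auto simp: in_keys_iff lookup_to_monom split: if_splits)
  show "monomial n (Poly_Mapping.lookup (to_monom n e)) = monomial n e"
    by (intro ext) (auto simp: monomial_def lookup_to_monom intro!: prod.cong)
  show "monom_functional (to_monom n e) = weight n e"
    unfolding monom_functional_weight[OF k] by (intro ext) (auto simp: weight_def lookup_to_monom intro!: sum.cong)
qed

lemma laurent_of_weights:
  assumes "laurent_weights n Q F"
  shows "\<exists>L\<in>laurent_in (coords n). (\<forall>m\<in>Poly_Mapping.keys L. Q (monom_functional m)) \<and>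
    (\<forall>p\<in>chart n. F p = eval_laurent L (point_coords n p))"
proof -
  obtain xs where xs: "\<forall>(c, e)\<in>set xs. Q (weight n e)"
    "\<forall>p\<in>chart n. F p = (\<Sum>(c, e)\<leftarrow>xs. c * monomial n e (point_coords n p))"
    using assms unfolding laurent_weights_def by blast
  have "\<exists>L\<in>laurent_in (coords n). (\<forall>m\<in>Poly_Mapping.keys L. Q (monom_functional m)) \<and>
    (\<forall>x. (\<Sum>(c, e)\<leftarrow>xs. c * monomial n e x) = eval_laurent L x)"
    using xs(1)
  proof (induction xs)
    case Nil
    show ?case by (rule bexI[of _ 0]) (auto simp: laurent_in_def eval_laurent_def)
  next
    case (Cons y ys)
    obtain c e where y: "y = (c, e)" by force
    obtain L where L: "L \<in> laurent_in (coords n)" "\<forall>m\<in>Poly_Mapping.keys L. Q (monom_functional m)"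
      "\<And>x. (\<Sum>(c, e)\<leftarrow>ys. c * monomial n e x) = eval_laurent L x"
      using Cons by auto
    let ?M = "Poly_Mapping.single (to_monom n e) c"
    have M: "?M \<in> laurent_in (coords n)"
      using to_monom_props(1)[of n e] by (auto simp: laurent_in_def split: if_splits)
    show ?case
    proof (intro bexI[of _ "?M + L"] conjI allI ballI)
      fix m assume "m \<in> Poly_Mapping.keys (?M + L)"
      then have "m \<in> Poly_Mapping.keys ?M \<or> m \<in> Poly_Mapping.keys L"
        using Poly_Mapping.keys_add[of ?M L] by blast
      then show "Q (monom_functional m)"
        using L(2) Cons.prems y by (auto simp: to_monom_props split: if_splits)
    next
      fix x show "(\<Sum>(c, e)\<leftarrow>y # ys. c * monomial n e x) = eval_laurent (?M + L) x"
        using L(3)[of x] by (simp add: y eval_laurent_add[OF M L(1)] eval_laurent_single[OF to_monom_props(1)] to_monom_props(2))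
    qed (rule laurent_in_add[OF M L(1)])
  qed
  then show ?thesis using xs(2) by auto
qed

text \<open>If the bracket is written as \<open>c u v\<close> plus a function whose monomials all have functionals other than that
of \<open>u v\<close>, then uniqueness of the expansion identifies the first summand with the constant term and the second with
the rest.\<close>

lemma bracket_expansion:
  assumes uv: "u \<in> coords n" "v \<in> coords n"
    and F: "\<And>p. p \<in> chart n \<Longrightarrow> real_bracket n (coord_fun n u) (coord_fun n v) p =
        c * (coord_fun n u p * coord_fun n v p) + R p"
    and R: "laurent_weights n Q R" and Q: "\<not> Q (monom_functional (prod_monom u v))"
  shows "c_coeff n u v = c"
    and "p_part n u v \<in> laurent_in (coords n)"
    and "\<forall>m\<in>Poly_Mapping.keys (p_part n u v). Q (monom_functional m)"
    and "\<forall>p\<in>chart n. R p = eval_laurent (p_part n u v) (point_coords n p)"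
proof -
  obtain L where L: "L \<in> laurent_in (coords n)" "\<forall>m\<in>Poly_Mapping.keys L. Q (monom_functional m)"
    "\<And>p. p \<in> chart n \<Longrightarrow> R p = eval_laurent L (point_coords n p)"
    using laurent_of_weights[OF R] by blast
  let ?m = "prod_monom u v"
  have mk: "Poly_Mapping.keys ?m \<subseteq> coords n"
    using Poly_Mapping.keys_add[of "Poly_Mapping.single u (1::int)" "Poly_Mapping.single v 1"] uv
    unfolding prod_monom_def by (auto split: if_splits)
  let ?M = "Poly_Mapping.single ?m c"
  have M: "?M \<in> laurent_in (coords n)" using mk by (auto simp: laurent_in_def split: if_splits)
  have mm: "monomial n (Poly_Mapping.lookup ?m) (point_coords n p) = coord_fun n u p * coord_fun n v p" if p: "p \<in> chart n" for p
  proof -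
    have s: "monomial n (Poly_Mapping.lookup (Poly_Mapping.single w 1)) (point_coords n p) = coord_fun n w p" if "w \<in> coords n" for w
      using that eval_monomial[of "Poly_Mapping.single w (1::int)" n "point_coords n p"] by simp
    have "monomial n (Poly_Mapping.lookup ?m) (point_coords n p) = monomial n (\<lambda>w. Poly_Mapping.lookup (Poly_Mapping.single u 1) w + Poly_Mapping.lookup (Poly_Mapping.single v 1) w) (point_coords n p)"
      by (simp add: prod_monom_def lookup_add[abs_def])
    then show ?thesis using monomial_mult[OF p] s uv by simp
  qed
  have sumL: "?M + L \<in> laurent_in (coords n)" by (rule laurent_in_add[OF M L(1)])
  have ev: "real_bracket n (coord_fun n u) (coord_fun n v) p = eval_laurent (?M + L) (point_coords n p)" if "p \<in> chart n" for p
    using that by (simp add: F L(3) eval_laurent_add[OF M L(1)] eval_laurent_single[OF mk] mm)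
  have B: "bracket_laurent n u v = ?M + L"
    unfolding bracket_laurent_def
  proof (rule the_equality)
    fix L' assume L': "L' \<in> laurent_in (coords n) \<and>
        (\<forall>p\<in>chart n. real_bracket n (coord_fun n u) (coord_fun n v) p = eval_laurent L' (point_coords n p))"
    have "L' - (?M + L) = 0"
      by (rule laurent_vanishing) (use L' sumL ev in \<open>auto simp: laurent_in_diff eval_laurent_diff\<close>)
    then show "L' = ?M + L" by simp
  qed (use sumL ev in auto)
  have "?m \<notin> Poly_Mapping.keys L" using L(2) Q by blast
  then show c: "c_coeff n u v = c" unfolding c_coeff_def B by (simp add: lookup_add in_keys_iff)
  have P: "p_part n u v = L" unfolding p_part_def B c by simp
  show "p_part n u v \<in> laurent_in (coords n)"
    "\<forall>m\<in>Poly_Mapping.keys (p_part n u v). Q (monom_functional m)"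
    "\<forall>p\<in>chart n. R p = eval_laurent (p_part n u v) (point_coords n p)"
    using L P by auto
qed

text \<open>A nonzero part all of whose monomials have the functional \<open>a\<close> cannot be cancelled by monomials with other
functionals.\<close>

lemma dominant_term_survives:
  assumes L: "L \<in> laurent_in (coords n)"
    and ev: "\<And>p. p \<in> chart n \<Longrightarrow> eval_laurent L (point_coords n p) = T p + R p"
    and T: "laurent_weights n ((=) a) T" "p0 \<in> chart n" "T p0 \<noteq> 0"
    and R: "laurent_weights n Q R" "\<not> Q a"
  shows "\<exists>m\<in>Poly_Mapping.keys L. monom_functional m = a"
proof -
  obtain A where A: "A \<in> laurent_in (coords n)" "\<forall>m\<in>Poly_Mapping.keys A. a = monom_functional m"
    "\<And>p. p \<in> chart n \<Longrightarrow> T p = eval_laurent A (point_coords n p)"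
    using laurent_of_weights[OF T(1)] by blast
  obtain B where B: "B \<in> laurent_in (coords n)" "\<forall>m\<in>Poly_Mapping.keys B. Q (monom_functional m)"
    "\<And>p. p \<in> chart n \<Longrightarrow> R p = eval_laurent B (point_coords n p)"
    using laurent_of_weights[OF R(1)] by blast
  have "L - (A + B) = 0"
  proof (rule laurent_vanishing)
    note AB = laurent_in_add[OF A(1) B(1)]
    show "L - (A + B) \<in> laurent_in (coords n)" by (rule laurent_in_diff[OF L AB])
    show "eval_laurent (L - (A + B)) (point_coords n p) = 0" if "p \<in> chart n" for p
      using that ev A(3) B(3) by (simp add: eval_laurent_diff[OF L AB] eval_laurent_add[OF A(1) B(1)])
  qed
  then have eq: "L = A + B" by simp
  have "A \<noteq> 0" using T(2,3) A(3)[of p0] by (auto simp: eval_laurent_def)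
  then obtain m where m: "m \<in> Poly_Mapping.keys A" by (metis keys_eq_empty ex_in_conv)
  then have "m \<notin> Poly_Mapping.keys B" using A(2) B(2) R(2) by metis
  then have "m \<in> Poly_Mapping.keys L" using m unfolding eq by (simp add: in_keys_iff lookup_add)
  then show ?thesis using m A(2) by auto
qed

section \<open>Weights of the transition coefficients\<close>

definition gap :: "(idx \<Rightarrow> real) \<Rightarrow> nat \<Rightarrow> nat \<Rightarrow> real" where
  "gap \<zeta> k l = pad \<zeta> k l - pad \<zeta> k (l - 1)"

text \<open>The Gelfand-Zeitlin inequalities for the gaps.\<close>

definition interlacing :: "nat \<Rightarrow> (idx \<Rightarrow> real) set" where
  "interlacing n = {\<zeta>. \<forall>k\<in>{2..n}. \<forall>l\<in>{1..k - 1}.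
     gap \<zeta> (k - 1) l < gap \<zeta> k l \<and> gap \<zeta> k (l + 1) < gap \<zeta> (k - 1) l}"

lemma interlacingD:
  assumes "\<zeta> \<in> interlacing n" "r + l < n" "1 \<le> l"
  shows "gap \<zeta> (n - Suc r) l < gap \<zeta> (n - r) l" "gap \<zeta> (n - r) (Suc l) < gap \<zeta> (n - Suc r) l"
proof -
  have "n - r \<in> {2..n}" "l \<in> {1..(n - r) - 1}" "n - r - 1 = n - Suc r" using assms by auto
  then show "gap \<zeta> (n - Suc r) l < gap \<zeta> (n - r) l" "gap \<zeta> (n - r) (Suc l) < gap \<zeta> (n - Suc r) l"
    using assms(1) unfolding interlacing_def by force+
qed

lemma interlacing_nonempty: "interlacing n \<noteq> {}"
proof -
  (* the partial sums of the interlacing pattern with entries k - 2 * l *)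
  define \<zeta> where "\<zeta> = (\<lambda>(k, l). real k * real l - real l * (real l + 1))"
  have p: "pad \<zeta> k l = real k * real l - real l * (real l + 1)" for k l
    by (auto simp: pad_def \<zeta>_def)
  have g: "gap \<zeta> k l = real k - 2 * real l" if "1 \<le> l" for k l
    using that unfolding gap_def p by (simp add: of_nat_diff algebra_simps)
  have "\<zeta> \<in> interlacing n" by (auto simp: interlacing_def g of_nat_diff)
  then show ?thesis by auto
qed

text \<open>Evaluating a functional at \<open>row_weight n x\<close> or \<open>col_weight n x\<close> gives the weight of the monomial under scaling of
the row or column \<open>x\<close> of \<open>g\<close>; at \<open>unit_weight k l\<close> it gives the total degree in one coordinate and its
conjugate.\<close>

definition row_weight :: "nat \<Rightarrow> nat \<Rightarrow> idx \<Rightarrow> real" where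
  "row_weight n x = (\<lambda>(k, l). if n - k \<le> x \<and> x < n - k + l then 1 else 0)"

definition col_weight :: "nat \<Rightarrow> nat \<Rightarrow> idx \<Rightarrow> real" where
  "col_weight n x = (\<lambda>(k, l). if n - l \<le> x \<and> x < n \<and> 0 < l then 1 else 0)"

definition unit_weight :: "nat \<Rightarrow> nat \<Rightarrow> idx \<Rightarrow> real" where
  "unit_weight k l = (\<lambda>i. if i = (k, l) then 1 else 0)"

definition kronecker :: "nat \<Rightarrow> nat \<Rightarrow> real" where
  "kronecker x y = (if x = y then 1 else 0)"

lemma gap_row_weight: "1 \<le> l \<Longrightarrow> r \<le> n \<Longrightarrow> gap (row_weight n x) (n - r) l = kronecker x (r + l - 1)"
  by (auto simp: gap_def pad_def row_weight_def kronecker_def)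

lemma gap_col_weight: "1 \<le> l \<Longrightarrow> l \<le> n \<Longrightarrow> x < n \<Longrightarrow> gap (col_weight n x) k l = kronecker x (n - l)"
  by (auto simp: gap_def pad_def col_weight_def kronecker_def)

lemma gap_unit_weight: "gap (unit_weight k l) k' l' = (if k = k' \<and> 0 < l then kronecker l l' - kronecker l (l' - 1) else 0)"
  by (auto simp: gap_def pad_def unit_weight_def kronecker_def)

text \<open>What is needed about the coefficient expanding row \<open>s\<close> by row \<open>i\<close> of a block that starts at row \<open>r\<close>: it is
tropically negative, it scales like row \<open>s\<close> divided by row \<open>i\<close>, and it involves only rows from \<open>r\<close> on. The
negativity describes the cone, the other conditions separate the terms of a bracket from each other.\<close>

definition row_class :: "nat \<Rightarrow> nat \<Rightarrow> nat \<Rightarrow> nat \<Rightarrow> ((idx \<Rightarrow> real) \<Rightarrow> real) \<Rightarrow> bool" where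
  "row_class n r s i a \<longleftrightarrow> (\<forall>\<zeta>\<in>interlacing n. a \<zeta> < 0) \<and>
     (\<forall>x<n. a (row_weight n x) = kronecker x s - kronecker x i) \<and>
     (\<forall>x<n. a (col_weight n x) = 0) \<and>
     (\<forall>k l. n - r < k \<longrightarrow> a (unit_weight k l) = 0)"

text \<open>The same for the coefficient expanding column \<open>t\<close> by column \<open>j\<close>.\<close>

definition col_class :: "nat \<Rightarrow> nat \<Rightarrow> nat \<Rightarrow> nat \<Rightarrow> ((idx \<Rightarrow> real) \<Rightarrow> real) \<Rightarrow> bool" where
  "col_class n r t j a \<longleftrightarrow> (\<forall>\<zeta>\<in>interlacing n. a \<zeta> < 0) \<and>
     (\<forall>x<n. a (row_weight n x) = 0) \<and>
     (\<forall>x<n. a (col_weight n x) = kronecker x t - kronecker x j) \<and>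
     (\<forall>k l. n - r < k \<longrightarrow> a (unit_weight k l) = 0)"

lemma row_class_mult: "row_class n r s i a \<Longrightarrow> row_class n r i j b \<Longrightarrow> row_class n r s j (\<lambda>\<zeta>. a \<zeta> + b \<zeta>)"
  by (auto simp: row_class_def intro: add_neg_neg)

lemma col_class_mult: "col_class n r s i a \<Longrightarrow> col_class n r i j b \<Longrightarrow> col_class n r s j (\<lambda>\<zeta>. a \<zeta> + b \<zeta>)"
  by (auto simp: col_class_def intro: add_neg_neg)

lemma row_class_Suc: "row_class n (Suc r) s i a \<Longrightarrow> row_class n r s i a"
  by (auto simp: row_class_def)

lemma col_class_Suc: "col_class n (Suc r) s i a \<Longrightarrow> col_class n r s i a"
  by (auto simp: col_class_def)

lemma laurent_weights_minor:
  assumes "r + l \<le> n"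
  shows "laurent_weights n ((=) (\<lambda>\<zeta>. pad \<zeta> (n - r) l)) (\<lambda>p. corner_minor n (upper_entries p) r l)"
    "laurent_weights n ((=) (\<lambda>\<zeta>. - pad \<zeta> (n - r) l)) (\<lambda>p. inverse (corner_minor n (upper_entries p) r l))"
  using laurent_weights_minor_power[OF assms, of 1] laurent_weights_minor_power[OF assms, of "-1"]
  by (simp_all add: power_int_minus)

lemma laurent_weights_mult_eq:
  assumes "laurent_weights n ((=) a) F" "laurent_weights n ((=) b) H"
  shows "laurent_weights n ((=) (\<lambda>\<zeta>. a \<zeta> + b \<zeta>)) (\<lambda>p. F p * H p)"
  by (rule laurent_weights_mult[OF assms]) simp

lemma laurent_weights_ratio:
  assumes "r1 + l1 \<le> n" "r2 + l2 \<le> n" "r3 + l3 \<le> n" "r4 + l4 \<le> n"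
  shows "laurent_weights n ((=) (\<lambda>\<zeta>. pad \<zeta> (n - r1) l1 + pad \<zeta> (n - r2) l2 + (- pad \<zeta> (n - r3) l3 + - pad \<zeta> (n - r4) l4)))
     (\<lambda>p. corner_minor n (upper_entries p) r1 l1 * corner_minor n (upper_entries p) r2 l2 /
       (corner_minor n (upper_entries p) r3 l3 * corner_minor n (upper_entries p) r4 l4))"
proof -
  have "laurent_weights n ((=) (\<lambda>\<zeta>. pad \<zeta> (n - r1) l1 + pad \<zeta> (n - r2) l2 + (- pad \<zeta> (n - r3) l3 + - pad \<zeta> (n - r4) l4)))
     (\<lambda>p. (corner_minor n (upper_entries p) r1 l1 * corner_minor n (upper_entries p) r2 l2) *
       (inverse (corner_minor n (upper_entries p) r3 l3) * inverse (corner_minor n (upper_entries p) r4 l4)))"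
    by (intro laurent_weights_mult_eq laurent_weights_minor assms)
  then show ?thesis by (rule laurent_weights_mono) (auto simp: divide_inverse)
qed

lemma laurent_weights_row_ratio:
  assumes "r + l < n" "1 \<le> l"
  shows "laurent_weights n ((=) (\<lambda>\<zeta>. gap \<zeta> (n - Suc r) l - gap \<zeta> (n - r) l)) (\<lambda>p. row_ratio n (upper_entries p) r l)"
  unfolding row_ratio_def
  by (rule laurent_weights_mono[OF laurent_weights_ratio]) (use assms in \<open>auto simp: gap_def algebra_simps\<close>)

lemma laurent_weights_col_ratio:
  assumes "r + l < n" "1 \<le> l"
  shows "laurent_weights n ((=) (\<lambda>\<zeta>. gap \<zeta> (n - r) (Suc l) - gap \<zeta> (n - Suc r) l)) (\<lambda>p. col_ratio n (upper_entries p) r l)"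
  unfolding col_ratio_def
  by (rule laurent_weights_mono[OF laurent_weights_ratio]) (use assms in \<open>auto simp: gap_def algebra_simps\<close>)

lemma row_ratio_class:
  assumes "r + l < n" "1 \<le> l"
  shows "row_class n r (r + l) (r + l - 1) (\<lambda>\<zeta>. gap \<zeta> (n - Suc r) l - gap \<zeta> (n - r) l)"
  using assms interlacingD[of _ n r l] gap_row_weight[of l "Suc r" n]
  by (auto simp: row_class_def gap_row_weight gap_col_weight gap_unit_weight)

lemma col_ratio_class:
  assumes "r + l < n" "1 \<le> l"
  shows "col_class n r (n - Suc l) (n - l) (\<lambda>\<zeta>. gap \<zeta> (n - r) (Suc l) - gap \<zeta> (n - Suc r) l)"
  using assms interlacingD[of _ n r l] gap_row_weight[of l "Suc r" n]
  by (auto simp: col_class_def gap_row_weight gap_col_weight gap_unit_weight)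

lemma row_ratio_laurent:
  assumes "r + l < n" "1 \<le> l"
  shows "laurent_weights n (row_class n r (r + l) (r + l - 1)) (\<lambda>p. row_ratio n (upper_entries p) r l)"
  by (rule laurent_weights_mono[OF laurent_weights_row_ratio[OF assms]]) (use row_ratio_class[OF assms] in auto)

lemma col_ratio_laurent:
  assumes "r + l < n" "1 \<le> l"
  shows "laurent_weights n (col_class n r (n - Suc l) (n - l)) (\<lambda>p. col_ratio n (upper_entries p) r l)"
  by (rule laurent_weights_mono[OF laurent_weights_col_ratio[OF assms]]) (use col_ratio_class[OF assms] in auto)

lemma laurent_weights_mult_row:
  assumes "laurent_weights n (row_class n r s i) F" "laurent_weights n (row_class n r i j) H"
  shows "laurent_weights n (row_class n r s j) (\<lambda>p. F p * H p)"
  by (rule laurent_weights_mult[OF assms]) (rule row_class_mult)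

lemma laurent_weights_mult_col:
  assumes "laurent_weights n (col_class n r s i) F" "laurent_weights n (col_class n r i j) H"
  shows "laurent_weights n (col_class n r s j) (\<lambda>p. F p * H p)"
  by (rule laurent_weights_mult[OF assms]) (rule col_class_mult)

lemma col_coeff_full_height_chart:
  "p \<in> chart n \<Longrightarrow> r + l = n \<Longrightarrow> t < r \<Longrightarrow> col_coeff n (upper_entries p) r l j t = 0"
  by (rule col_coeff_full_height) (auto simp: chart_upper_entries_zero)

lemma row_relation_laurent:
  assumes "r + l < n" "r \<le> i" "i < r + l"
  shows "laurent_weights n (row_class n r (r + l) i) (\<lambda>p. row_relation n (upper_entries p) l r i)"
  using assms
proof (induction l arbitrary: r)
  case (Suc l)
  have 1: "laurent_weights n (row_class n r (r + Suc l) i) (\<lambda>p. row_relation n (upper_entries p) l (Suc r) i)"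
  proof (cases "i = r")
    case False
    then have "laurent_weights n (row_class n (Suc r) (Suc r + l) i) (\<lambda>p. row_relation n (upper_entries p) l (Suc r) i)"
      using Suc.prems by (intro Suc.IH) auto
    then show ?thesis by (rule laurent_weights_mono) (auto intro: row_class_Suc)
  qed (simp add: row_relation_outside)
  have R: "laurent_weights n (row_class n r (r + Suc l) (r + l)) (\<lambda>p. row_ratio n (upper_entries p) r (Suc l))"
    using row_ratio_laurent[of r "Suc l" n] Suc.prems by simp
  have 2: "laurent_weights n (row_class n r (r + Suc l) i)
      (\<lambda>p. row_ratio n (upper_entries p) r (Suc l) * row_relation n (upper_entries p) l r i)"
  proof (cases "i = r + l")
    case True
    then show ?thesis using R by (simp add: row_relation_top)
  next
    case False
    then have "laurent_weights n (row_class n r (r + l) i) (\<lambda>p. row_relation n (upper_entries p) l r i)"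
      using Suc.prems by (intro Suc.IH) auto
    from laurent_weights_mult_row[OF R this] show ?thesis .
  qed
  show ?case using laurent_weights_diff[OF 1 2] by simp
qed simp

text \<open>Induction on the distance of \<open>s\<close> from the block by \<open>row_coeff_shift\<close>, starting from the row relation.\<close>

lemma row_coeff_laurent:
  assumes "r \<le> i" "i < r + l" "r + l \<le> s" "s < n"
  shows "laurent_weights n (row_class n r s i) (\<lambda>p. row_coeff n (upper_entries p) r l s i)"
  using assms
proof (induction "s - (r + l)" arbitrary: r i)
  case 0
  then have "s = r + l" by simp
  then show ?case
    using 0 chart_regular
    by (intro laurent_weights_mono[OF laurent_weights_uminus[OF row_relation_laurent[of r l n i]]])
       (auto simp: row_coeff_first_below)
next
  case (Suc d)
  have 1: "laurent_weights n (row_class n r s i) (\<lambda>p. row_coeff n (upper_entries p) (Suc r) l s i)"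
  proof (cases "i = r")
    case False
    then have "laurent_weights n (row_class n (Suc r) s i) (\<lambda>p. row_coeff n (upper_entries p) (Suc r) l s i)"
      using Suc.prems Suc.hyps(2) by (intro Suc.hyps(1)) auto
    then show ?thesis by (rule laurent_weights_mono) (auto intro: row_class_Suc)
  qed (simp add: row_coeff_outside)
  have 2: "laurent_weights n (row_class n r s (r + l)) (\<lambda>p. row_coeff n (upper_entries p) (Suc r) l s (r + l))"
  proof -
    have "laurent_weights n (row_class n (Suc r) s (r + l)) (\<lambda>p. row_coeff n (upper_entries p) (Suc r) l s (r + l))"
      using Suc.prems Suc.hyps(2) by (intro Suc.hyps(1)) auto
    then show ?thesis by (rule laurent_weights_mono) (auto intro: row_class_Suc)
  qed
  have 3: "laurent_weights n (row_class n r (r + l) i) (\<lambda>p. row_coeff n (upper_entries p) r l (r + l) i)"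
    using Suc.prems chart_regular
    by (intro laurent_weights_mono[OF laurent_weights_uminus[OF row_relation_laurent[of r l n i]]])
       (auto simp: row_coeff_first_below)
  show ?case
    by (rule laurent_weights_mono[OF laurent_weights_add[OF 1 laurent_weights_mult_row[OF 2 3]]])
       (use Suc.prems Suc.hyps(2) chart_regular in \<open>auto intro!: row_coeff_shift[symmetric]\<close>)
qed

text \<open>Induction on \<open>l\<close> and, inside, on the distance of \<open>r\<close> from the bottom, by \<open>col_coeff_shift\<close>. The inner induction
ends when the block below would reach the bottom: then the column vanishes there, as \<open>g\<close> is upper
triangular.\<close>

lemma col_coeff_first_laurent:
  assumes "r + Suc l \<le> n" "n - l \<le> j" "j < n"
  shows "laurent_weights n (col_class n r (n - Suc l) j) (\<lambda>p. col_coeff n (upper_entries p) r l j (n - Suc l))"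
  using assms
proof (induction l arbitrary: r j)
  case (Suc l)
  note IHl = Suc.IH
  let ?L = "Suc l"
  show ?case using Suc.prems
  proof (induction "n - r" arbitrary: r rule: less_induct)
    case (less r)
    have 1: "laurent_weights n (col_class n r (n - Suc ?L) j) (\<lambda>p. col_coeff n (upper_entries p) (Suc r) ?L j (n - Suc ?L))"
    proof (cases "Suc r + Suc ?L \<le> n")
      case True
      then have "laurent_weights n (col_class n (Suc r) (n - Suc ?L) j) (\<lambda>p. col_coeff n (upper_entries p) (Suc r) ?L j (n - Suc ?L))"
        using less.prems by (intro less.hyps) auto
      then show ?thesis by (rule laurent_weights_mono) (auto intro: col_class_Suc)
    next
      case False
      then have r: "Suc r + ?L = n" using less.prems by auto
      show ?thesis
        by (rule laurent_weights_mono[OF laurent_weights_0])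
           (use r in \<open>auto simp: col_coeff_full_height_chart\<close>)
    qed
    have R: "laurent_weights n (col_class n r (n - Suc ?L) (n - ?L)) (\<lambda>p. col_ratio n (upper_entries p) r ?L)"
      using less.prems by (intro col_ratio_laurent) auto
    have 2: "laurent_weights n (col_class n r (n - Suc ?L) j) (\<lambda>p. col_ratio n (upper_entries p) r ?L * kernel_coeff n (upper_entries p) r ?L j)"
    proof (cases "j = n - ?L")
      case True
      then show ?thesis using R by (simp add: kernel_coeff_def)
    next
      case False
      then have "laurent_weights n (col_class n (Suc r) (n - Suc l) j) (\<lambda>p. col_coeff n (upper_entries p) (Suc r) l j (n - Suc l))"
        using less.prems by (intro IHl) auto
      then have "laurent_weights n (col_class n r (n - ?L) j) (\<lambda>p. - col_coeff n (upper_entries p) (Suc r) l j (n - Suc l))"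
        by (rule laurent_weights_mono[OF laurent_weights_uminus]) (auto intro: col_class_Suc)
      from laurent_weights_mult_col[OF R this] show ?thesis
        using False by (simp add: kernel_coeff_def)
    qed
    show ?case
      by (rule laurent_weights_mono[OF laurent_weights_add[OF 1 2]])
         (use less.prems chart_regular in \<open>auto intro!: col_coeff_shift[symmetric]\<close>)
  qed
qed simp

lemma col_coeff_laurent:
  assumes "r + l \<le> n" "n - l \<le> j" "j < n" "t < n - l"
  shows "laurent_weights n (col_class n r t j) (\<lambda>p. col_coeff n (upper_entries p) r l j t)"
  using assms
proof (induction "n - l" arbitrary: l j rule: less_induct)
  case less
  show ?case
  proof (cases "r + l = n")
    case True
    show ?thesis
      by (rule laurent_weights_mono[OF laurent_weights_0])
         (use True less.prems in \<open>auto simp: col_coeff_full_height_chart\<close>)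
  next
    case False
    then have r: "r + Suc l \<le> n" using less.prems by auto
    have K: "laurent_weights n (col_class n r (n - Suc l) j) (\<lambda>p. col_coeff n (upper_entries p) r l j (n - Suc l))"
      using less.prems r by (intro col_coeff_first_laurent) auto
    show ?thesis
    proof (cases "t = n - Suc l")
      case False
      then have t: "t < n - Suc l" using less.prems by auto
      have 1: "laurent_weights n (col_class n r t j) (\<lambda>p. col_coeff n (upper_entries p) r (Suc l) j t)"
        using less.prems r t by (intro less.hyps) auto
      have 2: "laurent_weights n (col_class n r t (n - Suc l)) (\<lambda>p. col_coeff n (upper_entries p) r (Suc l) (n - Suc l) t)"
        using less.prems r t by (intro less.hyps) auto
      show ?thesis
        by (rule laurent_weights_mono[OF laurent_weights_add[OF 1 laurent_weights_mult_col[OF 2 K]]])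
           (use less.prems r chart_regular in \<open>auto intro!: col_coeff_widen[symmetric]\<close>)
    qed (use K in simp)
  qed
qed

section \<open>The tropical cone and the constant terms\<close>

definition expands :: "nat \<Rightarrow> coord \<Rightarrow> coord \<Rightarrow> complex \<Rightarrow> (complex mat \<times> complex mat \<Rightarrow> complex) \<Rightarrow> bool" where
  "expands n u v c R \<longleftrightarrow> (\<forall>p\<in>chart n. real_bracket n (coord_fun n u) (coord_fun n v) p =
      c * (coord_fun n u p * coord_fun n v p) + R p)"

text \<open>The functional is smaller than that of \<open>u v\<close> on the whole interlacing cone.\<close>

definition below :: "nat \<Rightarrow> coord \<Rightarrow> coord \<Rightarrow> ((idx \<Rightarrow> real) \<Rightarrow> real) \<Rightarrow> bool" where
  "below n u v a \<longleftrightarrow> (\<forall>\<zeta>\<in>interlacing n. a \<zeta> < \<zeta> (coord_index u) + \<zeta> (coord_index v))"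

definition overlap :: "nat \<Rightarrow> nat \<Rightarrow> nat \<Rightarrow> nat \<Rightarrow> nat \<Rightarrow> nat" where
  "overlap n k l k' l' = card ({n-k..<n-k+l} \<inter> {n-k'..<n-k'+l'})"

lemma overlap_commute: "overlap n k l k' l' = overlap n k' l' k l"
  by (simp add: overlap_def Int_commute)

lemma expands_swap:
  assumes "expands n u v c R"
  shows "expands n v u (- c) (\<lambda>p. - R p)"
  unfolding expands_def
proof
  fix p assume "p \<in> chart n"
  then have "real_bracket n (coord_fun n u) (coord_fun n v) p = c * (coord_fun n u p * coord_fun n v p) + R p"
    using assms by (simp add: expands_def)
  moreover have "real_bracket n (coord_fun n v) (coord_fun n u) p = - real_bracket n (coord_fun n u) (coord_fun n v) p"
    using group_bracket_antisym[of n "coord_fun n v" "coord_fun n u" p] by (simp add: real_bracket_def)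
  ultimately show "real_bracket n (coord_fun n v) (coord_fun n u) p = - c * (coord_fun n v p * coord_fun n u p) + - R p"
    by (simp add: mult.commute)
qed

lemma below_swap: "below n u v a \<longleftrightarrow> below n v u a"
  by (simp add: below_def add.commute)

lemma expands_Delta_Delta:
  assumes "l \<le> k" "k \<le> k'" "l' \<le> k'" "k' \<le> n"
  shows "expands n (Dl k l) (Dl k' l') (\<i> / 2 * (of_nat (overlap n k l k' l') - of_nat (min l l'))) (\<lambda>p. 0)"
  unfolding expands_def
proof
  fix p assume "p \<in> chart n"
  then interpret chart_point n p by unfold_locales
  show "real_bracket n (coord_fun n (Dl k l)) (coord_fun n (Dl k' l')) p =
      \<i> / 2 * (of_nat (overlap n k l k' l') - of_nat (min l l')) * (coord_fun n (Dl k l) p * coord_fun n (Dl k' l') p) + 0"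
    unfolding coord_fun.simps overlap_def using Delta_Delta[OF assms] by simp
qed

lemma expands_Lambda_Lambda:
  assumes "l' \<le> k'" "k' \<le> k" "l \<le> k" "k \<le> n"
  shows "expands n (Dlbar k l) (Dlbar k' l') (\<i> / 2 * (of_nat (overlap n k' l' k l) - of_nat (min l' l))) (\<lambda>p. 0)"
  unfolding expands_def
proof
  fix p assume "p \<in> chart n"
  then interpret chart_point n p by unfold_locales
  show "real_bracket n (coord_fun n (Dlbar k l)) (coord_fun n (Dlbar k' l')) p =
      \<i> / 2 * (of_nat (overlap n k' l' k l) - of_nat (min l' l)) * (coord_fun n (Dlbar k l) p * coord_fun n (Dlbar k' l') p) + 0"
    unfolding coord_fun.simps overlap_def using Lambda_Lambda[OF assms] by simp
qed

text \<open>The part of \<open>{\<Delta>, \<Lambda>} / (\<i> \<Delta> \<Lambda>)\<close> that is not constant.\<close>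

definition mixed_sum :: "nat \<Rightarrow> nat \<Rightarrow> nat \<Rightarrow> nat \<Rightarrow> nat \<Rightarrow> complex mat \<times> complex mat \<Rightarrow> complex" where
  "mixed_sum n k l k' l' p =
     (\<Sum>j\<in>{n - min l l'..<n}. \<Sum>t<n - max l l'.
        col_coeff n (upper_entries p) (n-k) l j t * cnj (col_coeff n (upper_entries p) (n-k') l' j t))
      - (\<Sum>i\<in>{n-k..<n-k+l} \<inter> {n-k'..<n-k'+l'}. \<Sum>s\<in>{max (n-k+l) (n-k'+l')..<n}.
          row_coeff n (upper_entries p) (n-k) l s i * cnj (row_coeff n (upper_entries p) (n-k') l' s i))"

lemma expands_Delta_Lambda:
  assumes "l \<le> k" "k \<le> n" "l' \<le> k'" "k' \<le> n"
  shows "expands n (Dl k l) (Dlbar k' l') (\<i> / 2 * (of_nat (min l l') - of_nat (overlap n k l k' l')))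
     (\<lambda>p. Delta_minor n k l p * Lambda_minor n k' l' p * (\<i> * mixed_sum n k l k' l' p))"
  unfolding expands_def
proof
  fix p assume "p \<in> chart n"
  then interpret chart_point n p by unfold_locales
  show "real_bracket n (coord_fun n (Dl k l)) (coord_fun n (Dlbar k' l')) p =
      \<i> / 2 * (of_nat (min l l') - of_nat (overlap n k l k' l')) * (coord_fun n (Dl k l) p * coord_fun n (Dlbar k' l') p)
      + Delta_minor n k l p * Lambda_minor n k' l' p * (\<i> * mixed_sum n k l k' l' p)"
    unfolding coord_fun.simps overlap_def mixed_sum_def using Delta_Lambda[OF assms] by (simp only: mult.assoc)
qed

lemma laurent_weights_mult_cnj:
  assumes "laurent_weights n Q F" "laurent_weights n Q' H" "\<And>a b. Q a \<Longrightarrow> Q' b \<Longrightarrow> Q'' (\<lambda>\<zeta>. a \<zeta> + b \<zeta>)"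
  shows "laurent_weights n Q'' (\<lambda>p. F p * cnj (H p))"
  by (rule laurent_weights_mult[OF assms(1) laurent_weights_cnj[OF assms(2)]]) (rule assms(3))

lemma laurent_weights_Delta_Lambda:
  assumes "1 \<le> l" "l \<le> k" "k \<le> n" "1 \<le> l'" "l' \<le> k'" "k' \<le> n"
  shows "laurent_weights n ((=) (\<lambda>\<zeta>. \<zeta> (k, l) + \<zeta> (k', l'))) (\<lambda>p. Delta_minor n k l p * Lambda_minor n k' l' p)"
proof -
  have D: "laurent_weights n ((=) (\<lambda>\<zeta>. \<zeta> (k, l))) (\<lambda>p. Delta_minor n k l p)"
    if "1 \<le> l" "l \<le> k" "k \<le> n" for k l
    using laurent_weights_minor(1)[of "n - k" l n] that by (simp add: pad_def Delta_minor_upper_entries)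
  have "laurent_weights n ((=) (\<lambda>\<zeta>. \<zeta> (k, l) + \<zeta> (k', l'))) (\<lambda>p. Delta_minor n k l p * cnj (Delta_minor n k' l' p))"
    by (rule laurent_weights_mult_cnj[OF D D]) (use assms in auto)
  then show ?thesis
  proof (rule laurent_weights_mono)
    fix p assume "p \<in> chart n"
    then interpret chart_point n p by unfold_locales
    show "Delta_minor n k l p * cnj (Delta_minor n k' l' p) = Delta_minor n k l p * Lambda_minor n k' l' p"
      using Lambda_cnj[of l' k'] assms by simp
  qed
qed

lemma mixed_sum_negative:
  assumes "1 \<le> l" "l \<le> k" "k \<le> n" "1 \<le> l'" "l' \<le> k'" "k' \<le> n"
  shows "laurent_weights n (\<lambda>a. \<forall>\<zeta>\<in>interlacing n. a \<zeta> < 0) (mixed_sum n k l k' l')"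
proof -
  have C: "laurent_weights n (\<lambda>a. \<forall>\<zeta>\<in>interlacing n. a \<zeta> < 0)
      (\<lambda>p. col_coeff n (upper_entries p) (n-k) l j t * cnj (col_coeff n (upper_entries p) (n-k') l' j t))"
    if "j \<in> {n - min l l'..<n}" "t < n - max l l'" for j t
    using that assms
    by (intro laurent_weights_mult_cnj[OF col_coeff_laurent col_coeff_laurent])
       (auto simp: col_class_def intro: add_neg_neg)
  have R: "laurent_weights n (\<lambda>a. \<forall>\<zeta>\<in>interlacing n. a \<zeta> < 0)
      (\<lambda>p. row_coeff n (upper_entries p) (n-k) l s i * cnj (row_coeff n (upper_entries p) (n-k') l' s i))"
    if "i \<in> {n-k..<n-k+l} \<inter> {n-k'..<n-k'+l'}" "s \<in> {max (n-k+l) (n-k'+l')..<n}" for i s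
    using that assms
    by (intro laurent_weights_mult_cnj[OF row_coeff_laurent row_coeff_laurent])
       (auto simp: row_class_def intro: add_neg_neg)
  show ?thesis
    unfolding mixed_sum_def[abs_def] using C R
    by (intro laurent_weights_diff laurent_weights_sum) auto
qed

lemma mixed_rest_below:
  assumes "1 \<le> l" "l \<le> k" "k \<le> n" "1 \<le> l'" "l' \<le> k'" "k' \<le> n"
  shows "laurent_weights n (below n (Dl k l) (Dlbar k' l'))
    (\<lambda>p. Delta_minor n k l p * Lambda_minor n k' l' p * (\<i> * mixed_sum n k l k' l' p))"
  by (rule laurent_weights_mult[OF laurent_weights_Delta_Lambda[OF assms] laurent_weights_cmult[OF mixed_sum_negative[OF assms]]])
     (auto simp: below_def)

text \<open>Skew-symmetry reduces the pairs to those for which the formulas above apply: for two functions of the same kind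
the order of the upper indices matters, and a mixed pair must start with the holomorphic function.\<close>

lemma expansion_exists:
  assumes "u \<in> coords n" "v \<in> coords n"
  shows "\<exists>c R. expands n u v c R \<and> laurent_weights n (below n u v) R"
proof -
  have swap: "\<exists>c R. expands n u v c R \<and> laurent_weights n (below n u v) R"
    if "\<exists>c R. expands n v u c R \<and> laurent_weights n (below n v u) R" for u v
    using that expands_swap laurent_weights_uminus below_swap[abs_def] by metis
  have exact: "\<exists>c R. expands n u v c R \<and> laurent_weights n (below n u v) R"
    if "expands n u v c (\<lambda>p. 0)" for u v c
    using that laurent_weights_0 by blast
  show ?thesis
  proof (cases u; cases v)
    fix k l k' l' assume uv: "u = Dl k l" "v = Dl k' l'"
    show ?thesis
    proof (cases "k \<le> k'")
      case True
      show ?thesis unfolding uv by (rule exact, rule expands_Delta_Delta) (use True assms uv in \<open>auto simp: coords_def\<close>)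
    next
      case False
      show ?thesis unfolding uv by (rule swap, rule exact, rule expands_Delta_Delta) (use False assms uv in \<open>auto simp: coords_def\<close>)
    qed
  next
    fix k l k' l' assume uv: "u = Dlbar k l" "v = Dlbar k' l'"
    show ?thesis
    proof (cases "k' \<le> k")
      case True
      show ?thesis unfolding uv by (rule exact, rule expands_Lambda_Lambda) (use True assms uv in \<open>auto simp: coords_def\<close>)
    next
      case False
      show ?thesis unfolding uv by (rule swap, rule exact, rule expands_Lambda_Lambda) (use False assms uv in \<open>auto simp: coords_def\<close>)
    qed
  next
    fix k l k' l' assume uv: "u = Dl k l" "v = Dlbar k' l'"
    then show ?thesis using assms expands_Delta_Lambda[of l k n l' k'] mixed_rest_below[of l k n l' k']
      by (auto simp: coords_def)
  next
    fix k l k' l' assume uv: "u = Dlbar k l" "v = Dl k' l'"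
    then have "\<exists>c R. expands n v u c R \<and> laurent_weights n (below n v u) R"
      using assms expands_Delta_Lambda[of l' k' n l k] mixed_rest_below[of l' k' n l k]
      by (auto simp: coords_def)
    then show ?thesis by (rule swap)
  qed
qed

lemma prod_monom_functional:
  assumes "u \<in> coords n" "v \<in> coords n"
  shows "monom_functional (prod_monom u v) \<zeta> = \<zeta> (coord_index u) + \<zeta> (coord_index v)"
proof -
  have k: "Poly_Mapping.keys (prod_monom u v) \<subseteq> coords n"
    using Poly_Mapping.keys_add[of "Poly_Mapping.single u (1::int)" "Poly_Mapping.single v 1"] assms
    unfolding prod_monom_def by (auto split: if_splits)
  have "Poly_Mapping.lookup (prod_monom u v) w = (if w = u then 1 else 0) + (if w = v then 1 else 0)" for w
    by (auto simp: prod_monom_def lookup_add lookup_single when_def)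
  then have "monom_functional (prod_monom u v) \<zeta> = (\<Sum>w\<in>coords n. (if w = u then \<zeta> (coord_index u) else 0) + (if w = v then \<zeta> (coord_index v) else 0))"
    unfolding monom_functional_weight[OF k] weight_def by (intro sum.cong refl) auto
  also have "\<dots> = \<zeta> (coord_index u) + \<zeta> (coord_index v)"
    using assms by (simp add: sum.distrib)
  finally show ?thesis .
qed

lemma not_below_prod:
  assumes "u \<in> coords n" "v \<in> coords n"
  shows "\<not> below n u v (monom_functional (prod_monom u v))"
  using interlacing_nonempty[of n] by (auto simp: below_def prod_monom_functional[OF assms])

lemma expands_bracket:
  assumes "u \<in> coords n" "v \<in> coords n" "expands n u v c R" "laurent_weights n (below n u v) R"
  shows "c_coeff n u v = c"
    and "p_part n u v \<in> laurent_in (coords n)"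
    and "\<forall>m\<in>Poly_Mapping.keys (p_part n u v). below n u v (monom_functional m)"
    and "\<forall>p\<in>chart n. R p = eval_laurent (p_part n u v) (point_coords n p)"
  using bracket_expansion[OF assms(1,2) _ assms(4) not_below_prod[OF assms(1,2)], of c] assms(3)
  unfolding expands_def by blast+

lemma sum_sum_single:
  fixes c :: "'a::comm_monoid_add"
  assumes "finite A" "finite B" "a \<in> A" "b \<in> B"
  shows "(\<Sum>i\<in>A. \<Sum>s\<in>B. if i = a \<and> s = b then c else 0) = c"
proof -
  have "(\<Sum>i\<in>A. \<Sum>s\<in>B. if i = a \<and> s = b then c else 0) = (\<Sum>i\<in>A. if i = a then c else 0)"
  proof (intro sum.cong refl)
    fix i show "(\<Sum>s\<in>B. if i = a \<and> s = b then c else 0) = (if i = a then c else 0)"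
      using assms by (cases "i = a") auto
  qed
  then show ?thesis using assms by simp
qed

text \<open>The criterion for a monomial to occur in the bracket of a coordinate with its own conjugate: \<open>y\<close> is a Laurent
function of the single functional \<open>b\<close>, and no other contribution \<open>D\<close> has the functional \<open>2 b\<close>.\<close>

lemma p_part_monomial:
  assumes kl: "1 \<le> l" "l < k" "k \<le> n"
    and sum: "\<And>p. p \<in> chart n \<Longrightarrow> mixed_sum n k l k l p = \<epsilon> * (y p * cnj (y p)) + D p"
    and e: "\<epsilon> \<noteq> 0" and y: "laurent_weights n ((=) b) y" "\<And>p. p \<in> chart n \<Longrightarrow> y p \<noteq> 0"
    and D: "laurent_weights n Q D" and Q: "\<not> Q (\<lambda>\<zeta>. b \<zeta> + b \<zeta>)"
  shows "\<exists>m\<in>Poly_Mapping.keys (p_part n (Dl k l) (Dlbar k l)).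
     \<forall>\<zeta>. monom_functional m \<zeta> = \<zeta> (k, l) + \<zeta> (k, l) + (b \<zeta> + b \<zeta>)"
proof -
  have c: "Dl k l \<in> coords n" "Dlbar k l \<in> coords n" using kl by (auto simp: coords_def)
  let ?R = "\<lambda>p. Delta_minor n k l p * Lambda_minor n k l p * (\<i> * mixed_sum n k l k l p)"
  let ?uv = "\<lambda>p. Delta_minor n k l p * Lambda_minor n k l p"
  have le: "l \<le> k" using kl by simp
  note ex = expands_bracket[OF c expands_Delta_Lambda[OF le kl(3) le kl(3)] mixed_rest_below[OF kl(1) le kl(3) kl(1) le kl(3)]]
  note uv = laurent_weights_Delta_Lambda[OF kl(1) le kl(3) kl(1) le kl(3)]
  obtain p0 where p0: "p0 \<in> chart n" using chart_nonempty by blast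
  have T: "laurent_weights n ((=) (\<lambda>\<zeta>. \<zeta> (k, l) + \<zeta> (k, l) + (b \<zeta> + b \<zeta>))) (\<lambda>p. ?uv p * (\<i> * \<epsilon> * (y p * cnj (y p))))"
    by (rule laurent_weights_mult_eq[OF uv laurent_weights_cmult[OF laurent_weights_mult_eq[OF y(1) laurent_weights_cnj[OF y(1)]]]])
  have D': "laurent_weights n (\<lambda>a. Q (\<lambda>\<zeta>. a \<zeta> - (\<zeta> (k, l) + \<zeta> (k, l)))) (\<lambda>p. ?uv p * (\<i> * D p))"
    by (rule laurent_weights_mult[OF uv laurent_weights_cmult[OF D]]) auto
  have "\<exists>m\<in>Poly_Mapping.keys (p_part n (Dl k l) (Dlbar k l)).
     monom_functional m = (\<lambda>\<zeta>. \<zeta> (k, l) + \<zeta> (k, l) + (b \<zeta> + b \<zeta>))"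
  proof (rule dominant_term_survives[OF ex(2) _ T p0 _ D'])
    fix p assume p: "p \<in> chart n"
    show "eval_laurent (p_part n (Dl k l) (Dlbar k l)) (point_coords n p)
       = ?uv p * (\<i> * \<epsilon> * (y p * cnj (y p))) + ?uv p * (\<i> * D p)"
      using bspec[OF ex(4) p] sum[OF p] by (simp add: algebra_simps)
  next
    interpret chart_point n p0 using p0 by unfold_locales
    show "?uv p0 * (\<i> * \<epsilon> * (y p0 * cnj (y p0))) \<noteq> 0"
      using e y(2)[OF p0] Delta_nz[OF le kl(3)] Lambda_nz[OF le kl(3)] by simp
  qed (use Q in simp)
  then show ?thesis by metis
qed

lemma ratios_nz:
  assumes "p \<in> chart n" "r + l < n" "1 \<le> l"
  shows "row_ratio n (upper_entries p) r l \<noteq> 0" "col_ratio n (upper_entries p) r l \<noteq> 0"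
  using corner_regularD[OF chart_regular[OF assms(1)]] assms
  by (auto simp: row_ratio_def col_ratio_def)

text \<open>Among the rows below the block the first one, expanded by the last row of the block, has the coefficient
\<open>row_ratio\<close> minus a coefficient of a shorter relation that does not involve row \<open>r\<close>. So the squared modulus of
\<open>row_ratio\<close> occurs. All other contributions differ from it in the weight of the row \<open>r + l\<close>, in the
weight of the row \<open>r + l - 1\<close>, or in the degree in the coordinate \<open>(k, l)\<close>.\<close>

lemma row_monomial_present:
  assumes kl: "1 \<le> l" "l < k" "k \<le> n"
  shows "\<exists>m\<in>Poly_Mapping.keys (p_part n (Dl k l) (Dlbar k l)).
     \<forall>\<zeta>. monom_functional m \<zeta> = 2 * \<zeta> (k, l) + 2 * (gap \<zeta> (k - 1) l - gap \<zeta> k l)"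
proof -
  define r where "r = n - k"
  have r: "r + l < n" "n - r = k" "n - Suc r = k - 1" using kl by (auto simp: r_def)
  define s0 where "s0 = r + l"
  define i0 where "i0 = r + l - 1"
  have si: "s0 < n" "i0 < n" "s0 \<noteq> i0" using r kl by (auto simp: s0_def i0_def)
  let ?G = upper_entries
  let ?y = "\<lambda>p. row_ratio n (?G p) r l"
  let ?E = "\<lambda>p. row_relation n (?G p) (l - 1) (Suc r) i0"
  let ?x = "\<lambda>j t p. col_coeff n (?G p) r l j t"
  let ?z = "\<lambda>s i p. row_coeff n (?G p) r l s i"
  (* excludes the weights of the squared modulus of row_ratio *)
  define Q where "Q a \<longleftrightarrow> \<not> (a (row_weight n s0) = 2 \<and> a (row_weight n i0) = -2 \<and> a (unit_weight k l) = -2)" for a :: "(idx \<Rightarrow> real) \<Rightarrow> real"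
  let ?b = "\<lambda>\<zeta>. gap \<zeta> (n - Suc r) l - gap \<zeta> (n - r) l"
  have b: "?b (row_weight n s0) = 1" "?b (row_weight n i0) = -1" "?b (unit_weight k l) = -1"
    using row_ratio_class[OF r(1) kl(1)] si kl r unfolding row_class_def
    by (auto simp: kronecker_def s0_def i0_def gap_unit_weight)
  have y: "laurent_weights n ((=) ?b) ?y" by (rule laurent_weights_row_ratio) (use r kl in auto)
  have E: "laurent_weights n (row_class n (Suc r) s0 i0) ?E"
  proof (cases "l = 1")
    case True
    then show ?thesis by (simp add: i0_def)
  next
    case False
    have "laurent_weights n (row_class n (Suc r) (Suc r + (l - 1)) i0) ?E"
      by (rule row_relation_laurent) (use False kl r in \<open>auto simp: i0_def\<close>)
    then show ?thesis using kl by (simp add: s0_def)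
  qed
  have zy: "?z s0 i0 p = ?y p - ?E p" if "p \<in> chart n" for p
  proof -
    obtain m where m: "l = Suc m" using kl by (cases l) auto
    have "?z s0 i0 p = - row_relation n (?G p) l r i0"
      unfolding s0_def using r kl chart_regular[OF that] by (intro row_coeff_first_below) (auto simp: i0_def)
    also have "\<dots> = ?y p - ?E p" by (simp add: m i0_def row_relation_top)
    finally show ?thesis .
  qed
  define D where "D p = (\<Sum>j\<in>{n-l..<n}. \<Sum>t<n-l. ?x j t p * cnj (?x j t p))
      - (\<Sum>i\<in>{r..<r+l}. \<Sum>s\<in>{r+l..<n}. ?z s i p * cnj (?z s i p) - (if i = i0 \<and> s = s0 then ?y p * cnj (?y p) else 0))" for p
  have msum: "mixed_sum n k l k l p = (-1) * (?y p * cnj (?y p)) + D p" for p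
  proof -
    have "(\<Sum>i\<in>{r..<r+l}. \<Sum>s\<in>{r+l..<n}. if i = i0 \<and> s = s0 then ?y p * cnj (?y p) else 0) = ?y p * cnj (?y p)"
      using r kl by (intro sum_sum_single) (auto simp: i0_def s0_def)
    then show ?thesis unfolding mixed_sum_def D_def r_def[symmetric] by (simp add: sum_subtractf)
  qed
  have DQ: "laurent_weights n Q D"
  proof -
    have C: "laurent_weights n Q (\<lambda>p. ?x j t p * cnj (?x j t p))" if "j \<in> {n-l..<n}" "t < n - l" for j t
      using that r si
      by (intro laurent_weights_mult_cnj[OF col_coeff_laurent col_coeff_laurent]) (auto simp: col_class_def Q_def)
    have R: "laurent_weights n Q (\<lambda>p. ?z s i p * cnj (?z s i p) - (if i = i0 \<and> s = s0 then ?y p * cnj (?y p) else 0))"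
      if iseg: "i \<in> {r..<r+l}" "s \<in> {r+l..<n}" for i s
    proof (cases "i = i0 \<and> s = s0")
      case False
      have "laurent_weights n Q (\<lambda>p. ?z s i p * cnj (?z s i p))"
        using iseg False si
        by (intro laurent_weights_mult_cnj[OF row_coeff_laurent row_coeff_laurent])
           (auto simp: row_class_def Q_def kronecker_def s0_def i0_def)
      then show ?thesis using False by (rule_tac laurent_weights_mono) auto
    next
      case True
      have u: "a (unit_weight k l) = 0" if "row_class n (Suc r) s0 i0 a" for a
        using that r kl by (auto simp: row_class_def)
      have 1: "laurent_weights n Q (\<lambda>p. ?E p * cnj (?E p))"
        by (rule laurent_weights_mult_cnj[OF E E]) (auto simp: Q_def u)
      have 2: "laurent_weights n Q (\<lambda>p. ?E p * cnj (?y p))"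
        by (rule laurent_weights_mult_cnj[OF E y]) (use b(3) in \<open>auto simp: Q_def u\<close>)
      have 3: "laurent_weights n Q (\<lambda>p. ?y p * cnj (?E p))"
        by (rule laurent_weights_mult_cnj[OF y E]) (use b(3) in \<open>auto simp: Q_def u\<close>)
      show ?thesis
        by (rule laurent_weights_mono[OF laurent_weights_diff[OF 1 laurent_weights_add[OF 2 3]]])
           (use True in \<open>auto simp: zy algebra_simps\<close>)
    qed
    show ?thesis unfolding D_def[abs_def]
      by (rule laurent_weights_diff; rule laurent_weights_sum; rule laurent_weights_sum)
         (rule C, simp, simp, rule R, simp, simp)
  qed
  have "\<exists>m\<in>Poly_Mapping.keys (p_part n (Dl k l) (Dlbar k l)).
     \<forall>\<zeta>. monom_functional m \<zeta> = \<zeta> (k, l) + \<zeta> (k, l) + (?b \<zeta> + ?b \<zeta>)"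
    by (rule p_part_monomial[OF kl msum _ y _ DQ]) (use ratios_nz r kl b in \<open>auto simp: Q_def\<close>)
  then show ?thesis by (simp add: r algebra_simps)
qed

text \<open>The same argument for the first column left of the block, expanded by the leftmost column of the block.\<close>

lemma col_monomial_present:
  assumes kl: "1 \<le> l" "l < k" "k \<le> n"
  shows "\<exists>m\<in>Poly_Mapping.keys (p_part n (Dl k l) (Dlbar k l)).
     \<forall>\<zeta>. monom_functional m \<zeta> = 2 * \<zeta> (k, l) + 2 * (gap \<zeta> k (Suc l) - gap \<zeta> (k - 1) l)"
proof -
  define r where "r = n - k"
  have r: "r + l < n" "n - r = k" "n - Suc r = k - 1" using kl by (auto simp: r_def)
  define t0 where "t0 = n - Suc l"
  define j0 where "j0 = n - l"
  have tj: "t0 < n" "j0 < n" "t0 \<noteq> j0" using r kl by (auto simp: t0_def j0_def)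
  let ?G = upper_entries
  let ?y = "\<lambda>p. col_ratio n (?G p) r l"
  let ?E = "\<lambda>p. col_coeff n (?G p) (Suc r) l j0 t0"
  let ?x = "\<lambda>j t p. col_coeff n (?G p) r l j t"
  let ?z = "\<lambda>s i p. row_coeff n (?G p) r l s i"
  (* excludes the weights of the squared modulus of col_ratio *)
  define Q where "Q a \<longleftrightarrow> \<not> (a (col_weight n t0) = 2 \<and> a (col_weight n j0) = -2 \<and> a (unit_weight k l) = -2)" for a :: "(idx \<Rightarrow> real) \<Rightarrow> real"
  let ?b = "\<lambda>\<zeta>. gap \<zeta> (n - r) (Suc l) - gap \<zeta> (n - Suc r) l"
  have b: "?b (col_weight n t0) = 1" "?b (col_weight n j0) = -1" "?b (unit_weight k l) = -1"
    using col_ratio_class[OF r(1) kl(1)] tj kl r unfolding col_class_def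
    by (auto simp: kronecker_def t0_def j0_def gap_unit_weight)
  have y: "laurent_weights n ((=) ?b) ?y" by (rule laurent_weights_col_ratio) (use r kl in auto)
  have E: "laurent_weights n (col_class n (Suc r) t0 j0) ?E"
    unfolding t0_def by (rule col_coeff_laurent) (use kl r in \<open>auto simp: j0_def\<close>)
  have xy: "?x j0 t0 p = ?y p + ?E p" if "p \<in> chart n" for p
    using col_coeff_shift[OF chart_regular[OF that], of l r j0] r kl tj
    by (simp add: t0_def j0_def kernel_coeff_def)
  define D where "D p = (\<Sum>j\<in>{n-l..<n}. \<Sum>t<n-l. ?x j t p * cnj (?x j t p) - (if j = j0 \<and> t = t0 then ?y p * cnj (?y p) else 0))
      - (\<Sum>i\<in>{r..<r+l}. \<Sum>s\<in>{r+l..<n}. ?z s i p * cnj (?z s i p))" for p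
  have msum: "mixed_sum n k l k l p = 1 * (?y p * cnj (?y p)) + D p" for p
  proof -
    have "(\<Sum>j\<in>{n-l..<n}. \<Sum>t<n-l. if j = j0 \<and> t = t0 then ?y p * cnj (?y p) else 0) = ?y p * cnj (?y p)"
      using r kl by (intro sum_sum_single) (auto simp: t0_def j0_def)
    then show ?thesis unfolding mixed_sum_def D_def r_def[symmetric] by (simp add: sum_subtractf)
  qed
  have DQ: "laurent_weights n Q D"
  proof -
    have R: "laurent_weights n Q (\<lambda>p. ?z s i p * cnj (?z s i p))" if "i \<in> {r..<r+l}" "s \<in> {r+l..<n}" for i s
      using that r tj
      by (intro laurent_weights_mult_cnj[OF row_coeff_laurent row_coeff_laurent]) (auto simp: row_class_def Q_def)
    have C: "laurent_weights n Q (\<lambda>p. ?x j t p * cnj (?x j t p) - (if j = j0 \<and> t = t0 then ?y p * cnj (?y p) else 0))"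
      if jt: "j \<in> {n-l..<n}" "t < n - l" for j t
    proof (cases "j = j0 \<and> t = t0")
      case False
      have "laurent_weights n Q (\<lambda>p. ?x j t p * cnj (?x j t p))"
        using jt False tj r
        by (intro laurent_weights_mult_cnj[OF col_coeff_laurent col_coeff_laurent])
           (auto simp: col_class_def Q_def kronecker_def t0_def j0_def)
      then show ?thesis using False by (rule_tac laurent_weights_mono) auto
    next
      case True
      have u: "a (unit_weight k l) = 0" if "col_class n (Suc r) t0 j0 a" for a
        using that r kl by (auto simp: col_class_def)
      have 1: "laurent_weights n Q (\<lambda>p. ?E p * cnj (?E p))"
        by (rule laurent_weights_mult_cnj[OF E E]) (auto simp: Q_def u)
      have 2: "laurent_weights n Q (\<lambda>p. ?E p * cnj (?y p))"
        by (rule laurent_weights_mult_cnj[OF E y]) (use b(3) in \<open>auto simp: Q_def u\<close>)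
      have 3: "laurent_weights n Q (\<lambda>p. ?y p * cnj (?E p))"
        by (rule laurent_weights_mult_cnj[OF y E]) (use b(3) in \<open>auto simp: Q_def u\<close>)
      show ?thesis
        by (rule laurent_weights_mono[OF laurent_weights_add[OF 1 laurent_weights_add[OF 2 3]]])
           (use True in \<open>auto simp: xy algebra_simps\<close>)
    qed
    show ?thesis unfolding D_def[abs_def]
      by (rule laurent_weights_diff; rule laurent_weights_sum; rule laurent_weights_sum)
         (rule C, simp, simp, rule R, simp, simp)
  qed
  have "\<exists>m\<in>Poly_Mapping.keys (p_part n (Dl k l) (Dlbar k l)).
     \<forall>\<zeta>. monom_functional m \<zeta> = \<zeta> (k, l) + \<zeta> (k, l) + (?b \<zeta> + ?b \<zeta>)"
    by (rule p_part_monomial[OF kl msum _ y _ DQ]) (use ratios_nz r kl b in \<open>auto simp: Q_def\<close>)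
  then show ?thesis by (simp add: r algebra_simps)
qed

text \<open>The interlacing cone is contained in the tropical one because all coefficients are tropically negative on it; the
other inclusion uses only the brackets of the coordinates with their own conjugates.\<close>

lemma trop_cone_interlacing: "trop_cone n = (tri n \<rightarrow>\<^sub>E UNIV) \<inter> interlacing n"
proof (intro equalityI subsetI IntI)
  fix \<zeta> assume z: "\<zeta> \<in> trop_cone n"
  show "\<zeta> \<in> tri n \<rightarrow>\<^sub>E UNIV" using z by (simp add: trop_cone_def)
  have *: "monom_functional m \<zeta> < 2 * \<zeta> (k, l)"
    if "1 \<le> l" "l < k" "k \<le> n" "m \<in> Poly_Mapping.keys (p_part n (Dl k l) (Dlbar k l))" for k l m
  proof -
    have c: "Dl k l \<in> coords n" "Dlbar k l \<in> coords n" using that by (auto simp: coords_def)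
    then have "monom_functional (prod_monom (Dl k l) (Dlbar k l)) \<zeta> - monom_functional m \<zeta> > 0"
      using z that(4) unfolding trop_cone_def by blast
    then show ?thesis using prod_monom_functional[OF c] by simp
  qed
  show "\<zeta> \<in> interlacing n"
    unfolding interlacing_def
  proof (intro CollectI ballI conjI)
    fix k l assume "k \<in> {2..n}" "l \<in> {1..k - 1}"
    then have kl: "1 \<le> l" "l < k" "k \<le> n" by auto
    show "gap \<zeta> (k - 1) l < gap \<zeta> k l"
      using row_monomial_present[OF kl] *[OF kl] by fastforce
    show "gap \<zeta> k (l + 1) < gap \<zeta> (k - 1) l"
      using col_monomial_present[OF kl] *[OF kl] by fastforce
  qed
next
  fix \<zeta> assume z: "\<zeta> \<in> (tri n \<rightarrow>\<^sub>E UNIV) \<inter> interlacing n"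
  have "monom_functional (prod_monom u v) \<zeta> - monom_functional m \<zeta> > 0"
    if uv: "u \<in> coords n" "v \<in> coords n" and m: "m \<in> Poly_Mapping.keys (p_part n u v)" for u v m
  proof -
    obtain c R where "expands n u v c R" "laurent_weights n (below n u v) R"
      using expansion_exists[OF uv] by blast
    from expands_bracket(3)[OF uv this] m z show ?thesis
      by (auto simp: below_def prod_monom_functional[OF uv])
  qed
  then show "\<zeta> \<in> trop_cone n" using z by (auto simp: trop_cone_def)
qed

lemma c_coeff_Delta_Delta:
  assumes "(k, l) \<in> tri n" "(k', l') \<in> tri n"
  shows "c_coeff n (Dl k l) (Dl k' l') =
     (if k \<le> k' then 1 else - 1) * (\<i> / 2 * (of_nat (overlap n k l k' l') - of_nat (min l l')))"
proof -
  have c: "Dl k l \<in> coords n" "Dl k' l' \<in> coords n" using assms by (auto simp: coords_def tri_def)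
  show ?thesis
  proof (cases "k \<le> k'")
    case True
    then show ?thesis using expands_bracket(1)[OF c expands_Delta_Delta laurent_weights_0] assms
      by (auto simp: tri_def)
  next
    case False
    then have "expands n (Dl k l) (Dl k' l') (- (\<i> / 2 * (of_nat (overlap n k' l' k l) - of_nat (min l' l)))) (\<lambda>p. - 0)"
      using assms by (intro expands_swap expands_Delta_Delta) (auto simp: tri_def)
    from expands_bracket(1)[OF c this] show ?thesis
      using False by (simp add: overlap_commute[of n k' l'] min.commute[of l'])
  qed
qed

lemma c_coeff_Delta_Lambda:
  assumes "(k, l) \<in> tri n" "(k', l') \<in> tri n" "l' < k'"
  shows "c_coeff n (Dl k l) (Dlbar k' l') = \<i> / 2 * (of_nat (min l l') - of_nat (overlap n k l k' l'))"
proof -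
  have c: "Dl k l \<in> coords n" "Dlbar k' l' \<in> coords n" using assms by (auto simp: coords_def tri_def)
  show ?thesis
    by (rule expands_bracket(1)[OF c expands_Delta_Lambda mixed_rest_below]) (use assms in \<open>auto simp: tri_def\<close>)
qed

section \<open>Differential calculus on action-angle spaces\<close>

lemma flow_0 [simp]: "flow c 0 q = q"
  by (cases c; cases q) auto

lemma flow_add: "flow c (s + t) q = flow c s (flow c t q)"
  by (cases c; cases q) (auto simp: cis_mult[symmetric] mult_ac)

lemma flow_continuous: "continuous_on UNIV (\<lambda>z. flow c (fst z) (snd z))"
proof (cases c)
  case (Act a)
  have eq: "(\<lambda>z. flow c (fst z) (snd z)) = (\<lambda>z. ((\<lambda>i. fst (snd z) i + (if i = a then fst z else 0)), snd (snd z)))"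
    by (intro ext) (auto simp: Act fun_eq_iff split: prod.splits)
  have i: "continuous_on UNIV (\<lambda>z :: real \<times> aa_point. fst (snd z) i)" for i
    by (rule continuous_on_product_then_coordinatewise) (intro continuous_intros)
  show ?thesis unfolding eq
  proof (intro continuous_on_Pair continuous_on_coordinatewise_then_product continuous_on_add i)
    fix i show "continuous_on UNIV (\<lambda>z :: real \<times> aa_point. if i = a then fst z else 0)"
      by (cases "i = a") (auto intro!: continuous_intros)
  qed (rule continuous_on_product_then_coordinatewise, intro continuous_intros)
next
  case (Ang b)
  have eq: "(\<lambda>z. flow c (fst z) (snd z)) = (\<lambda>z. (fst (snd z), (\<lambda>i. snd (snd z) i * (if i = b then cis (fst z) else 1))))"
    by (intro ext) (auto simp: Ang fun_eq_iff split: prod.splits)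
  have i: "continuous_on UNIV (\<lambda>z :: real \<times> aa_point. snd (snd z) i)" for i
    by (rule continuous_on_product_then_coordinatewise) (intro continuous_intros)
  have c: "continuous_on UNIV (\<lambda>z :: real \<times> aa_point. cis (fst z))"
    by (auto simp: cis_conv_exp intro!: continuous_intros)
  show ?thesis unfolding eq
  proof (intro continuous_on_Pair continuous_on_coordinatewise_then_product continuous_on_mult i)
    fix i show "continuous_on UNIV (\<lambda>z :: real \<times> aa_point. if i = b then cis (fst z) else 1)"
      using c by (cases "i = b") auto
  qed (rule continuous_on_product_then_coordinatewise, intro continuous_intros)
qed

lemma flow_tendsto:
  assumes "(f \<longlongrightarrow> t) F" "(g \<longlongrightarrow> q) F"
  shows "((\<lambda>x. flow c (f x) (g x)) \<longlongrightarrow> flow c t q) F"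
proof -
  have "isCont (\<lambda>z. flow c (fst z) (snd z)) (t, q)"
    using flow_continuous continuous_on_eq_continuous_at[OF open_UNIV] by blast
  from isCont_tendsto_compose[OF this tendsto_Pair[OF assms]] show ?thesis by simp
qed

text \<open>The base is open relative to the real coordinate space indexed by \<open>acts S\<close>, which is itself not open in the
space of all functions on index pairs.\<close>

definition open_base :: "aa_space \<Rightarrow> bool" where
  "open_base S \<longleftrightarrow> (\<exists>U. open U \<and> base S = (acts S \<rightarrow>\<^sub>E UNIV) \<inter> U)"

lemma flow_frame:
  assumes "c \<in> axes S" "q \<in> (acts S \<rightarrow>\<^sub>E UNIV) \<times> torus (angs S)"
  shows "flow c t q \<in> (acts S \<rightarrow>\<^sub>E UNIV) \<times> torus (angs S)"
  using assms by (cases q) (auto simp: axes_def torus_def PiE_iff extensional_def norm_mult)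

text \<open>The frame condition takes care of the indices outside \<open>acts S\<close> and \<open>angs S\<close>; the remaining condition is open.\<close>

lemma eventually_points:
  assumes S: "open_base S" and q: "q \<in> points S"
    and lim: "(g \<longlongrightarrow> q) F" and frame: "eventually (\<lambda>x. g x \<in> (acts S \<rightarrow>\<^sub>E UNIV) \<times> torus (angs S)) F"
  shows "eventually (\<lambda>x. g x \<in> points S) F"
proof -
  obtain U where U: "open U" "base S = (acts S \<rightarrow>\<^sub>E UNIV) \<inter> U" using S by (auto simp: open_base_def)
  have "open (U \<times> (UNIV :: (idx \<Rightarrow> complex) set))" using U(1) by (intro open_Times) auto
  moreover have "q \<in> U \<times> UNIV" using q U by (auto simp: points_def)
  ultimately have "eventually (\<lambda>x. g x \<in> U \<times> UNIV) F" using lim by (auto dest: topological_tendstoD)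
  with frame show ?thesis by eventually_elim (auto simp: points_def U)
qed

lemma points_frame: "open_base S \<Longrightarrow> q \<in> points S \<Longrightarrow> q \<in> (acts S \<rightarrow>\<^sub>E UNIV) \<times> torus (angs S)"
  by (auto simp: open_base_def points_def)

lemma flow_eventually_points:
  assumes "open_base S" "c \<in> axes S" "q \<in> points S"
  shows "eventually (\<lambda>t. flow c t q \<in> points S) (nhds 0)"
proof (rule eventually_points[OF assms(1,3)])
  have "((\<lambda>t. flow c t q) \<longlongrightarrow> flow c 0 q) (nhds 0)"
    by (intro flow_tendsto tendsto_const filterlim_ident)
  then show "((\<lambda>t. flow c t q) \<longlongrightarrow> q) (nhds 0)" by simp
  show "\<forall>\<^sub>F t in nhds 0. flow c t q \<in> (acts S \<rightarrow>\<^sub>E UNIV) \<times> torus (angs S)"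
    by (intro always_eventually allI flow_frame assms points_frame)
qed

lemma iterated_axis_deriv_cong:
  assumes S: "open_base S" and eq: "\<And>p. p \<in> points S \<Longrightarrow> h p = h' p"
    and cs: "set cs \<subseteq> axes S" and p: "p \<in> points S"
  shows "foldr axis_deriv cs h p = foldr axis_deriv cs h' p"
  using cs p
proof (induction cs arbitrary: p)
  case (Cons c cs)
  have "eventually (\<lambda>t. flow c t p \<in> points S) (nhds 0)"
    using Cons.prems S by (intro flow_eventually_points) auto
  then have "eventually (\<lambda>t. foldr axis_deriv cs h (flow c t p) = foldr axis_deriv cs h' (flow c t p)) (nhds 0)"
    by eventually_elim (use Cons in auto)
  then have "vector_derivative (\<lambda>t. foldr axis_deriv cs h (flow c t p)) (at 0)
      = vector_derivative (\<lambda>t. foldr axis_deriv cs h' (flow c t p)) (at 0)"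
    by (intro vector_derivative_cong_eq) (auto elim: eventually_mono)
  then show ?case by (simp only: foldr.simps o_apply axis_deriv_def[of c])
qed (use eq in auto)

lemma smooth_fun_cong:
  assumes S: "open_base S" and eq: "\<And>p. p \<in> points S \<Longrightarrow> h p = h' p" and h: "smooth_fun S h"
  shows "smooth_fun S h'"
  unfolding smooth_fun_def
proof (intro allI impI conjI ballI)
  fix cs assume cs: "set cs \<subseteq> axes S"
  note c = iterated_axis_deriv_cong[OF S eq cs]
  have "continuous_on (points S) (foldr axis_deriv cs h)" using h cs by (auto simp: smooth_fun_def)
  then show "continuous_on (points S) (foldr axis_deriv cs h')"
    by (rule continuous_on_eq) (use c in auto)
  fix d p assume d: "d \<in> axes S" and p: "p \<in> points S"
  have "(\<lambda>t. foldr axis_deriv cs h (flow d t p)) differentiable (at 0)" using h cs d p by (auto simp: smooth_fun_def)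
  then obtain D where D: "((\<lambda>t. foldr axis_deriv cs h (flow d t p)) has_derivative D) (at 0)"
    by (auto simp: differentiable_def)
  have ev: "eventually (\<lambda>t. foldr axis_deriv cs h (flow d t p) = foldr axis_deriv cs h' (flow d t p)) (at 0)"
  proof -
    have "eventually (\<lambda>t. flow d t p \<in> points S) (at 0)"
      using flow_eventually_points[OF S d p] by (auto simp: eventually_at_filter elim: eventually_mono)
    then show ?thesis by eventually_elim (use c in auto)
  qed
  have "((\<lambda>t. foldr axis_deriv cs h' (flow d t p)) has_derivative D) (at 0)"
    by (rule has_derivative_transform_eventually[OF D ev]) (use c p in auto)
  then show "(\<lambda>t. foldr axis_deriv cs h' (flow d t p)) differentiable (at 0)"
    by (auto simp: differentiable_def)
qed

text \<open>To show smoothness it suffices to find a class of functions, continuous and differentiable along the axes, that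
is closed under the derivatives along the axes.\<close>

lemma smooth_fun_coinduct:
  assumes "P h"
    and step: "\<And>h. P h \<Longrightarrow> continuous_on (points S) h \<and>
      (\<forall>c\<in>axes S. (\<forall>p\<in>points S. (\<lambda>t. h (flow c t p)) differentiable (at 0)) \<and> P (axis_deriv c h))"
  shows "smooth_fun S h"
proof -
  have "P (foldr axis_deriv cs h)" if "set cs \<subseteq> axes S" for cs
    using that by (induction cs) (use assms in auto)
  then show ?thesis unfolding smooth_fun_def using step by blast
qed

lemma smooth_linear:
  fixes w :: "idx \<Rightarrow> real"
  assumes A: "finite A"
  shows "smooth_fun S (\<lambda>p. \<Sum>a\<in>A. w a * fst p a)"
proof (rule smooth_fun_coinduct[where P = "\<lambda>h. h = (\<lambda>p. \<Sum>a\<in>A. w a * fst p a) \<or> (\<exists>k. h = (\<lambda>p. k))"])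
  fix h :: "aa_point \<Rightarrow> real"
  assume h: "h = (\<lambda>p. \<Sum>a\<in>A. w a * fst p a) \<or> (\<exists>k. h = (\<lambda>p. k))"
  have i: "continuous_on X (\<lambda>p :: aa_point. fst p a)" for X a
    by (rule continuous_on_product_then_coordinatewise) (intro continuous_intros)
  have D: "\<exists>k. \<forall>p. ((\<lambda>t. h (flow c t p)) has_vector_derivative k) (at 0)" for c
    using h
  proof (elim disjE exE)
    assume h: "h = (\<lambda>p. \<Sum>a\<in>A. w a * fst p a)"
    show ?thesis
    proof (cases c)
      case (Act b)
      have "((\<lambda>t. h (flow c t p)) has_vector_derivative (\<Sum>a\<in>A. w a * (if a = b then 1 else 0))) (at 0)" for p
      proof -
        have "((\<lambda>t. \<Sum>a\<in>A. w a * (fst p a + (if a = b then 1 else 0) * t)) has_vector_derivative (\<Sum>a\<in>A. w a * (if a = b then 1 else 0))) (at 0)"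
          unfolding has_real_derivative_iff_has_vector_derivative[symmetric]
          by (auto intro!: derivative_eq_intros sum.cong simp: mult.commute)
        moreover have "h (flow c t p) = (\<Sum>a\<in>A. w a * (fst p a + (if a = b then 1 else 0) * t))" for t
          unfolding h by (intro sum.cong refl) (auto simp: Act split: prod.splits, (cases p; auto)+)
        ultimately show ?thesis by simp
      qed
      then show ?thesis by blast
    next
      case (Ang b)
      have "h (flow c t p) = h p" for t p unfolding h Ang by (cases p) auto
      then show ?thesis by (auto intro!: exI[of _ 0])
    qed
  qed (auto intro!: exI[of _ 0])
  show "continuous_on (points S) h \<and>
      (\<forall>c\<in>axes S. (\<forall>p\<in>points S. (\<lambda>t. h (flow c t p)) differentiable (at 0)) \<and>
        (axis_deriv c h = (\<lambda>p. \<Sum>a\<in>A. w a * fst p a) \<or> (\<exists>k. axis_deriv c h = (\<lambda>p. k))))"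
  proof (intro conjI ballI)
    show "continuous_on (points S) h" using h by (auto intro!: continuous_intros i)
    fix c
    obtain k where k: "\<And>p. ((\<lambda>t. h (flow c t p)) has_vector_derivative k) (at 0)" using D by blast
    then show "(\<lambda>t. h (flow c t p)) differentiable (at 0)" for p
      by (metis differentiableI_vector)
    have "axis_deriv c h = (\<lambda>p. k)"
      using k by (intro ext) (simp only: axis_deriv_def vector_derivative_at)
    then show "axis_deriv c h = (\<lambda>p. \<Sum>a\<in>A. w a * fst p a) \<or> (\<exists>k. axis_deriv c h = (\<lambda>p. k))"
      by blast
  qed
qed simp

lemma prod_flow_Ang:
  assumes "finite B"
  shows "(\<Prod>i\<in>B. snd (flow (Ang b) t p) i) = (\<Prod>i\<in>B. snd p i) * cis (t * (if b \<in> B then 1 else 0))"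
proof -
  have "snd (flow (Ang b) t p) i = snd p i * (if i = b then cis t else 1)" for i by (cases p) auto
  then show ?thesis using assms by (simp add: prod.distrib)
qed

text \<open>Such a monomial is an eigenfunction of every derivative along an axis, so its iterated derivatives are multiples of
it.\<close>

lemma smooth_torus_monomial:
  assumes B: "finite B" "finite B'"
  shows "smooth_fun S (\<lambda>p. (\<Prod>b\<in>B. snd p b) * cnj (\<Prod>b\<in>B'. snd p b))"
proof -
  let ?m = "\<lambda>p :: aa_point. (\<Prod>b\<in>B. snd p b) * cnj (\<Prod>b\<in>B'. snd p b)"
  have D: "\<exists>k. \<forall>p. ((\<lambda>t. ?m (flow c t p)) has_vector_derivative k * ?m p) (at 0)" for c
  proof (cases c)
    case (Act a)
    have "?m (flow c t p) = ?m p" for t p by (cases p) (auto simp: Act)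
    then show ?thesis by (intro exI[of _ 0] allI) (simp only:, simp)
  next
    case (Ang b)
    let ?d = "(if b \<in> B then 1 else 0) - (if b \<in> B' then 1 else 0) :: real"
    have "?m (flow c t p) = cis (t * ?d) * ?m p" for t p
      unfolding Ang prod_flow_Ang[OF B(1)] prod_flow_Ang[OF B(2)]
      by (simp add: cis_cnj cis_mult algebra_simps)
    moreover have "((\<lambda>t. cis (t * ?d) * ?m p) has_vector_derivative (\<i> * of_real ?d) * ?m p) (at 0)" for p
    proof -
      have "((\<lambda>t. cis (t * ?d)) has_vector_derivative \<i> * of_real ?d) (at 0)"
      proof -
        have "((\<lambda>z. exp (\<i> * (z * of_real ?d))) has_field_derivative \<i> * of_real ?d) (at (of_real 0))"
          by (rule derivative_eq_intros refl | simp)+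
        from has_vector_derivative_real_field[OF this] show ?thesis by (simp add: cis_conv_exp)
      qed
      from has_vector_derivative_mult_left[OF this] show ?thesis .
    qed
    ultimately show ?thesis by (intro exI[of _ "\<i> * of_real ?d"] allI) (simp only:)
  qed
  have i: "continuous_on X (\<lambda>p :: aa_point. snd p b)" for X b
    by (rule continuous_on_product_then_coordinatewise) (intro continuous_intros)
  show ?thesis
  proof (rule smooth_fun_coinduct[where P = "\<lambda>h. \<exists>K. h = (\<lambda>p. K * ?m p)"])
    show "\<exists>K. ?m = (\<lambda>p. K * ?m p)" by (intro exI[of _ 1]) simp
    fix h :: "aa_point \<Rightarrow> complex" assume "\<exists>K. h = (\<lambda>p. K * ?m p)"
    then obtain K where h: "h = (\<lambda>p. K * ?m p)" by blast
    show "continuous_on (points S) h \<and>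
      (\<forall>c\<in>axes S. (\<forall>p\<in>points S. (\<lambda>t. h (flow c t p)) differentiable (at 0)) \<and> (\<exists>K. axis_deriv c h = (\<lambda>p. K * ?m p)))"
    proof (intro conjI ballI)
      show "continuous_on (points S) h" unfolding h by (intro continuous_intros continuous_on_prod i)
      fix c
      obtain k where "\<And>p. ((\<lambda>t. ?m (flow c t p)) has_vector_derivative k * ?m p) (at 0)" using D by blast
      then have k: "((\<lambda>t. h (flow c t p)) has_vector_derivative K * (k * ?m p)) (at 0)" for p
        unfolding h by (rule has_vector_derivative_mult_right)
      then show "(\<lambda>t. h (flow c t p)) differentiable (at 0)" for p
        by (metis differentiableI_vector)
      show "\<exists>K. axis_deriv c h = (\<lambda>p. K * ?m p)"
        using k by (intro exI[of _ "K * k"] ext) (simp only: axis_deriv_def vector_derivative_at mult.assoc)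
    qed
  qed
qed

text \<open>Simultaneous motion with constant speeds along several axes, carried out one axis after the other.\<close>

definition multiflow :: "(axis \<times> real) list \<Rightarrow> real \<Rightarrow> aa_point \<Rightarrow> aa_point" where
  "multiflow ds t q = foldr (\<lambda>(c, v). flow c (v * t)) ds q"

lemma multiflow_simps [simp]:
  "multiflow [] t q = q" "multiflow ((c, v) # ds) t q = flow c (v * t) (multiflow ds t q)"
  by (auto simp: multiflow_def)

lemma multiflow_tendsto:
  assumes "(f \<longlongrightarrow> 0) F"
  shows "((\<lambda>x. multiflow ds (f x) q) \<longlongrightarrow> q) F"
proof (induction ds)
  case (Cons d ds)
  obtain c v where d: "d = (c, v)" by force
  have "((\<lambda>x. flow c (v * f x) (multiflow ds (f x) q)) \<longlongrightarrow> flow c (v * 0) q) F"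
    by (intro flow_tendsto tendsto_intros assms Cons)
  then show ?case by (simp add: d)
qed simp

lemma multiflow_frame:
  assumes "fst ` set ds \<subseteq> axes S" "q \<in> (acts S \<rightarrow>\<^sub>E UNIV) \<times> torus (angs S)"
  shows "multiflow ds t q \<in> (acts S \<rightarrow>\<^sub>E UNIV) \<times> torus (angs S)"
  using assms(1)
proof (induction ds)
  case (Cons d ds)
  obtain c v where d: "d = (c, v)" by force
  show ?case unfolding d multiflow_simps by (rule flow_frame) (use Cons d in auto)
qed (use assms in auto)

lemma flow_derivative:
  fixes h :: "aa_point \<Rightarrow> real"
  assumes h: "smooth_fun S h" and c: "c \<in> axes S" and q: "flow c t q \<in> points S"
  shows "((\<lambda>s. h (flow c s q)) has_real_derivative axis_deriv c h (flow c t q)) (at t)"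
proof -
  have "(\<lambda>s. h (flow c s (flow c t q))) differentiable (at 0)"
    using h c q unfolding smooth_fun_def by (elim allE[of _ "[]"]) auto
  then have "((\<lambda>s. h (flow c s (flow c t q))) has_vector_derivative axis_deriv c h (flow c t q)) (at 0)"
    by (simp add: axis_deriv_def vector_derivative_works)
  then have "((\<lambda>s. h (flow c (s + t) q)) has_real_derivative axis_deriv c h (flow c t q)) (at 0)"
    by (simp add: flow_add has_real_derivative_iff_has_vector_derivative)
  then show ?thesis
    using DERIV_shift[of "\<lambda>s. h (flow c s q)" "axis_deriv c h (flow c t q)" 0 t] by simp
qed

lemma mean_value_from_0:
  fixes f :: "real \<Rightarrow> real"
  assumes "\<And>s. \<bar>s\<bar> \<le> \<bar>x\<bar> \<Longrightarrow> (f has_real_derivative f' s) (at s)"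
  shows "\<exists>\<xi>. \<bar>\<xi>\<bar> \<le> \<bar>x\<bar> \<and> f x - f 0 = x * f' \<xi>"
proof -
  consider "x = 0" | "x > 0" | "x < 0" by linarith
  then show ?thesis
  proof cases
    case 2
    then obtain z where "0 < z" "z < x" "f x - f 0 = (x - 0) * f' z" using MVT2[of 0 x f f'] assms by force
    then show ?thesis by (intro exI[of _ z]) auto
  next
    case 3
    then obtain z where "x < z" "z < 0" "f 0 - f x = (0 - x) * f' z" using MVT2[of x 0 f f'] assms by force
    then show ?thesis by (intro exI[of _ z]) (auto simp: algebra_simps)
  qed auto
qed

text \<open>The usual proof that continuous partial derivatives imply differentiability: the increment is split into
increments along the single axes, each of which is a partial derivative at an intermediate point, and these
points converge to \<open>q\<close>.\<close>

lemma multiflow_derivative: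
  fixes h :: "aa_point \<Rightarrow> real"
  assumes S: "open_base S" and h: "smooth_fun S h" and q: "q \<in> points S"
    and ds: "fst ` set ds \<subseteq> axes S"
  shows "((\<lambda>t. h (multiflow ds t q)) has_real_derivative (\<Sum>(c, v)\<leftarrow>ds. v * axis_deriv c h q)) (at 0)"
  using ds
proof (induction ds)
  case (Cons d ds)
  obtain c v where d: "d = (c, v)" by force
  have c: "c \<in> axes S" and ds: "fst ` set ds \<subseteq> axes S" using Cons.prems d by auto
  let ?g = "\<lambda>t. multiflow ds t q"
  note frame = points_frame[OF S q]
  define \<Delta> where "\<Delta> t = h (flow c (v * t) (?g t)) - h (?g t)" for t
  have near: "eventually (\<lambda>t. \<forall>s. \<bar>s\<bar> \<le> \<bar>v * t\<bar> \<longrightarrow> flow c s (?g t) \<in> points S) (at 0)"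
  proof -
    have "((\<lambda>z. flow c (fst z) (?g (snd z))) \<longlongrightarrow> flow c 0 q) (nhds (0, 0))"
      by (intro flow_tendsto multiflow_tendsto) (auto intro!: tendsto_eq_intros filterlim_ident simp: nhds_prod filterlim_fst filterlim_snd)
    then have "((\<lambda>z. flow c (fst z) (?g (snd z))) \<longlongrightarrow> q) (nhds (0, 0))" by simp
    then have "eventually (\<lambda>z. flow c (fst z) (?g (snd z)) \<in> points S) (nhds (0, 0))"
      by (rule eventually_points[OF S q]) (intro always_eventually allI flow_frame multiflow_frame c ds frame)
    then obtain P P' where P: "eventually P (nhds 0)" "eventually P' (nhds 0)"
      "\<And>s t. P s \<Longrightarrow> P' t \<Longrightarrow> flow c s (?g t) \<in> points S"
      unfolding nhds_prod eventually_prod_filter by auto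
    obtain e where e: "e > 0" "\<And>s. \<bar>s\<bar> < e \<Longrightarrow> P s"
      using P(1) unfolding eventually_nhds_metric by (auto simp: dist_real_def)
    have "((\<lambda>t. \<bar>v * t\<bar>) \<longlongrightarrow> \<bar>v * 0\<bar>) (at 0)" by (intro tendsto_intros)
    then have "eventually (\<lambda>t. \<bar>v * t\<bar> < e) (at 0)" using e by (intro order_tendstoD) auto
    moreover have "eventually P' (at 0)" using P(2) by (auto simp: eventually_at_filter elim: eventually_mono)
    ultimately show ?thesis by eventually_elim (use P(3) e(2) in force)
  qed
  have mvt: "eventually (\<lambda>t. \<exists>\<xi>. \<bar>\<xi>\<bar> \<le> \<bar>v * t\<bar> \<and> flow c \<xi> (?g t) \<in> points S \<and> \<Delta> t = v * t * axis_deriv c h (flow c \<xi> (?g t))) (at 0)"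
    using near
  proof eventually_elim
    case (elim t)
    have "\<exists>\<xi>. \<bar>\<xi>\<bar> \<le> \<bar>v * t\<bar> \<and> h (flow c (v * t) (?g t)) - h (flow c 0 (?g t)) = v * t * axis_deriv c h (flow c \<xi> (?g t))"
      using elim by (intro mean_value_from_0 flow_derivative[OF h c]) auto
    then show ?case using elim by (auto simp: \<Delta>_def)
  qed
  define \<xi> where "\<xi> t = (SOME \<xi>. \<bar>\<xi>\<bar> \<le> \<bar>v * t\<bar> \<and> flow c \<xi> (?g t) \<in> points S \<and> \<Delta> t = v * t * axis_deriv c h (flow c \<xi> (?g t)))" for t
  have xi: "eventually (\<lambda>t. \<bar>\<xi> t\<bar> \<le> \<bar>v * t\<bar> \<and> flow c (\<xi> t) (?g t) \<in> points S \<and> \<Delta> t = v * t * axis_deriv c h (flow c (\<xi> t) (?g t))) (at 0)"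
    using mvt
  proof eventually_elim
    case (elim t)
    then show ?case unfolding \<xi>_def by (rule someI_ex)
  qed
  have xi0: "(\<xi> \<longlongrightarrow> 0) (at 0)"
  proof (rule Lim_null_comparison)
    show "eventually (\<lambda>t. norm (\<xi> t) \<le> \<bar>v * t\<bar>) (at 0)" using xi by eventually_elim auto
    have "((\<lambda>t. \<bar>v * t\<bar>) \<longlongrightarrow> \<bar>v * 0\<bar>) (at 0)" by (intro tendsto_intros)
    then show "((\<lambda>t. \<bar>v * t\<bar>) \<longlongrightarrow> 0) (at 0)" by simp
  qed
  have "((\<lambda>t. flow c (\<xi> t) (?g t)) \<longlongrightarrow> flow c 0 q) (at 0)"
    by (intro flow_tendsto multiflow_tendsto xi0) (rule tendsto_ident_at)
  then have lim: "((\<lambda>t. axis_deriv c h (flow c (\<xi> t) (?g t))) \<longlongrightarrow> axis_deriv c h q) (at 0)"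
  proof (intro continuous_on_tendsto_compose[of "points S" "axis_deriv c h"])
    show "continuous_on (points S) (axis_deriv c h)"
      using h c unfolding smooth_fun_def by (elim allE[of _ "[c]"]) auto
    show "\<forall>\<^sub>F t in at 0. flow c (\<xi> t) (?g t) \<in> points S" using xi by eventually_elim auto
  qed (use q in auto)
  have "(\<Delta> has_real_derivative v * axis_deriv c h q) (at 0)"
    unfolding has_field_derivative_iff
  proof (rule Lim_transform_eventually)
    show "((\<lambda>t. v * axis_deriv c h (flow c (\<xi> t) (?g t))) \<longlongrightarrow> v * axis_deriv c h q) (at 0)"
      by (intro tendsto_intros lim)
    have 0: "\<Delta> 0 = 0" by (simp add: \<Delta>_def)
    have "eventually (\<lambda>t. t \<noteq> 0) (at (0::real))" by (simp add: eventually_at_filter)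
    with xi show "\<forall>\<^sub>F t in at 0. v * axis_deriv c h (flow c (\<xi> t) (?g t)) = (\<Delta> t - \<Delta> 0) / (t - 0)"
      by eventually_elim (simp add: 0)
  qed
  from DERIV_add[OF this Cons.IH[OF ds]] show ?case by (simp add: d \<Delta>_def)
qed simp

text \<open>In the flow coordinates the maps between action-angle spaces considered below are affine, so they carry a single
flow to a multiflow.\<close>

lemma chain_rule:
  fixes h :: "aa_point \<Rightarrow> real"
  assumes "open_base T" "smooth_fun T h" "F p \<in> points T" "fst ` set ds \<subseteq> axes T"
    and "\<And>t. F (flow c t p) = multiflow ds t (F p)"
  shows "axis_deriv c (h \<circ> F) p = (\<Sum>(d, v)\<leftarrow>ds. v * axis_deriv d h (F p))"
  using multiflow_derivative[OF assms(1-4)] assms(5)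
  by (simp add: axis_deriv_def has_real_derivative_iff_has_vector_derivative vector_derivative_at o_def)

lemma multiflow_Act:
  assumes "distinct as"
  shows "multiflow (map (\<lambda>a. (Act a, v)) as) t (x, w) = (\<lambda>i. if i \<in> set as then x i + v * t else x i, w)"
  using assms by (induction as) (auto simp: fun_eq_iff)

lemma multiflow_Ang:
  assumes "distinct bs"
  shows "multiflow (map (\<lambda>b. (Ang b, v)) bs) t (x, w) = (x, \<lambda>i. if i \<in> set bs then w i * cis (v * t) else w i)"
  using assms by (induction bs) (auto simp: fun_eq_iff)

lemma aa_bracket_pairing:
  assumes "finite (acts S)" "finite (angs S)"
  shows "aa_bracket S h k p = (\<Sum>a\<in>acts S. \<Sum>b\<in>angs S. pairing S a b *
     (axis_deriv (Act a) h p * axis_deriv (Ang b) k p - axis_deriv (Ang b) h p * axis_deriv (Act a) k p))"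
proof -
  have axes: "(\<Sum>c\<in>axes S. f c) = (\<Sum>a\<in>acts S. f (Act a)) + (\<Sum>b\<in>angs S. f (Ang b))" for f :: "axis \<Rightarrow> real"
    unfolding axes_def using assms by (subst sum.union_disjoint) (auto simp: sum.reindex inj_on_def)
  have "aa_bracket S h k p = (\<Sum>a\<in>acts S. \<Sum>b\<in>angs S. pairing S a b * axis_deriv (Act a) h p * axis_deriv (Ang b) k p)
      + (\<Sum>b\<in>angs S. \<Sum>a\<in>acts S. - pairing S a b * axis_deriv (Ang b) h p * axis_deriv (Act a) k p)"
    unfolding aa_bracket_def axes by simp
  also have "(\<Sum>b\<in>angs S. \<Sum>a\<in>acts S. - pairing S a b * axis_deriv (Ang b) h p * axis_deriv (Act a) k p)
      = (\<Sum>a\<in>acts S. \<Sum>b\<in>angs S. - pairing S a b * axis_deriv (Ang b) h p * axis_deriv (Act a) k p)"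
    by (rule sum.swap)
  finally show ?thesis by (simp add: sum.distrib[symmetric] algebra_simps)
qed

section \<open>The isomorphism with the Gelfand-Zeitlin system\<close>

lemma finite_tri [simp]: "finite (tri n)"
  by (rule finite_subset[of _ "{..n} \<times> {..n}"]) (auto simp: tri_def)

lemma space_simps [simp]:
  "acts (trop_space n) = tri n" "acts (GZ_space n) = tri n"
  "base (trop_space n) = trop_cone n" "base (GZ_space n) = GZ_cone n"
  "angs (trop_space n) = {(k, l). 1 \<le> l \<and> l < k \<and> k \<le> n}"
  "angs (GZ_space n) = {(k, l). 1 \<le> l \<and> l \<le> k \<and> k \<le> n - 1}"
  by (simp_all add: trop_space_def GZ_space_def)

text \<open>In terms of \<open>y\<close> and \<open>x - y\<close> this is the box \<open>1 \<le> y \<le> q\<close>, \<open>0 \<le> x - y < p - q\<close>. The form chosen here avoids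
subtraction of natural numbers.\<close>

definition angle_set :: "idx \<Rightarrow> idx set" where
  "angle_set = (\<lambda>(p, q). {(x, y). 1 \<le> y \<and> y \<le> x \<and> x < p \<and> y \<le> q \<and> x + q < y + p})"

lemma finite_angle_set [simp]: "finite (angle_set b)"
  by (rule finite_subset[of _ "{..fst b} \<times> {..fst b}"]) (auto simp: angle_set_def)

lemma finite_angs [simp]: "finite (angs (trop_space n))" "finite (angs (GZ_space n))"
  by (rule finite_subset[of _ "{..n} \<times> {..n}"], auto)+

lemma angle_set_angs: "b \<in> angs (trop_space n) \<Longrightarrow> angle_set b \<subseteq> angs (GZ_space n)"
  by (auto simp: angle_set_def)

text \<open>If the block of \<open>(p, q)\<close> starts above that of \<open>(k, l)\<close>, the two constant terms add up and give minus one half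
of \<open>min l q\<close> minus the number of common rows, which counts the points of the box. Otherwise they cancel or vanish.\<close>

lemma trop_pairing:
  assumes a: "(k, l) \<in> tri n" and b: "(p, q) \<in> angs (trop_space n)"
  shows "pairing (trop_space n) (k, l) (p, q) = - real (card {c \<in> angle_set (p, q). fst c = k \<and> snd c \<le> l}) / 2"
proof -
  have b': "(p, q) \<in> tri n" "q < p" using b by (auto simp: tri_def)
  have P: "pairing (trop_space n) (k, l) (p, q) = (if k \<le> p then (real (overlap n k l p q) - real (min l q)) / 2 else 0)"
  proof -
    have I: "Im (\<i> / 2 * (of_nat x - of_nat y)) = (real x - real y) / 2" for x y by simp
    show ?thesis
      unfolding trop_space_def
      by (cases "k \<le> p") (simp_all add: c_coeff_Delta_Delta[OF a b'(1)] c_coeff_Delta_Lambda[OF a b'] I field_simps)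
  qed
  show ?thesis
  proof (cases "k < p")
    case True
    have "{c \<in> angle_set (p, q). fst c = k \<and> snd c \<le> l} = Pair k ` {Suc (q + k - p)..min l q}"
      using True a by (auto simp: angle_set_def tri_def image_iff)
    then have c: "card {c \<in> angle_set (p, q). fst c = k \<and> snd c \<le> l} = min l q - (q + k - p)"
      by (simp add: card_image inj_on_def)
    have "overlap n k l p q = min (n - k + l) (n - p + q) - (n - k)"
      using True a b unfolding overlap_def by (simp add: tri_def)
    also have "\<dots> = min l (q + k - p)"
      using True a b by (auto simp: tri_def min_def)
    finally have o: "overlap n k l p q = min l (q + k - p)" .
    have "q + k - p \<le> q" using True by simp
    then have "real (min l (q + k - p)) - real (min l q) = - real (min l q - (q + k - p))"
      by (auto simp: min_def of_nat_diff)
    then show ?thesis using True by (simp add: P o c)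
  next
    case False
    then have "{c \<in> angle_set (p, q). fst c = k \<and> snd c \<le> l} = {}"
      by (auto simp: angle_set_def)
    then have "card {c \<in> angle_set (p, q). fst c = k \<and> snd c \<le> l} = 0"
      by (simp only: card.empty)
    moreover have "overlap n k l p q = min l q" if "k = p"
      using that by (simp add: overlap_def min_def)
    ultimately show ?thesis using False by (auto simp: P)
  qed
qed

text \<open>The factor \<open>1/2\<close> does not affect the homogeneous inequalities. It compensates the factor \<open>1/2\<close> in \<open>trop_pairing\<close>,
so that the angles can be transformed with integer coefficients.\<close>

definition act_map :: "nat \<Rightarrow> (idx \<Rightarrow> real) \<Rightarrow> idx \<Rightarrow> real" where
  "act_map n x = restrict (\<lambda>(k, l). (\<Sum>i=1..l. x (k, i)) / 2) (tri n)"

definition act_inv :: "nat \<Rightarrow> (idx \<Rightarrow> real) \<Rightarrow> idx \<Rightarrow> real" where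
  "act_inv n \<zeta> = restrict (\<lambda>(k, l). 2 * gap \<zeta> k l) (tri n)"

lemma gap_act_map:
  assumes "(k, l) \<in> tri n"
  shows "gap (act_map n x) k l = x (k, l) / 2"
proof -
  obtain m where m: "l = Suc m" using assms by (cases l) (auto simp: tri_def)
  have "(k, m) \<in> tri n" if "m \<noteq> 0" using assms that m by (auto simp: tri_def)
  then show ?thesis using assms by (auto simp: gap_def pad_def act_map_def m add_divide_distrib)
qed

lemma act_inv_map:
  assumes "x \<in> tri n \<rightarrow>\<^sub>E UNIV"
  shows "act_inv n (act_map n x) = x"
proof
  fix a show "act_inv n (act_map n x) a = x a"
    using assms by (cases a, cases "a \<in> tri n") (auto simp: act_inv_def gap_act_map)
qed

lemma act_map_inv:
  assumes "\<zeta> \<in> tri n \<rightarrow>\<^sub>E UNIV"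
  shows "act_map n (act_inv n \<zeta>) = \<zeta>"
proof
  fix a :: idx
  obtain k l where a: "a = (k, l)" by force
  show "act_map n (act_inv n \<zeta>) a = \<zeta> a"
  proof (cases "a \<in> tri n")
    case True
    have "(\<Sum>i=1..l. act_inv n \<zeta> (k, i)) = (\<Sum>i=1..l. 2 * gap \<zeta> k i)"
      using True a by (intro sum.cong) (auto simp: act_inv_def tri_def)
    also have "\<dots> = 2 * (\<Sum>i=1..l. pad \<zeta> k i - pad \<zeta> k (i - 1))"
      by (simp add: gap_def sum_distrib_left)
    also have "(\<Sum>i=1..l. pad \<zeta> k i - pad \<zeta> k (i - 1)) = pad \<zeta> k l"
      by (induction l) (auto simp: pad_def[of _ _ 0])
    finally show ?thesis using True a by (auto simp: act_map_def pad_def tri_def)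
  qed (use assms in \<open>auto simp: act_map_def\<close>)
qed

lemma act_map_cone:
  assumes "x \<in> GZ_cone n"
  shows "act_map n x \<in> trop_cone n"
proof -
  have "act_map n x \<in> interlacing n"
    unfolding interlacing_def
  proof (intro CollectI ballI conjI)
    fix k l assume kl: "k \<in> {2..n}" "l \<in> {1..k - 1}"
    then have t: "(k, l) \<in> tri n" "(k - 1, l) \<in> tri n" "(k, l + 1) \<in> tri n" by (auto simp: tri_def)
    have "x (k, l) > x (k - 1, l)" "x (k - 1, l) > x (k, l + 1)" using assms kl by (auto simp: GZ_cone_def)
    then show "gap (act_map n x) (k - 1) l < gap (act_map n x) k l"
      "gap (act_map n x) k (l + 1) < gap (act_map n x) (k - 1) l"
      using t by (simp_all add: gap_act_map)
  qed
  then show ?thesis by (auto simp: trop_cone_interlacing act_map_def)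
qed

lemma act_inv_cone:
  assumes "\<zeta> \<in> trop_cone n"
  shows "act_inv n \<zeta> \<in> GZ_cone n"
proof -
  have "act_inv n \<zeta> (k, l) > act_inv n \<zeta> (k - 1, l) \<and> act_inv n \<zeta> (k - 1, l) > act_inv n \<zeta> (k, l + 1)"
    if kl: "k \<in> {2..n}" "l \<in> {1..k - 1}" for k l
  proof -
    have t: "(k, l) \<in> tri n" "(k - 1, l) \<in> tri n" "(k, l + 1) \<in> tri n" using kl by (auto simp: tri_def)
    have "gap \<zeta> (k - 1) l < gap \<zeta> k l" "gap \<zeta> k (l + 1) < gap \<zeta> (k - 1) l"
      using assms kl unfolding trop_cone_interlacing interlacing_def by blast+
    then show ?thesis using t by (simp add: act_inv_def)
  qed
  then show ?thesis by (auto simp: GZ_cone_def act_inv_def)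
qed

definition angle_prod :: "(idx \<Rightarrow> complex) \<Rightarrow> idx \<Rightarrow> complex" where
  "angle_prod w b = (\<Prod>c\<in>angle_set b. w c)"

definition ang_map :: "nat \<Rightarrow> (idx \<Rightarrow> complex) \<Rightarrow> idx \<Rightarrow> complex" where
  "ang_map n w = restrict (angle_prod w) (angs (trop_space n))"

definition below_diagonal :: "idx set" where
  "below_diagonal = {(p, q). 1 \<le> q \<and> q < p}"

text \<open>The inclusion-exclusion inverse of \<open>ang_map\<close>, with conjugates as inverses on the unit circle. The product over an
empty box is \<open>1\<close>, which is why indices that are not below the diagonal are left out.\<close>

definition ang_inv :: "nat \<Rightarrow> (idx \<Rightarrow> complex) \<Rightarrow> idx \<Rightarrow> complex" where
  "ang_inv n \<phi> = restrict (\<lambda>(k, l). (\<Prod>b\<in>{(k+1, l), (k-1, l-1)} \<inter> below_diagonal. \<phi> b) *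
     cnj (\<Prod>b\<in>{(k, l-1), (k, l)} \<inter> below_diagonal. \<phi> b)) (angs (GZ_space n))"

lemma ang_inv_apply:
  assumes "(k, l) \<in> angs (GZ_space n)"
  shows "ang_inv n \<phi> (k, l) = (\<Prod>b\<in>{(k+1, l), (k-1, l-1)} \<inter> below_diagonal. \<phi> b) *
     cnj (\<Prod>b\<in>{(k, l-1), (k, l)} \<inter> below_diagonal. \<phi> b)"
  using assms unfolding ang_inv_def by (simp only: restrict_apply if_True prod.case)

lemma angle_prod_degenerate: "b \<notin> below_diagonal \<Longrightarrow> angle_prod w b = 1"
  unfolding angle_prod_def by (intro prod.neutral) (auto simp: angle_set_def below_diagonal_def)

lemma prod_below_diagonal:
  assumes "finite B" "\<And>b. b \<in> B \<inter> below_diagonal \<Longrightarrow> \<phi> b = angle_prod w b"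
  shows "(\<Prod>b\<in>B \<inter> below_diagonal. \<phi> b) = (\<Prod>b\<in>B. angle_prod w b)"
proof -
  have "(\<Prod>b\<in>B \<inter> below_diagonal. \<phi> b) = (\<Prod>b\<in>B \<inter> below_diagonal. angle_prod w b)"
    using assms(2) by (intro prod.cong) auto
  also have "\<dots> = (\<Prod>b\<in>B. angle_prod w b)"
    using assms(1) by (intro prod.mono_neutral_left) (auto simp: angle_prod_degenerate)
  finally show ?thesis .
qed

text \<open>The box of \<open>(k+1, l)\<close> consists of its corner \<open>(k, l)\<close> and of the union of the boxes of \<open>(k, l-1)\<close> and
\<open>(k, l)\<close>, which intersect in the box of \<open>(k-1, l-1)\<close>.\<close>

lemma angle_prod_recursion:
  assumes "1 \<le> l" "l \<le> k"
  shows "angle_prod w (k+1, l) * angle_prod w (k-1, l-1) = w (k, l) * (angle_prod w (k, l-1) * angle_prod w (k, l))"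
proof -
  let ?A = "angle_set (k, l-1)" and ?B = "angle_set (k, l)"
  have I: "?A \<inter> ?B = angle_set (k-1, l-1)" using assms by (auto simp: angle_set_def)
  have U: "angle_set (k+1, l) = insert (k, l) (?A \<union> ?B)"
  proof (rule Set.set_eqI)
    fix c :: idx
    obtain x y where c: "c = (x, y)" by force
    show "c \<in> angle_set (k+1, l) \<longleftrightarrow> c \<in> insert (k, l) (?A \<union> ?B)"
      using assms unfolding c by (cases "y = l") (auto simp: angle_set_def)
  qed
  have n: "(k, l) \<notin> ?A \<union> ?B" by (auto simp: angle_set_def)
  have "angle_prod w (k+1, l) = w (k, l) * prod w (?A \<union> ?B)"
    unfolding angle_prod_def U using n by (subst prod.insert) auto
  moreover have "prod w (?A \<union> ?B) * prod w (?A \<inter> ?B) = prod w ?A * prod w ?B"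
    by (rule prod.union_inter) auto
  ultimately show ?thesis unfolding angle_prod_def I by (simp add: mult.assoc)
qed

lemma prod_norm_1: "(\<And>b. b \<in> B \<Longrightarrow> norm (f b) = 1) \<Longrightarrow> norm (prod f B) = (1::real)" for f :: "'a \<Rightarrow> complex"
  by (simp add: prod_norm[symmetric])

lemma mult_cnj_1: "norm z = 1 \<Longrightarrow> z * cnj z = 1"
  by (simp add: complex_norm_square[symmetric])

lemma ang_inv_map:
  assumes w: "w \<in> torus (angs (GZ_space n))"
  shows "ang_inv n (ang_map n w) = w"
proof
  fix a :: idx
  obtain k l where a: "a = (k, l)" by force
  show "ang_inv n (ang_map n w) a = w a"
  proof (cases "a \<in> angs (GZ_space n)")
    case True
    then have kl: "1 \<le> l" "l \<le> k" "k + 1 \<le> n" using a by auto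
    have m: "ang_map n w b = angle_prod w b" if "b \<in> {(k+1, l), (k-1, l-1), (k, l-1), (k, l)} \<inter> below_diagonal" for b
      using that kl by (auto simp: ang_map_def below_diagonal_def)
    let ?t = "angle_prod w (k, l-1) * angle_prod w (k, l)"
    have n1: "norm (angle_prod w b) = 1" if "b \<in> angs (trop_space n) \<or> b \<notin> below_diagonal" for b
      using that
    proof
      assume b: "b \<in> angs (trop_space n)"
      show ?thesis unfolding angle_prod_def
        using w angle_set_angs[OF b] by (intro prod_norm_1) (auto simp: torus_def PiE_iff)
    qed (simp add: angle_prod_degenerate)
    have "norm (angle_prod w (k, l - 1)) = 1" "norm (angle_prod w (k, l)) = 1"
      by (rule n1; use kl in \<open>auto simp: below_diagonal_def\<close>)+
    then have "norm ?t = 1" by (simp add: norm_mult)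
    have "ang_inv n (ang_map n w) a = (\<Prod>b\<in>{(k+1, l), (k-1, l-1)}. angle_prod w b) * cnj (\<Prod>b\<in>{(k, l-1), (k, l)}. angle_prod w b)"
    proof -
      have "(\<Prod>b\<in>{(k+1, l), (k-1, l-1)} \<inter> below_diagonal. ang_map n w b) = (\<Prod>b\<in>{(k+1, l), (k-1, l-1)}. angle_prod w b)"
        "(\<Prod>b\<in>{(k, l-1), (k, l)} \<inter> below_diagonal. ang_map n w b) = (\<Prod>b\<in>{(k, l-1), (k, l)}. angle_prod w b)"
        by (rule prod_below_diagonal; use m in blast)+
      then show ?thesis unfolding a ang_inv_apply[OF True[unfolded a]] by (simp only:)
    qed
    also have "\<dots> = (angle_prod w (k+1, l) * angle_prod w (k-1, l-1)) * cnj ?t"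
      using kl by simp
    also have "\<dots> = w (k, l) * (?t * cnj ?t)"
      using angle_prod_recursion[OF kl(1,2), of w] by simp
    also have "\<dots> = w a" using mult_cnj_1[OF \<open>norm ?t = 1\<close>] by (simp add: a)
    finally show ?thesis .
  next
    case False
    have "w a = undefined" using w False unfolding torus_def by (rule PiE_arb)
    then show ?thesis using False by (simp only: ang_inv_def restrict_apply if_False)
  qed
qed

text \<open>Induction on \<open>p\<close>: the definition of \<open>ang_inv\<close> solves \<open>angle_prod_recursion\<close> for the product over the largest box.\<close>

lemma angle_prod_ang_inv:
  assumes \<phi>: "\<phi> \<in> torus (angs (trop_space n))"
  shows "1 \<le> q \<Longrightarrow> q < p \<Longrightarrow> p \<le> n \<Longrightarrow> angle_prod (ang_inv n \<phi>) (p, q) = \<phi> (p, q)"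
proof (induction p arbitrary: q rule: less_induct)
  case (less p)
  let ?w = "ang_inv n \<phi>"
  define k where "k = p - 1"
  have kl: "1 \<le> q" "q \<le> k" "k + 1 \<le> n" "p = k + 1" using less.prems by (auto simp: k_def)
  have IH: "\<phi> b = angle_prod ?w b" if "b \<in> {(k, q-1), (k, q), (k-1, q-1)} \<inter> below_diagonal" for b
    using that less.IH[of "fst b" "snd b"] kl by (cases b) (auto simp: below_diagonal_def)
  let ?t = "angle_prod ?w (k, q-1) * angle_prod ?w (k, q)" and ?e = "angle_prod ?w (k-1, q-1)"
  have t: "(\<Prod>b\<in>{(k, q-1), (k, q)} \<inter> below_diagonal. \<phi> b) = ?t"
    using kl by (subst prod_below_diagonal[of _ _ ?w]) (auto intro: IH)
  have e: "(\<Prod>b\<in>{(k-1, q-1)} \<inter> below_diagonal. \<phi> b) = ?e"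
    by (subst prod_below_diagonal[of _ _ ?w]) (auto intro: IH)
  have n1: "norm (\<phi> b) = 1" if "b \<in> below_diagonal" "fst b \<le> n" for b
    using \<phi> that by (cases b) (auto simp: torus_def PiE_iff below_diagonal_def)
  have nt: "norm ?t = 1" unfolding t[symmetric] by (intro prod_norm_1 n1) (use kl in auto)
  have ne: "norm ?e = 1" unfolding e[symmetric] by (intro prod_norm_1 n1) (use kl in auto)
  have "?w (k, q) = (\<Prod>b\<in>{(k+1, q), (k-1, q-1)} \<inter> below_diagonal. \<phi> b) * cnj ?t"
    unfolding t[symmetric] by (rule ang_inv_apply) (use kl in auto)
  also have "{(k+1, q), (k-1, q-1)} \<inter> below_diagonal = insert (k+1, q) ({(k-1, q-1)} \<inter> below_diagonal)"
    using kl by (auto simp: below_diagonal_def)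
  also have "(\<Prod>b\<in>\<dots>. \<phi> b) = \<phi> (k+1, q) * ?e"
    unfolding e[symmetric] by (subst prod.insert) auto
  finally have w: "?w (k, q) = \<phi> (k+1, q) * ?e * cnj ?t" .
  have "angle_prod ?w (k+1, q) * ?e = \<phi> (k+1, q) * ?e * (?t * cnj ?t)"
    using angle_prod_recursion[OF kl(1,2), of ?w] unfolding w by (simp only: mult_ac)
  then have "angle_prod ?w (k+1, q) * ?e = \<phi> (k+1, q) * ?e" unfolding mult_cnj_1[OF nt] by (simp only: mult_1_right)
  moreover have "?e \<noteq> 0" using ne by auto
  ultimately show ?case using kl by simp
qed

lemma ang_map_inv:
  assumes \<phi>: "\<phi> \<in> torus (angs (trop_space n))"
  shows "ang_map n (ang_inv n \<phi>) = \<phi>"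
proof
  fix b :: idx
  obtain p q where b: "b = (p, q)" by force
  show "ang_map n (ang_inv n \<phi>) b = \<phi> b"
    using \<phi> angle_prod_ang_inv[OF \<phi>, of q p]
    by (cases "b \<in> angs (trop_space n)") (auto simp: ang_map_def b torus_def PiE_iff extensional_def)
qed

lemma ang_map_torus: "w \<in> torus (angs (GZ_space n)) \<Longrightarrow> ang_map n w \<in> torus (angs (trop_space n))"
  using angle_set_angs[of _ n]
  by (auto simp: ang_map_def torus_def angle_prod_def PiE_iff simp del: space_simps intro!: prod_norm_1)

lemma ang_inv_torus:
  assumes "\<phi> \<in> torus (angs (trop_space n))"
  shows "ang_inv n \<phi> \<in> torus (angs (GZ_space n))"
proof -
  have n1: "norm (\<phi> b) = 1" if "b \<in> below_diagonal" "fst b \<le> n" for b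
    using assms that by (cases b) (auto simp: torus_def PiE_iff below_diagonal_def)
  have "norm (ang_inv n \<phi> a) = 1" if a: "a \<in> angs (GZ_space n)" for a
  proof -
    obtain k l where kl: "a = (k, l)" by force
    have "norm (\<Prod>b\<in>{(k+1, l), (k-1, l-1)} \<inter> below_diagonal. \<phi> b) = 1" "norm (\<Prod>b\<in>{(k, l-1), (k, l)} \<inter> below_diagonal. \<phi> b) = 1"
      by (intro prod_norm_1 n1; use a kl in auto)+
    then show ?thesis unfolding kl ang_inv_apply[OF a[unfolded kl]] norm_mult complex_mod_cnj by (simp only: mult_1)
  qed
  moreover have "ang_inv n \<phi> \<in> extensional (angs (GZ_space n))" by (simp add: ang_inv_def)
  ultimately show ?thesis by (auto simp: torus_def PiE_iff)
qed

definition GZ_to_trop :: "nat \<Rightarrow> aa_point \<Rightarrow> aa_point" where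
  "GZ_to_trop n p = (act_map n (fst p), ang_map n (snd p))"

definition trop_to_GZ :: "nat \<Rightarrow> aa_point \<Rightarrow> aa_point" where
  "trop_to_GZ n p = (act_inv n (fst p), ang_inv n (snd p))"

lemma GZ_trop_inverse:
  "p \<in> points (GZ_space n) \<Longrightarrow> GZ_to_trop n p \<in> points (trop_space n)"
  "q \<in> points (trop_space n) \<Longrightarrow> trop_to_GZ n q \<in> points (GZ_space n)"
  "p \<in> points (GZ_space n) \<Longrightarrow> trop_to_GZ n (GZ_to_trop n p) = p"
  "q \<in> points (trop_space n) \<Longrightarrow> GZ_to_trop n (trop_to_GZ n q) = q"
proof -
  have G: "x \<in> tri n \<rightarrow>\<^sub>E UNIV" if "x \<in> GZ_cone n" for x using that by (simp add: GZ_cone_def)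
  have T: "x \<in> tri n \<rightarrow>\<^sub>E UNIV" if "x \<in> trop_cone n" for x using that by (simp add: trop_cone_def)
  show "p \<in> points (GZ_space n) \<Longrightarrow> GZ_to_trop n p \<in> points (trop_space n)"
    using act_map_cone ang_map_torus by (auto simp: points_def GZ_to_trop_def simp del: space_simps(5,6))
  show "q \<in> points (trop_space n) \<Longrightarrow> trop_to_GZ n q \<in> points (GZ_space n)"
    using act_inv_cone ang_inv_torus by (auto simp: points_def trop_to_GZ_def simp del: space_simps(5,6))
  show "p \<in> points (GZ_space n) \<Longrightarrow> trop_to_GZ n (GZ_to_trop n p) = p"
    using act_inv_map[OF G] ang_inv_map by (auto simp: points_def GZ_to_trop_def trop_to_GZ_def simp del: space_simps(5,6))
  show "q \<in> points (trop_space n) \<Longrightarrow> GZ_to_trop n (trop_to_GZ n q) = q"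
    using act_map_inv[OF T] ang_map_inv by (auto simp: points_def GZ_to_trop_def trop_to_GZ_def simp del: space_simps(5,6))
qed

lemma open_base_trop: "open_base (trop_space n)"
proof -
  have pad: "continuous_on UNIV (\<lambda>\<zeta>. pad \<zeta> k l)" for k l
    unfolding pad_def by (cases "l = 0") auto
  have gap: "continuous_on UNIV (\<lambda>\<zeta>. gap \<zeta> k l)" for k l
    unfolding gap_def by (intro continuous_intros pad)
  let ?U = "(\<Inter>k\<in>{2..n}. \<Inter>l\<in>{1..k - 1}. {\<zeta>. gap \<zeta> (k - 1) l < gap \<zeta> k l} \<inter> {\<zeta>. gap \<zeta> k (l + 1) < gap \<zeta> (k - 1) l})"
  have "open ?U" by (intro open_INT ballI open_Int open_Collect_less gap) auto
  moreover have "trop_cone n = (tri n \<rightarrow>\<^sub>E UNIV) \<inter> ?U" by (auto simp: trop_cone_interlacing interlacing_def)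
  ultimately show ?thesis by (auto simp: open_base_def simp del: INT_simps)
qed

lemma smooth_GZ_to_trop: "smooth_map (GZ_space n) (trop_space n) (GZ_to_trop n)"
  unfolding smooth_map_def
proof (intro conjI ballI)
  show "GZ_to_trop n ` points (GZ_space n) \<subseteq> points (trop_space n)" using GZ_trop_inverse(1) by auto
  fix a assume a: "a \<in> acts (trop_space n)"
  obtain k l where kl: "a = (k, l)" by force
  have "(\<Sum>c\<in>Pair k ` {1..l}. (1/2) * fst p c) = fst (GZ_to_trop n p) a" for p
    using a by (subst sum.reindex) (auto simp: inj_on_def GZ_to_trop_def act_map_def kl sum_divide_distrib)
  with smooth_linear[of "Pair k ` {1..l}" "GZ_space n" "\<lambda>_. 1/2"]
  show "smooth_fun (GZ_space n) (\<lambda>p. fst (GZ_to_trop n p) a)" by simp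
next
  fix b assume b: "b \<in> angs (trop_space n)"
  have "(\<Prod>c\<in>angle_set b. snd p c) * cnj (\<Prod>c\<in>{}. snd p c) = snd (GZ_to_trop n p) b" for p
    using b by (simp add: GZ_to_trop_def ang_map_def angle_prod_def)
  with smooth_torus_monomial[of "angle_set b" "{}" "GZ_space n"]
  show "smooth_fun (GZ_space n) (\<lambda>p. snd (GZ_to_trop n p) b)" by simp
qed

lemma smooth_trop_to_GZ: "smooth_map (trop_space n) (GZ_space n) (trop_to_GZ n)"
  unfolding smooth_map_def
proof (intro conjI ballI)
  show "trop_to_GZ n ` points (trop_space n) \<subseteq> points (GZ_space n)" using GZ_trop_inverse(2) by auto
  fix a assume a: "a \<in> acts (GZ_space n)"
  obtain k l where kl: "a = (k, l)" by force
  let ?A = "if l = 1 then {(k, l)} else {(k, l), (k, l - 1)}"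
  have "(\<Sum>c\<in>?A. (if c = (k, l) then 2 else - 2) * fst p c) = fst (trop_to_GZ n p) a" for p
    using a by (auto simp: trop_to_GZ_def act_inv_def kl gap_def pad_def tri_def)
  with smooth_linear[of ?A "trop_space n" "\<lambda>c. if c = (k, l) then 2 else - 2"]
  show "smooth_fun (trop_space n) (\<lambda>p. fst (trop_to_GZ n p) a)" by simp
next
  fix b assume b: "b \<in> angs (GZ_space n)"
  obtain k l where kl: "b = (k, l)" by force
  let ?B = "{(k+1, l), (k-1, l-1)} \<inter> below_diagonal" and ?B' = "{(k, l-1), (k, l)} \<inter> below_diagonal"
  have "(\<Prod>c\<in>?B. snd p c) * cnj (\<Prod>c\<in>?B'. snd p c) = snd (trop_to_GZ n p) b" for p
    using b unfolding trop_to_GZ_def ang_inv_def kl by simp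
  with smooth_torus_monomial[of ?B ?B' "trop_space n"]
  show "smooth_fun (trop_space n) (\<lambda>p. snd (trop_to_GZ n p) b)" by simp
qed

lemma diffeomorphism_GZ_to_trop: "diffeomorphism (GZ_space n) (trop_space n) (GZ_to_trop n)"
proof -
  have bij: "bij_betw (GZ_to_trop n) (points (GZ_space n)) (points (trop_space n))"
    by (rule bij_betw_byWitness[where f' = "trop_to_GZ n"]) (use GZ_trop_inverse in auto)
  have inv: "trop_to_GZ n q = the_inv_into (points (GZ_space n)) (GZ_to_trop n) q" if "q \<in> points (trop_space n)" for q
    using that bij GZ_trop_inverse by (intro the_inv_into_f_eq[symmetric]) (auto simp: bij_betw_def)
  have "smooth_map (trop_space n) (GZ_space n) (the_inv_into (points (GZ_space n)) (GZ_to_trop n))"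
    unfolding smooth_map_def
  proof (intro conjI ballI)
    show "the_inv_into (points (GZ_space n)) (GZ_to_trop n) ` points (trop_space n) \<subseteq> points (GZ_space n)"
      using inv GZ_trop_inverse(2) by (metis image_subsetI)
  next
    fix a assume "a \<in> acts (GZ_space n)"
    then have "smooth_fun (trop_space n) (\<lambda>p. fst (trop_to_GZ n p) a)" using smooth_trop_to_GZ by (auto simp: smooth_map_def)
    then show "smooth_fun (trop_space n) (\<lambda>p. fst (the_inv_into (points (GZ_space n)) (GZ_to_trop n) p) a)"
      by (rule smooth_fun_cong[OF open_base_trop, rotated]) (simp add: inv)
  next
    fix b assume "b \<in> angs (GZ_space n)"
    then have "smooth_fun (trop_space n) (\<lambda>p. snd (trop_to_GZ n p) b)" using smooth_trop_to_GZ unfolding smooth_map_def by blast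
    then show "smooth_fun (trop_space n) (\<lambda>p. snd (the_inv_into (points (GZ_space n)) (GZ_to_trop n) p) b)"
      by (rule smooth_fun_cong[OF open_base_trop, rotated]) (simp add: inv)
  qed
  then show ?thesis using bij smooth_GZ_to_trop by (simp add: diffeomorphism_def)
qed

lemma act_map_flow:
  assumes "a \<in> tri n" "distinct as" "set as = {a' \<in> tri n. fst a' = fst a \<and> snd a \<le> snd a'}"
  shows "GZ_to_trop n (flow (Act a) t p) = multiflow (map (\<lambda>a. (Act a, 1/2)) as) t (GZ_to_trop n p)"
proof -
  obtain k l where a: "a = (k, l)" by force
  have "act_map n ((fst p)(a := fst p a + t)) a' = (if a' \<in> set as then act_map n (fst p) a' + 1/2 * t else act_map n (fst p) a')" for a'
  proof (cases "a' \<in> tri n")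
    case True
    obtain k' l' where a': "a' = (k', l')" by force
    have "(\<Sum>i=1..l'. ((fst p)(a := fst p a + t)) (k', i)) = (\<Sum>i=1..l'. fst p (k', i) + (if i = l then (if k' = k then t else 0) else 0))"
      by (intro sum.cong) (auto simp: a)
    also have "\<dots> = (\<Sum>i=1..l'. fst p (k', i)) + (if a' \<in> set as then t else 0)"
      using assms True by (auto simp: sum.distrib a a' tri_def)
    finally show ?thesis using True by (simp add: act_map_def a' add_divide_distrib)
  qed (use assms in \<open>auto simp: act_map_def\<close>)
  then show ?thesis using assms(2)
    by (cases p) (simp add: GZ_to_trop_def multiflow_Act[OF assms(2)] fun_eq_iff del: split_paired_All)
qed

lemma ang_map_flow:
  assumes "distinct bs" "set bs = {b \<in> angs (trop_space n). c \<in> angle_set b}"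
  shows "GZ_to_trop n (flow (Ang c) t p) = multiflow (map (\<lambda>b. (Ang b, 1)) bs) t (GZ_to_trop n p)"
proof -
  have "ang_map n (snd (flow (Ang c) t p)) b = (if b \<in> set bs then ang_map n (snd p) b * cis (1 * t) else ang_map n (snd p) b)" for b
    unfolding assms(2) ang_map_def angle_prod_def
    by (cases "b \<in> angs (trop_space n)") (simp_all add: prod_flow_Ang del: space_simps)
  then have "ang_map n (snd (flow (Ang c) t p)) = (\<lambda>b. if b \<in> set bs then ang_map n (snd p) b * cis (1 * t) else ang_map n (snd p) b)"
    by (intro ext)
  moreover have "fst (flow (Ang c) t p) = fst p" by (cases p) auto
  ultimately show ?thesis unfolding GZ_to_trop_def multiflow_Ang[OF assms(1)] by simp
qed

lemma deriv_act_GZ_to_trop: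
  fixes h :: "aa_point \<Rightarrow> real"
  assumes h: "smooth_fun (trop_space n) h" and p: "p \<in> points (GZ_space n)" and a: "a \<in> tri n"
  shows "axis_deriv (Act a) (h \<circ> GZ_to_trop n) p =
    (\<Sum>a'\<in>tri n. (if fst a' = fst a \<and> snd a \<le> snd a' then 1/2 else 0) * axis_deriv (Act a') h (GZ_to_trop n p))"
proof -
  let ?A = "{a' \<in> tri n. fst a' = fst a \<and> snd a \<le> snd a'}"
  have "finite ?A" by (rule finite_subset[OF _ finite_tri[of n]]) auto
  then obtain as where as: "distinct as" "set as = ?A" using finite_distinct_list by blast
  have "axis_deriv (Act a) (h \<circ> GZ_to_trop n) p = (\<Sum>(d, v)\<leftarrow>map (\<lambda>a. (Act a, 1/2)) as. v * axis_deriv d h (GZ_to_trop n p))"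
  proof (rule chain_rule[where F = "GZ_to_trop n" and p = p, OF open_base_trop h GZ_trop_inverse(1)[OF p]])
    show "fst ` set (map (\<lambda>a. (Act a, 1/2 :: real)) as) \<subseteq> axes (trop_space n)"
      using as by (auto simp: axes_def)
  qed (rule act_map_flow[OF a as])
  also have "\<dots> = (\<Sum>a'\<in>?A. 1/2 * axis_deriv (Act a') h (GZ_to_trop n p))"
    using as by (simp add: o_def sum_list_distinct_conv_sum_set)
  also have "\<dots> = (\<Sum>a'\<in>tri n. (if fst a' = fst a \<and> snd a \<le> snd a' then 1/2 else 0) * axis_deriv (Act a') h (GZ_to_trop n p))"
    by (intro sum.mono_neutral_cong_left) auto
  finally show ?thesis .
qed

lemma deriv_ang_GZ_to_trop:
  fixes h :: "aa_point \<Rightarrow> real"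
  assumes h: "smooth_fun (trop_space n) h" and p: "p \<in> points (GZ_space n)"
  shows "axis_deriv (Ang c) (h \<circ> GZ_to_trop n) p =
    (\<Sum>b\<in>angs (trop_space n). (if c \<in> angle_set b then 1 else 0) * axis_deriv (Ang b) h (GZ_to_trop n p))"
proof -
  let ?B = "{b \<in> angs (trop_space n). c \<in> angle_set b}"
  have "finite ?B" by (rule finite_subset[OF _ finite_angs(1)[of n]]) auto
  then obtain bs where bs: "distinct bs" "set bs = ?B" using finite_distinct_list by blast
  have "axis_deriv (Ang c) (h \<circ> GZ_to_trop n) p = (\<Sum>(d, v)\<leftarrow>map (\<lambda>b. (Ang b, 1)) bs. v * axis_deriv d h (GZ_to_trop n p))"
  proof (rule chain_rule[where F = "GZ_to_trop n" and p = p, OF open_base_trop h GZ_trop_inverse(1)[OF p]])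
    show "fst ` set (map (\<lambda>b. (Ang b, 1 :: real)) bs) \<subseteq> axes (trop_space n)"
      using bs by (auto simp: axes_def)
  qed (rule ang_map_flow[OF bs])
  also have "\<dots> = (\<Sum>b\<in>?B. 1 * axis_deriv (Ang b) h (GZ_to_trop n p))"
    using bs by (simp add: o_def sum_list_distinct_conv_sum_set del: space_simps)
  also have "\<dots> = (\<Sum>b\<in>angs (trop_space n). (if c \<in> angle_set b then 1 else 0) * axis_deriv (Ang b) h (GZ_to_trop n p))"
    by (intro sum.mono_neutral_cong_left finite_angs) auto
  finally show ?thesis .
qed

lemma trop_pairing_sum:
  assumes a: "a \<in> tri n" and b: "b \<in> angs (trop_space n)"
  shows "(\<Sum>c\<in>angs (GZ_space n). (if fst a = fst c \<and> snd c \<le> snd a then 1/2 else 0) * (if c \<in> angle_set b then 1 else 0))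
     = - pairing (trop_space n) a b"
proof -
  obtain k l p q where kl: "a = (k, l)" "b = (p, q)" by (metis surj_pair)
  have "(\<Sum>c\<in>angs (GZ_space n). (if fst a = fst c \<and> snd c \<le> snd a then 1/2 else 0) * (if c \<in> angle_set b then 1 else 0))
      = (\<Sum>c\<in>{c \<in> angle_set b. fst c = fst a \<and> snd c \<le> snd a}. 1/2 :: real)"
    using angle_set_angs[OF b] by (intro sum.mono_neutral_cong_right finite_angs) (auto split: if_splits simp del: space_simps)
  also have "\<dots> = - pairing (trop_space n) a b"
    using trop_pairing[of k l n p q] a b unfolding kl by (simp del: space_simps)
  finally show ?thesis .
qed

lemma skew_sum_product:
  fixes L x x' :: "'a \<Rightarrow> real" and N y y' :: "'b \<Rightarrow> real"
  shows "- ((\<Sum>a\<in>A. L a * x a) * (\<Sum>b\<in>J. N b * y' b) - (\<Sum>b\<in>J. N b * y b) * (\<Sum>a\<in>A. L a * x' a))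
     = (\<Sum>a\<in>A. \<Sum>b\<in>J. - (L a * N b) * (x a * y' b - y b * x' a))"
proof -
  have p: "(\<Sum>a\<in>A. L a * u a) * (\<Sum>b\<in>J. N b * v b) = (\<Sum>a\<in>A. \<Sum>b\<in>J. (L a * N b) * (u a * v b))" for u v
    unfolding sum_product by (simp add: mult_ac)
  show ?thesis
    unfolding mult.commute[of "\<Sum>b\<in>J. N b * y b"] p sum_subtractf[symmetric] sum_negf[symmetric]
    by (intro sum.cong refl) (simp add: algebra_simps)
qed

text \<open>Both brackets are bilinear in the derivatives, which \<open>chain_rule\<close> transforms linearly; so the claim reduces to the
identity of the structure constants in \<open>trop_pairing_sum\<close>.\<close>

lemma poisson_GZ_to_trop: "poisson_map (GZ_space n) (trop_space n) (GZ_to_trop n)"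
  unfolding poisson_map_def
proof (intro allI impI ballI)
  fix h k :: "aa_point \<Rightarrow> real" and p
  assume h: "smooth_fun (trop_space n) h" and k: "smooth_fun (trop_space n) k" and p: "p \<in> points (GZ_space n)"
  let ?F = "GZ_to_trop n" and ?I = "angs (GZ_space n)" and ?J = "angs (trop_space n)"
  define L where "L a c = (if fst a = fst c \<and> snd c \<le> snd a then 1/2 else (0::real))" for a c :: idx
  define N where "N b c = (if c \<in> angle_set b then 1 else (0::real))" for b c
  let ?dh = "\<lambda>d. axis_deriv d h (?F p)" and ?dk = "\<lambda>d. axis_deriv d k (?F p)"
  let ?w = "\<lambda>a b. ?dh (Act a) * ?dk (Ang b) - ?dh (Ang b) * ?dk (Act a)"
  have sub: "?I \<subseteq> tri n" by (auto simp: tri_def)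
  have A: "axis_deriv (Act c) (u \<circ> ?F) p = (\<Sum>a\<in>tri n. L a c * axis_deriv (Act a) u (?F p))"
    if "smooth_fun (trop_space n) u" "c \<in> ?I" for u c
    using deriv_act_GZ_to_trop[OF that(1) p] that(2) sub unfolding L_def by blast
  have B: "axis_deriv (Ang c) (u \<circ> ?F) p = (\<Sum>b\<in>?J. N b c * axis_deriv (Ang b) u (?F p))"
    if "smooth_fun (trop_space n) u" for u c
    using deriv_ang_GZ_to_trop[OF that p] unfolding N_def .
  have "aa_bracket (GZ_space n) (h \<circ> ?F) (k \<circ> ?F) p
     = (\<Sum>a\<in>tri n. \<Sum>b\<in>?I. if a = b then - (axis_deriv (Act b) (h \<circ> ?F) p * axis_deriv (Ang b) (k \<circ> ?F) p
          - axis_deriv (Ang b) (h \<circ> ?F) p * axis_deriv (Act b) (k \<circ> ?F) p) else 0)"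
    by (subst aa_bracket_pairing) (auto simp: GZ_space_def simp del: finite_angs intro!: sum.cong finite_angs(2)[unfolded GZ_space_def, simplified])
  also have "\<dots> = (\<Sum>b\<in>?I. - (axis_deriv (Act b) (h \<circ> ?F) p * axis_deriv (Ang b) (k \<circ> ?F) p
          - axis_deriv (Ang b) (h \<circ> ?F) p * axis_deriv (Act b) (k \<circ> ?F) p))"
  proof (subst sum.swap, intro sum.cong refl)
    fix b assume "b \<in> ?I"
    then show "(\<Sum>a\<in>tri n. if a = b then - (axis_deriv (Act b) (h \<circ> ?F) p * axis_deriv (Ang b) (k \<circ> ?F) p
          - axis_deriv (Ang b) (h \<circ> ?F) p * axis_deriv (Act b) (k \<circ> ?F) p) else 0)
      = - (axis_deriv (Act b) (h \<circ> ?F) p * axis_deriv (Ang b) (k \<circ> ?F) p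
          - axis_deriv (Ang b) (h \<circ> ?F) p * axis_deriv (Act b) (k \<circ> ?F) p)"
      using sub by (subst sum.delta) auto
  qed
  also have "\<dots> = (\<Sum>c\<in>?I. \<Sum>a\<in>tri n. \<Sum>b\<in>?J. - (L a c * N b c) * ?w a b)"
  proof (intro sum.cong refl)
    fix c assume c: "c \<in> ?I"
    show "- (axis_deriv (Act c) (h \<circ> ?F) p * axis_deriv (Ang c) (k \<circ> ?F) p
          - axis_deriv (Ang c) (h \<circ> ?F) p * axis_deriv (Act c) (k \<circ> ?F) p)
      = (\<Sum>a\<in>tri n. \<Sum>b\<in>?J. - (L a c * N b c) * ?w a b)"
      unfolding A[OF h c] A[OF k c] B[OF h] B[OF k] by (rule skew_sum_product)
  qed
  also have "\<dots> = (\<Sum>a\<in>tri n. \<Sum>b\<in>?J. \<Sum>c\<in>?I. - (L a c * N b c) * ?w a b)"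
    by (subst sum.swap, rule sum.cong[OF refl], subst sum.swap) (rule refl)
  also have "\<dots> = (\<Sum>a\<in>tri n. \<Sum>b\<in>?J. pairing (trop_space n) a b * ?w a b)"
  proof (intro sum.cong refl)
    fix a b assume "a \<in> tri n" "b \<in> ?J"
    then show "(\<Sum>c\<in>?I. - (L a c * N b c) * ?w a b) = pairing (trop_space n) a b * ?w a b"
      using trop_pairing_sum[of a n b] unfolding L_def[symmetric] N_def[symmetric] sum_distrib_right[symmetric] sum_negf by simp
  qed
  also have "\<dots> = aa_bracket (trop_space n) h k (?F p)"
    by (subst aa_bracket_pairing) (simp_all del: space_simps(5,6))
  finally show "aa_bracket (GZ_space n) (h \<circ> ?F) (k \<circ> ?F) p = aa_bracket (trop_space n) h k (?F p)" .
qed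

theorem theorem1:
  fixes n :: nat
  assumes "n \<ge> 1"
  shows "\<exists>F \<alpha>. diffeomorphism (GZ_space n) (trop_space n) F \<and>
           poisson_map (GZ_space n) (trop_space n) F \<and>
           bij_betw \<alpha> (GZ_cone n) (trop_cone n) \<and>
           (\<forall>(x, w)\<in>points (GZ_space n). fst (F (x, w)) = \<alpha> x)"
proof (intro exI conjI)
  show "diffeomorphism (GZ_space n) (trop_space n) (GZ_to_trop n)" by (rule diffeomorphism_GZ_to_trop)
  show "poisson_map (GZ_space n) (trop_space n) (GZ_to_trop n)" by (rule poisson_GZ_to_trop)
  show "bij_betw (act_map n) (GZ_cone n) (trop_cone n)"
  proof (rule bij_betw_byWitness[where f' = "act_inv n"])
    show "\<forall>x\<in>GZ_cone n. act_inv n (act_map n x) = x" by (intro ballI act_inv_map) (simp add: GZ_cone_def)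
    show "\<forall>\<zeta>\<in>trop_cone n. act_map n (act_inv n \<zeta>) = \<zeta>" by (intro ballI act_map_inv) (simp add: trop_cone_def)
  qed (use act_map_cone act_inv_cone in blast)+
  show "\<forall>(x, w)\<in>points (GZ_space n). fst (GZ_to_trop n (x, w)) = act_map n x" by (simp add: GZ_to_trop_def)
qed

end
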